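(* Let $\rho>0$ be a continuously differentiable function of $Q$ such that, for some positive constants $C_1,C_2$: if $\rho'(Q)>0$, then $H'(Q)\leq C_1\,\rho(Q)$; and if $\rho'(Q)<0$, then $H'(Q)\geq C_2\,\rho(Q)$. Let the 1-forms $\Gamma=d\eta$ and $\omega$ smoothly satisfy, on $\Omega$, $$d\omega=\Gamma\wedge\omega,\qquad \delta\left[\rho(Q)\omega\right]=\ast\left(d\eta\wedge\ast\rho(Q)\omega\right),\qquad Q=|\omega|^2 .$$ Then the product $Q\rho(Q)$ is locally bounded above by the $L^2$-norm of $H$.
   Context: $\Omega$ is an open, finite domain of $\mathbb{R}^n$, $n\geq 2$, satisfying an interior sphere condition. Forms are scalar-valued and $\eta$ is a 0-form; $\ast$ is the Hodge involution, $\langle\alpha,\beta\rangle=\ast(\alpha\wedge\ast\beta)$, $|\alpha|^2=\langle\alpha,\alpha\rangle$; $d$ is the flat exterior derivative with formal adjoint $\delta$, where $\delta\alpha=-\ast d\ast\alpha$ on 1-forms (so $\delta\alpha=-\partial_i\alpha_i$). $Q=Q(\omega)=\langle\omega,\omega\rangle$ is viewed as a function of $\mathbf{x}\in\Omega$. The function $H=H(Q)$ is defined by $H'(Q)=\frac12\rho(Q)+Q\rho'(Q)$ (prime denotes $d/dQ$), normalized by $H(0)=0$. *)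

theory Defs
  imports "HOL-Analysis.Analysis"
begin

text \<open>
  An element of the exterior algebra over \<open>\<real>\<^sup>n\<close> is the family of its coefficients
  with respect to the basis \<open>dx\<^sub>I = dx\<^sub>i\<^sub>1 \<and> \<dots> \<and> dx\<^sub>i\<^sub>k\<close>, where
  \<open>I = {i\<^sub>1 < \<dots> < i\<^sub>k}\<close> ranges over the subsets of the index type. The
  linear order on the index type fixes the basis and the orientation; the numeral types
  supply such an index type for every dimension. A differential form is a field of such
  elements; only its values on the domain under consideration matter.
\<close>

type_synonym 'n ext = "'n set \<Rightarrow> real"
type_synonym 'n form = "real^'n \<Rightarrow> 'n ext"

text \<open>\<open>dx\<^sub>I \<and> dx\<^sub>J = shuffle_sign I J dx\<^bsub>I \<union> J\<^esub>\<close> for disjoint \<open>I\<close>, \<open>J\<close>.\<close>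

definition shuffle_sign :: "'n::{finite,linorder} set \<Rightarrow> 'n set \<Rightarrow> real" where
  "shuffle_sign I J = (-1) ^ card {(i, j). i \<in> I \<and> j \<in> J \<and> j < i}"

definition wedge :: "'n::{finite,linorder} ext \<Rightarrow> 'n ext \<Rightarrow> 'n ext" where
  "wedge a b = (\<lambda>K. \<Sum>I\<in>Pow K. shuffle_sign I (K - I) * a I * b (K - I))"

text \<open>Determined by \<open>dx\<^sub>I \<and> \<ast>dx\<^sub>I = dx\<^sub>1 \<and> \<dots> \<and> dx\<^sub>n\<close>,
  that is, \<open>\<ast>dx\<^sub>I = shuffle_sign I (- I) dx\<^bsub>- I\<^esub>\<close>.\<close>

definition hodge_star :: "'n::{finite,linorder} ext \<Rightarrow> 'n ext" where
  "hodge_star a = (\<lambda>K. shuffle_sign (- K) K * a (- K))"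

definition scale_ext :: "real \<Rightarrow> 'n ext \<Rightarrow> 'n ext" where
  "scale_ext c a = (\<lambda>I. c * a I)"

text \<open>The coefficient at \<open>{}\<close> turns the 0-form \<open>\<ast>(a \<and> \<ast>b)\<close> into a number.\<close>

definition ext_inner :: "'n::{finite,linorder} ext \<Rightarrow> 'n ext \<Rightarrow> real" where
  "ext_inner a b = hodge_star (wedge a (hodge_star b)) {}"

definition partial_deriv :: "'n::finite \<Rightarrow> (real^'n \<Rightarrow> real) \<Rightarrow> real^'n \<Rightarrow> real" where
  "partial_deriv i f x = frechet_derivative f (at x) (axis i 1)"

definition ext_d :: "'n::{finite,linorder} form \<Rightarrow> 'n form" where
  "ext_d \<alpha> x =
     (\<lambda>K. \<Sum>i\<in>K. shuffle_sign {i} (K - {i}) * partial_deriv i (\<lambda>y. \<alpha> y (K - {i})) x)"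

text \<open>The formal adjoint of \<open>d\<close> on 1-forms only; in other degrees the sign
  in front of \<open>\<ast>d\<ast>\<close> depends on the degree and on \<open>n\<close>.\<close>

definition codiff1 :: "'n::{finite,linorder} form \<Rightarrow> 'n form" where
  "codiff1 \<alpha> x = scale_ext (-1) (hodge_star (ext_d (\<lambda>y. hodge_star (\<alpha> y)) x))"

definition form_on :: "nat \<Rightarrow> (real^'n) set \<Rightarrow> 'n::finite form \<Rightarrow> bool" where
  "form_on k S \<alpha> \<longleftrightarrow> (\<forall>x\<in>S. \<forall>I. card I \<noteq> k \<longrightarrow> \<alpha> x I = 0)"

text \<open>\<open>Ck_on k S f\<close> is meant for open \<open>S\<close>.\<close>

primrec Ck_on :: "nat \<Rightarrow> (real^'n::finite) set \<Rightarrow> (real^'n \<Rightarrow> real) \<Rightarrow> bool" where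
  "Ck_on 0 S f \<longleftrightarrow> continuous_on S f"
| "Ck_on (Suc k) S f \<longleftrightarrow>
     (\<forall>x\<in>S. f differentiable (at x)) \<and> (\<forall>i. Ck_on k S (partial_deriv i f))"

definition smooth_form_on :: "(real^'n) set \<Rightarrow> 'n::finite form \<Rightarrow> bool" where
  "smooth_form_on S \<alpha> \<longleftrightarrow> (\<forall>I k. Ck_on k S (\<lambda>x. \<alpha> x I))"

definition interior_sphere_condition :: "'a::metric_space set \<Rightarrow> bool" where
  "interior_sphere_condition S \<longleftrightarrow>
     (\<forall>p\<in>frontier S. \<exists>c r. 0 < r \<and> ball c r \<subseteq> S \<and> p \<in> sphere c r)"

text \<open>The \<open>L\<^sup>2\<close>-norm with respect to Lebesgue measure, with value \<open>\<infinity>\<close> for a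
  measurable function that is not square integrable on \<open>U\<close>.\<close>

definition L2_norm :: "'a::euclidean_space set \<Rightarrow> ('a \<Rightarrow> real) \<Rightarrow> ennreal" where
  "L2_norm U f =
     (let J = (\<integral>\<^sup>+x\<in>U. ennreal ((f x)\<^sup>2) \<partial>lborel)
      in if J = \<infinity> then \<infinity> else ennreal (sqrt (enn2real J)))"

text \<open>
  \<open>\<rho>\<close> is a positive continuously differentiable function on \<open>[0,\<infinity>)\<close> with
  derivative \<open>\<rho>'\<close> (one-sided at \<open>0\<close>), and \<open>H\<close> is the primitive of
  \<open>\<rho>/2 + Q \<rho>'\<close> on \<open>[0,\<infinity>)\<close> that vanishes at \<open>0\<close>. The last two
  conjuncts are the bounds \<open>H' \<le> C1 \<rho>\<close> and \<open>H' \<ge> C2 \<rho>\<close>.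
\<close>

definition hodge_density :: "real \<Rightarrow> real \<Rightarrow> (real \<Rightarrow> real) \<Rightarrow> (real \<Rightarrow> real) \<Rightarrow> (real \<Rightarrow> real) \<Rightarrow> bool" where
  "hodge_density C1 C2 \<rho> \<rho>' H \<longleftrightarrow>
     (\<forall>q\<ge>0. 0 < \<rho> q) \<and>
     (\<forall>q\<ge>0. (\<rho> has_real_derivative \<rho>' q) (at q within {0..})) \<and>
     continuous_on {0..} \<rho>' \<and>
     H 0 = 0 \<and>
     (\<forall>q\<ge>0. (H has_real_derivative (1/2 * \<rho> q + q * \<rho>' q)) (at q within {0..})) \<and>
     (\<forall>q\<ge>0. 0 < \<rho>' q \<longrightarrow> 1/2 * \<rho> q + q * \<rho>' q \<le> C1 * \<rho> q) \<and>
     (\<forall>q\<ge>0. \<rho>' q < 0 \<longrightarrow> 1/2 * \<rho> q + q * \<rho>' q \<ge> C2 * \<rho> q)"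

end

theory Submission
  imports Defs
begin

text \<open>
  Write \<open>D\<^sub>i\<^sub>j = \<partial>\<^sub>i\<omega>\<^sub>j\<close>. Integrating \<open>\<partial>\<^sub>j(\<psi>\<omega>\<^sub>i) \<partial>\<^sub>i(\<rho>\<omega>\<^sub>j)\<close> by parts
  twice against a test function \<open>\<psi> \<ge> 0\<close> and inserting the two equations shows that
  \<open>v = H(Q)\<close> satisfies a weak inequality \<open>\<integral> W \<bullet> \<nabla>\<psi> \<le> B \<integral> \<psi> v\<close>: the second derivatives
  of \<open>\<omega>\<close> cancel, and the terms quadratic in \<open>D\<close> are nonnegative by the bounds on \<open>H'\<close>
  and absorb the mixed ones. Up to a multiple of \<open>v\<close>, the flux \<open>W\<close> is
  \<open>\<rho> (D\<omega>) + 2\<rho>' (D\<omega> \<bullet> \<omega>) \<omega>\<close>, a matrix applied to \<open>\<nabla>v = 2H' D\<omega>\<close> with eigenvalues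
  \<open>\<rho>/2H'\<close> and \<open>1\<close>, so it is uniformly elliptic with constants independent of
  \<open>\<omega>\<close> and \<open>\<rho>\<close>. De Giorgi's iteration, run with the Faber-Krahn inequality in place of the
  Sobolev inequality, bounds \<open>v\<close> at the centre of a ball by its \<open>L\<^sup>2\<close>-norm on
  the ball. Finally \<open>Q\<rho>(Q)\<close> is at most a constant times \<open>H(Q)\<close>.
\<close>

subsection \<open>Test functions\<close>

text \<open>As \<open>\<rho>\<close> is only C^1, so are \<open>\<rho> \<omega>\<close> and H(Q),
  and H(Q) satisfies no pointwise second-order inequality. Hence the weak formulation, and hence an
  integration by parts that is nothing but the symmetry of mixed partials for two C^1 functions. The
  test functions are merely C^1 too, being built from \<open>\<omega>\<close> and H(Q) themselves.
  The equation for \<open>\<omega>\<close> need not be uniformly elliptic, since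
  \<open>\<rho>\<close> may tend to 0 or to infinity with Q; only the ratio of \<open>\<rho>\<close>
  to H' is controlled. H is the right primitive because the derivative of
  \<open>\<rho>(Q) \<omega>\<close> in the variable \<open>\<omega>\<close> has the eigenvalue
  \<open>\<rho>\<close> + 2Q\<open>\<rho>'\<close> = 2H' along \<open>\<omega>\<close>, the factor
  that also appears in the gradient of H(Q). Because d\<open>\<omega>\<close> is not zero, the
  Jacobian of \<open>\<omega>\<close> is not symmetric, and every transposition costs a term with
  \<open>\<Gamma>\<close>. Each such term is at most a multiple of Q\<open>\<rho>\<close>(Q), hence
  of H(Q), or is absorbed by the squared Jacobian. No additive constant arises, so the final bound
  is homogeneous in H, with a constant depending only on n, C1, C2, the radius and a bound for
  \<open>\<Gamma>\<close>.\<close>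

definition C1_grad :: "'a::euclidean_space set \<Rightarrow> ('a \<Rightarrow> real) \<Rightarrow> ('a \<Rightarrow> 'a) \<Rightarrow> bool" where
  "C1_grad S f g \<longleftrightarrow> (\<forall>x\<in>S. GDERIV f x :> g x) \<and> continuous_on S g"

text \<open>C^1 regularity admits products of a cutoff with components of \<omega> or with
  truncations of H(Q). Closedness or compactness of \<open>K\<close> is assumed where it is
  used.\<close>

definition test_fun :: "'a::euclidean_space set \<Rightarrow> ('a \<Rightarrow> real) \<Rightarrow> ('a \<Rightarrow> 'a) \<Rightarrow> bool" where
  "test_fun K f g \<longleftrightarrow> C1_grad UNIV f g \<and> (\<forall>x. x \<notin> K \<longrightarrow> f x = 0)"

lemma GDERIV_transform_open:
  assumes "GDERIV f x :> d" "open T" "x \<in> T" "\<And>y. y \<in> T \<Longrightarrow> h y = f y"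
  shows "GDERIV h x :> d"
  using assms has_derivative_transform_within_open[of f _ x UNIV T h]
  unfolding gderiv_def by auto

lemma GDERIV_unique:
  assumes "GDERIV f x :> a" "GDERIV f x :> b" shows "a = b"
proof -
  have "(\<lambda>h. inner h a) = (\<lambda>h. inner h b)"
    using assms unfolding gderiv_def by (rule has_derivative_unique)
  from fun_cong[OF this] have "inner h (a - b) = 0" for h
    by (simp add: inner_diff_right)
  then have "inner (a - b) (a - b) = 0" .
  then show ?thesis by simp
qed

lemma C1_gradD: "C1_grad S f g \<Longrightarrow> x \<in> S \<Longrightarrow> GDERIV f x :> g x"
  and C1_grad_continuous_grad: "C1_grad S f g \<Longrightarrow> continuous_on S g"
  by (auto simp: C1_grad_def)

lemma C1_grad_continuous: "C1_grad S f g \<Longrightarrow> continuous_on S f"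
  unfolding C1_grad_def gderiv_def
  by (meson continuous_at_imp_continuous_on has_derivative_continuous)

lemma C1_grad_subset: "C1_grad S f g \<Longrightarrow> T \<subseteq> S \<Longrightarrow> C1_grad T f g"
  unfolding C1_grad_def by (meson continuous_on_subset subsetD)

lemma C1_grad_mult:
  "C1_grad S f g \<Longrightarrow> C1_grad S h k \<Longrightarrow> C1_grad S (\<lambda>x. f x * h x) (\<lambda>x. f x *\<^sub>R k x + h x *\<^sub>R g x)"
  using C1_grad_continuous[of S f g] C1_grad_continuous[of S h k]
  unfolding C1_grad_def by (simp add: GDERIV_mult continuous_on_add continuous_on_scaleR)

lemma C1_grad_compose:
  assumes "C1_grad S f g" "\<And>t. (p has_real_derivative p' t) (at t)" "continuous_on UNIV p'"
  shows "C1_grad S (\<lambda>x. p (f x)) (\<lambda>x. p' (f x) *\<^sub>R g x)"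
  using C1_grad_continuous[OF assms(1)] assms(1) unfolding C1_grad_def
  by (simp add: GDERIV_DERIV_compose assms(2) continuous_on_scaleR continuous_on_compose2[OF assms(3)])

lemma test_fun_grad_eq_0:
  assumes "test_fun K f g" "closed K" "x \<notin> K" shows "g x = 0"
proof -
  have "GDERIV f x :> 0"
    using assms by (intro GDERIV_transform_open[OF GDERIV_const, of "- K" x f 0])
      (auto simp: test_fun_def)
  moreover have "GDERIV f x :> g x"
    using assms by (simp add: test_fun_def C1_grad_def)
  ultimately show ?thesis using GDERIV_unique by blast
qed

text \<open>\<open>S\<close> and \<open>- K\<close> are open and cover the space, and on their
  overlap both the function and its gradient vanish. Functions known only on a ball become global
  test functions in this way.\<close>

lemma test_fun_extend:
  assumes "C1_grad S f g" "open S" "compact K" "K \<subseteq> S"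
    and "\<And>x. x \<in> S - K \<Longrightarrow> f x = 0"
  shows "test_fun K (\<lambda>x. if x \<in> S then f x else 0) (\<lambda>x. if x \<in> S then g x else 0)"
proof -
  let ?f = "\<lambda>x. if x \<in> S then f x else 0" and ?g = "\<lambda>x. if x \<in> S then g x else 0"
  have K: "open (- K)" using assms(3) compact_imp_closed by (auto simp: open_Compl)
  have der: "GDERIV ?f x :> ?g x" for x
  proof (cases "x \<in> S")
    case True
    then show ?thesis
      using GDERIV_transform_open[OF C1_gradD[OF assms(1) True] assms(2) True, of ?f] by simp
  next
    case False
    then have "x \<in> - K" using assms(4) by auto
    from GDERIV_transform_open[OF GDERIV_const K this, of ?f 0] show ?thesis
      using False assms(5) by auto
  qed
  have g0: "?g x = 0" if "x \<notin> K" for x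
  proof -
    have "GDERIV ?f x :> 0"
      using that assms(5) by (intro GDERIV_transform_open[OF GDERIV_const, of "- K" x _ 0]) (auto simp: K)
    from GDERIV_unique[OF der[of x] this] show ?thesis .
  qed
  have "continuous_on (S \<union> - K) ?g"
  proof (rule continuous_on_open_Un[OF assms(2) K])
    show "continuous_on S ?g"
      using C1_grad_continuous_grad[OF assms(1)] by (simp cong: continuous_on_cong)
    show "continuous_on (- K) ?g"
      using g0 by (subst continuous_on_cong[OF refl, of _ _ "\<lambda>_. 0"]) auto
  qed
  moreover have "S \<union> - K = UNIV" using assms(4) by auto
  ultimately show ?thesis
    unfolding test_fun_def C1_grad_def using der assms(5) by simp
qed

lemma test_fun_lipschitz:
  assumes "test_fun K f g" "compact K"
  obtains L where "0 \<le> L" "\<And>x. norm (g x) \<le> L" "\<And>x y. \<bar>f x - f y\<bar> \<le> L * norm (x - y)"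
proof -
  have "continuous_on UNIV g"
    using assms(1) by (simp add: test_fun_def C1_grad_def)
  then have "continuous_on K g"
    by (rule continuous_on_subset) simp
  then have "bounded (g ` K)"
    using assms(2) by (simp add: compact_continuous_image compact_imp_bounded)
  then obtain L where L: "0 < L" "\<And>x. x \<in> K \<Longrightarrow> norm (g x) \<le> L"
    unfolding bounded_pos by blast
  have g: "norm (g x) \<le> L" for x
    using L test_fun_grad_eq_0[OF assms(1) compact_imp_closed[OF assms(2)], of x]
    by (cases "x \<in> K") auto
  have "norm (f x - f y) \<le> L * norm (x - y)" for x y
  proof (rule differentiable_bound[of UNIV f "\<lambda>x h. inner h (g x)"])
    show "onorm (\<lambda>h. inner h (g z)) \<le> L" for z
    proof (rule onorm_le)
      fix h
      have "\<bar>inner h (g z)\<bar> \<le> norm h * norm (g z)" by (rule Cauchy_Schwarz_ineq2)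
      also have "\<dots> \<le> norm h * L" by (intro mult_left_mono g) auto
      finally show "norm (inner h (g z)) \<le> L * norm h" by (simp add: mult.commute)
    qed
    show "(f has_derivative (\<lambda>h. inner h (g z))) (at z within UNIV)" for z
      using assms(1) by (simp add: test_fun_def C1_grad_def gderiv_def)
  qed auto
  then show ?thesis using L(1) g that[of L] by auto
qed

section \<open>Compactly supported integrands and translation invariance\<close>

lemma integrable_compact_support:
  fixes f :: "'a::euclidean_space \<Rightarrow> real"
  assumes "continuous_on K f" "compact K" "\<And>x. x \<notin> K \<Longrightarrow> f x = 0"
  shows "integrable lborel f"
proof -
  have "(\<lambda>x. indicator K x *\<^sub>R f x) = f"
    using assms(3) by (auto simp: fun_eq_iff indicator_def)
  then show ?thesis using borel_integrable_compact[OF assms(2,1)] by simp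
qed

lemma integral_lborel_shift:
  fixes f :: "'a::euclidean_space \<Rightarrow> real"
  assumes "f \<in> borel_measurable borel"
  shows "(\<integral>x. f (x + c) \<partial>lborel) = (\<integral>x. f x \<partial>lborel)"
  using integral_distr[of "(+) c" lborel borel f] assms
  by (simp add: lborel_distr_plus add.commute)

lemma nn_integral_lborel_shift:
  assumes "f \<in> borel_measurable borel"
  shows "(\<integral>\<^sup>+x. f (x + c) \<partial>lborel) = (\<integral>\<^sup>+x. f x \<partial>(lborel :: 'a::euclidean_space measure))"
  using nn_integral_distr[of "(+) c" lborel borel f] assms
  by (simp add: lborel_distr_plus add.commute)

lemma continuous_on_shift:
  fixes f :: "'a::real_normed_vector \<Rightarrow> real"
  assumes "continuous_on UNIV f" shows "continuous_on UNIV (\<lambda>x. f (x + c))"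
  by (rule continuous_on_compose2[OF assms]) (auto intro!: continuous_intros)

lemma integrable_mult_shifts:
  fixes f h :: "'a::euclidean_space \<Rightarrow> real"
  assumes "continuous_on UNIV f" "continuous_on UNIV h" "compact K" "\<And>x. x \<notin> K \<Longrightarrow> f x = 0"
  shows "integrable lborel (\<lambda>x. f (x + a) * h (x + b))"
proof (rule integrable_compact_support)
  show "compact ((\<lambda>x. x - a) ` K)"
    by (intro compact_continuous_image continuous_intros assms)
  show "f (x + a) * h (x + b) = 0" if "x \<notin> (\<lambda>x. x - a) ` K" for x
  proof -
    have "x + a \<notin> K" using that by (force simp: image_iff)
    then show ?thesis using assms by simp
  qed
  have "continuous_on UNIV (\<lambda>x. f (x + a) * h (x + b))"
    by (intro continuous_on_mult continuous_on_shift assms)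
  then show "continuous_on ((\<lambda>x. x - a) ` K) (\<lambda>x. f (x + a) * h (x + b))"
    by (rule continuous_on_subset) simp
qed

subsection \<open>Difference quotients\<close>

lemma inverse_Suc_seq:
  "(\<lambda>n. inverse (real (Suc n))) \<longlonglongrightarrow> 0" "inverse (real (Suc n)) \<noteq> 0" "\<bar>inverse (real (Suc n))\<bar> \<le> 1"
  using LIMSEQ_inverse_real_of_nat by (auto simp: divide_simps)

definition diff_quot :: "('a::real_vector \<Rightarrow> real) \<Rightarrow> 'a \<Rightarrow> real \<Rightarrow> 'a \<Rightarrow> real" where
  "diff_quot f p s x = (f (x + s *\<^sub>R p) - f x) / s"

lemma diff_quot_tendsto:
  assumes "GDERIV f x :> d" "s \<longlonglongrightarrow> 0" "\<And>n. s n \<noteq> 0"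
  shows "(\<lambda>n. diff_quot f p (s n) x) \<longlonglongrightarrow> inner p d"
proof -
  have f: "(f has_derivative (\<lambda>h. inner h d)) (at (x + 0 *\<^sub>R p))"
    using assms(1) unfolding gderiv_def by simp
  have "((\<lambda>t. f (x + t *\<^sub>R p)) has_derivative (\<lambda>t. inner (t *\<^sub>R p) d)) (at 0)"
    by (rule has_derivative_compose[where f="\<lambda>t. x + t *\<^sub>R p", OF _ f])
      (auto intro!: derivative_eq_intros)
  then have "DERIV (\<lambda>t. f (x + t *\<^sub>R p)) 0 :> inner p d"
    by (simp add: has_field_derivative_def mult_commute_abs mult.commute)
  then have "((\<lambda>h. (f (x + h *\<^sub>R p) - f x) / h) \<longlongrightarrow> inner p d) (at 0)"
    by (simp add: DERIV_def)
  moreover have "filterlim s (at 0) sequentially"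
    using assms by (simp add: filterlim_at)
  ultimately show ?thesis
    unfolding diff_quot_def by (rule filterlim_compose)
qed

text \<open>Supplies the dominating function for the limit of difference quotients: the Lipschitz
  bound is uniform in the step, and steps of size at most 1 enlarge the support by at most
  \<open>norm p\<close>.\<close>

lemma diff_quot_bound:
  assumes "test_fun K f g" "compact K"
  obtains L B where "0 \<le> L"
    "\<And>s x. \<bar>s\<bar> \<le> 1 \<Longrightarrow> \<bar>diff_quot f p s x\<bar> \<le> L * indicator (cball 0 B) x"
proof -
  obtain L where L: "0 \<le> L" "\<And>x y. \<bar>f x - f y\<bar> \<le> L * norm (x - y)"
    using test_fun_lipschitz[OF assms] by metis
  obtain b where b: "\<And>x. x \<in> K \<Longrightarrow> norm x \<le> b"
    using compact_imp_bounded[OF assms(2)] by (auto simp: bounded_iff)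
  have "\<bar>diff_quot f p s x\<bar> \<le> (L * norm p) * indicator (cball 0 (b + norm p)) x"
    if "\<bar>s\<bar> \<le> 1" for s x
  proof (cases "x \<in> cball 0 (b + norm p)")
    case True
    show ?thesis
    \<comment> \<open>A zero step means division by zero, so the quotient is 0 and the bound is
      trivial.\<close>
    proof (cases "s = 0")
      case False
      have "\<bar>f (x + s *\<^sub>R p) - f x\<bar> \<le> L * (\<bar>s\<bar> * norm p)"
        using L(2)[of "x + s *\<^sub>R p" x] by simp
      then have "\<bar>f (x + s *\<^sub>R p) - f x\<bar> / \<bar>s\<bar> \<le> L * norm p"
        using False by (simp add: divide_simps mult.commute mult.left_commute)
      then show ?thesis using True by (simp add: diff_quot_def)
    qed (use L True in \<open>simp add: diff_quot_def\<close>)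
  next
    case False
    have s: "norm (s *\<^sub>R p) \<le> norm p" using that by (simp add: mult_left_le_one_le)
    have "x \<notin> K" using False b[of x] norm_ge_zero[of p] by auto
    moreover have "x + s *\<^sub>R p \<notin> K"
    proof
      assume "x + s *\<^sub>R p \<in> K"
      then have "norm (x + s *\<^sub>R p) \<le> b" by (rule b)
      moreover have "norm x \<le> norm (x + s *\<^sub>R p) + norm (s *\<^sub>R p)"
        by (metis add_diff_cancel norm_triangle_ineq4)
      ultimately show False using False s by simp
    qed
    ultimately show ?thesis using assms(1) L(1) by (simp add: test_fun_def diff_quot_def)
  qed
  then show ?thesis using that[of "L * norm p" "b + norm p"] L(1) by simp
qed

lemma diff_quot_measurable:
  fixes f :: "'a::euclidean_space \<Rightarrow> real"
  assumes "continuous_on UNIV f" shows "diff_quot f p s \<in> borel_measurable borel"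
  unfolding diff_quot_def
  by (intro borel_measurable_divide borel_measurable_diff borel_measurable_const
      borel_measurable_continuous_onI continuous_on_shift assms)

lemma test_fun_continuous:
  assumes "test_fun K f g" shows "continuous_on S f" "continuous_on S g"
  using assms C1_grad_continuous C1_grad_continuous_grad C1_grad_subset[of UNIV f g S]
  unfolding test_fun_def by blast+

lemma integral_diff_quot_tendsto:
  assumes f: "test_fun K f g" "compact K" and h: "test_fun J h k" "compact J"
    and s: "s \<longlonglongrightarrow> 0" "\<And>n. s n \<noteq> 0" "\<And>n. \<bar>s n\<bar> \<le> 1"
  shows "(\<lambda>n. \<integral>x. diff_quot f p (s n) x * diff_quot h q (s n) x \<partial>lborel)
    \<longlonglongrightarrow> (\<integral>x. inner p (g x) * inner q (k x) \<partial>lborel)"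
proof -
  obtain L B where L: "0 \<le> L"
    "\<And>s x. \<bar>s\<bar> \<le> 1 \<Longrightarrow> \<bar>diff_quot f p s x\<bar> \<le> L * indicator (cball 0 B) x"
    using diff_quot_bound[OF f] by metis
  obtain L' B' where L': "0 \<le> L'"
    "\<And>s x. \<bar>s\<bar> \<le> 1 \<Longrightarrow> \<bar>diff_quot h q s x\<bar> \<le> L' * indicator (cball 0 B') x"
    using diff_quot_bound[OF h] by metis
  note cont = test_fun_continuous[OF f(1)] test_fun_continuous[OF h(1)]
  show ?thesis
  proof (rule integral_dominated_convergence)
    show "(\<lambda>x. inner p (g x) * inner q (k x)) \<in> borel_measurable lborel"
      by (simp, intro borel_measurable_continuous_onI continuous_on_mult continuous_on_inner continuous_on_const cont)
    show "(\<lambda>x. diff_quot f p (s n) x * diff_quot h q (s n) x) \<in> borel_measurable lborel" for n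
      using diff_quot_measurable[OF cont(1)[of UNIV]] diff_quot_measurable[OF cont(3)[of UNIV]]
      by (simp add: borel_measurable_times)
    have "integrable lborel (\<lambda>x. (L * L') * indicat_real (cball 0 B) x)"
      by (intro integrable_mult_right integrable_real_indicator emeasure_lborel_cball_finite) auto
    then show "integrable lborel (\<lambda>x. L * L' * indicat_real (cball 0 B) x)" .
    have "(\<lambda>n. diff_quot f p (s n) x * diff_quot h q (s n) x) \<longlonglongrightarrow> inner p (g x) * inner q (k x)" for x
      using f(1) h(1) by (intro tendsto_mult diff_quot_tendsto s) (auto simp: test_fun_def C1_grad_def)
    then show "AE x in lborel. (\<lambda>n. diff_quot f p (s n) x * diff_quot h q (s n) x)
        \<longlonglongrightarrow> inner p (g x) * inner q (k x)" by simp
    have "\<bar>diff_quot f p (s n) x\<bar> * \<bar>diff_quot h q (s n) x\<bar> \<le> (L * indicator (cball 0 B) x) * L'" for n x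
    proof (rule mult_mono)
      have "L' * indicat_real (cball 0 B') x \<le> L'"
        using L'(1) by (simp add: mult_left_le indicator_le_1)
      then show "\<bar>diff_quot h q (s n) x\<bar> \<le> L'" using L'(2)[OF s(3), of n x] by linarith
    qed (use L(2)[OF s(3), of n x] L(1) in auto)
    then show "AE x in lborel. norm (diff_quot f p (s n) x * diff_quot h q (s n) x)
        \<le> L * L' * indicat_real (cball 0 B) x" for n
      by (intro AE_I2) (simp add: abs_mult ac_simps)
  qed
qed

text \<open>Summation by parts moves both translations from one factor to the other, so no second
  derivative is needed.\<close>

lemma integral_partials_commute:
  assumes f: "test_fun K f g" "compact K" and h: "test_fun J h k" "compact J"
  shows "(\<integral>x. inner p (g x) * inner q (k x) \<partial>lborel) = (\<integral>x. inner q (g x) * inner p (k x) \<partial>lborel)"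
proof -
  define s :: "nat \<Rightarrow> real" where "s = (\<lambda>n. inverse (real (Suc n)))"
  have s: "s \<longlonglongrightarrow> 0" "s n \<noteq> 0" "\<bar>s n\<bar> \<le> 1" for n
    unfolding s_def by (fact inverse_Suc_seq)+
  have s': "(\<lambda>n. - s n) \<longlonglongrightarrow> 0" "\<And>n. - s n \<noteq> 0" "\<And>n. \<bar>- s n\<bar> \<le> 1"
    using s tendsto_minus[OF s(1)] by auto
  have cont: "continuous_on UNIV f" "continuous_on UNIV h"
    using test_fun_continuous f h by blast+
  have z: "\<And>x. x \<notin> K \<Longrightarrow> f x = 0" using f by (simp add: test_fun_def)
  define I where "I a b = (\<integral>x. f (x + a) * h (x + b) \<partial>lborel)" for a b
  have int: "integrable lborel (\<lambda>x. f (x + a) * h (x + b))" for a b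
    by (rule integrable_mult_shifts[OF cont f(2) z])
  have shift: "I a b = I (a + c) (b + c)" for a b c
    unfolding I_def
    using integral_lborel_shift[of "\<lambda>x. f (x + a) * h (x + b)" c]
      borel_measurable_integrable[OF int[of a b]]
    by (simp add: algebra_simps)
  have expand: "(\<integral>x. diff_quot f a t x * diff_quot h b t x \<partial>lborel)
      = (I (t *\<^sub>R a) (t *\<^sub>R b) - I (t *\<^sub>R a) 0 - I 0 (t *\<^sub>R b) + I 0 0) / t\<^sup>2" for a b t
  proof -
    have "diff_quot f a t x * diff_quot h b t x
      = (f (x + t *\<^sub>R a) * h (x + t *\<^sub>R b) - f (x + t *\<^sub>R a) * h (x + 0)
        - f (x + 0) * h (x + t *\<^sub>R b) + f (x + 0) * h (x + 0)) / t\<^sup>2" for x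
      by (simp add: diff_quot_def power2_eq_square algebra_simps)
    then show ?thesis unfolding I_def by (simp add: int del: add_0_right)
  qed
  \<comment> \<open>\<open>I a b\<close> depends only on the difference of \<open>a\<close> and
    \<open>b\<close>, so the four terms for directions \<open>p\<close>, \<open>q\<close> and step
    \<open>t\<close> match those for \<open>q\<close>, \<open>p\<close> and step \<open>- t\<close>.
    This is why the other limit is taken along \<open>- s n\<close>.\<close>
  have "(\<integral>x. diff_quot f p t x * diff_quot h q t x \<partial>lborel)
      = (\<integral>x. diff_quot f q (- t) x * diff_quot h p (- t) x \<partial>lborel)" for t
    unfolding expand
    using shift[of "- (t *\<^sub>R q)" "- (t *\<^sub>R p)" "t *\<^sub>R p + t *\<^sub>R q"]
      shift[of "- (t *\<^sub>R q)" 0 "t *\<^sub>R q"] shift[of 0 "- (t *\<^sub>R p)" "t *\<^sub>R p"]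
    by simp
  then have "(\<lambda>n. \<integral>x. diff_quot f p (s n) x * diff_quot h q (s n) x \<partial>lborel)
    \<longlonglongrightarrow> (\<integral>x. inner q (g x) * inner p (k x) \<partial>lborel)"
    using integral_diff_quot_tendsto[OF f h s', of q p] by simp
  with integral_diff_quot_tendsto[OF f h s, of p q] show ?thesis
    by (rule LIMSEQ_unique)
qed

subsection \<open>The Faber-Krahn inequality\<close>

lemma sum_lessThan_squared_le: "(\<Sum>k<n. f k)\<^sup>2 \<le> real n * (\<Sum>k<n. (f k)\<^sup>2)"
  using sum_squared_le_sum_of_squares[of f "{..<n}"] by (simp add: mult.commute)

text \<open>The shift by \<open>h\<close> is cut into \<open>N\<close> equal pieces. Cauchy-Schwarz
  costs a factor \<open>N\<close>, and by translation invariance all \<open>N\<close> pieces have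
  the same integral; the resulting factor \<open>N\<close> squared turns one piece into a squared
  difference quotient with step 1/\<open>N\<close>, whose integral converges to the right-hand
  side.\<close>

lemma integral_translation_difference:
  assumes u: "test_fun K u g" "compact K"
  shows "(\<integral>x. (u (x + h) - u x)\<^sup>2 \<partial>lborel) \<le> (\<integral>x. (inner h (g x))\<^sup>2 \<partial>lborel)"
proof -
  define s :: "nat \<Rightarrow> real" where "s = (\<lambda>n. inverse (real (Suc n)))"
  have s: "s \<longlonglongrightarrow> 0" "s n \<noteq> 0" "\<bar>s n\<bar> \<le> 1" for n
    unfolding s_def by (fact inverse_Suc_seq)+
  have cont: "continuous_on UNIV u" using test_fun_continuous u by blast
  have z: "\<And>x. x \<notin> K \<Longrightarrow> u x = 0" using u by (simp add: test_fun_def)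
  have int: "integrable lborel (\<lambda>x. (u (x + a) - u (x + b))\<^sup>2)" for a b
  proof -
    have "(u (x + a) - u (x + b))\<^sup>2 = u (x + a) * u (x + a) - 2 * (u (x + a) * u (x + b)) + u (x + b) * u (x + b)" for x
      by (simp add: power2_eq_square algebra_simps)
    then show ?thesis
      using integrable_mult_shifts[OF cont cont u(2) z] by simp
  qed
  have "(\<integral>x. (u (x + h) - u x)\<^sup>2 \<partial>lborel) \<le> (\<integral>x. diff_quot u h (s n) x * diff_quot u h (s n) x \<partial>lborel)" for n
  proof -
    define N where "N = Suc n"
    define t where "t = s n"
    have Nt: "real N * t = 1" "inverse t = real N"
      by (simp_all add: N_def t_def s_def del: of_nat_Suc)
    define E where "E k x = (u (x + (real k * t) *\<^sub>R h + t *\<^sub>R h) - u (x + (real k * t) *\<^sub>R h))\<^sup>2" for k x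
    have intE: "integrable lborel (E k)" for k
      unfolding E_def using int[of "(real k * t) *\<^sub>R h + t *\<^sub>R h" "(real k * t) *\<^sub>R h"]
      by (simp add: add.assoc)
    have pointwise: "(u (x + h) - u x)\<^sup>2 \<le> real N * (\<Sum>k<N. E k x)" for x
    proof -
      let ?a = "\<lambda>k. u (x + (real k * t) *\<^sub>R h)"
      have a: "?a (Suc k) = u (x + (real k * t) *\<^sub>R h + t *\<^sub>R h)" for k
        by (simp add: scaleR_add_left distrib_right add_ac)
      have tel: "u (x + h) - u x = (\<Sum>k<N. ?a (Suc k) - ?a k)"
        by (rule trans[OF _ sum_lessThan_telescope[symmetric]]) (simp add: Nt(1))
      have "(u (x + h) - u x)\<^sup>2 \<le> real N * (\<Sum>k<N. (?a (Suc k) - ?a k)\<^sup>2)"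
        unfolding tel by (rule sum_lessThan_squared_le)
      then show ?thesis by (simp only: a E_def)
    qed
    have le: "(\<integral>x. (u (x + h) - u x)\<^sup>2 \<partial>lborel) \<le> (\<integral>x. real N * (\<Sum>k<N. E k x) \<partial>lborel)"
    proof (rule integral_mono)
      show "integrable lborel (\<lambda>x. (u (x + h) - u x)\<^sup>2)" using int[of h 0] by simp
      show "integrable lborel (\<lambda>x. real N * (\<Sum>k<N. E k x))" using intE by simp
    qed (rule pointwise)
    have shift: "(\<integral>x. E k x \<partial>lborel) = (\<integral>x. E 0 x \<partial>lborel)" for k
    proof -
      have "E k x = E 0 (x + (real k * t) *\<^sub>R h)" for x by (simp add: E_def)
      then show ?thesis
        using integral_lborel_shift[of "E 0" "(real k * t) *\<^sub>R h"] borel_measurable_integrable[OF intE[of 0]]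
        by simp
    qed
    have "diff_quot u h t x * diff_quot u h t x = (real N)\<^sup>2 * E 0 x" for x
      by (simp add: diff_quot_def E_def divide_inverse Nt(2) power2_eq_square)
    then have "(\<integral>x. diff_quot u h t x * diff_quot u h t x \<partial>lborel) = (real N)\<^sup>2 * (\<integral>x. E 0 x \<partial>lborel)"
      by simp
    moreover have "(\<Sum>k<N. \<integral>x. E k x \<partial>lborel) = (\<Sum>k<N. \<integral>x. E 0 x \<partial>lborel)"
      by (intro sum.cong refl shift)
    then have "(\<integral>x. real N * (\<Sum>k<N. E k x) \<partial>lborel) = (real N)\<^sup>2 * (\<integral>x. E 0 x \<partial>lborel)"
      using intE by (simp add: Bochner_Integration.integral_sum power2_eq_square)
    ultimately show ?thesis
      using le by (simp only: t_def)
  qed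
  moreover have "(\<lambda>n. \<integral>x. diff_quot u h (s n) x * diff_quot u h (s n) x \<partial>lborel)
    \<longlonglongrightarrow> (\<integral>x. inner h (g x) * inner h (g x) \<partial>lborel)"
    by (rule integral_diff_quot_tendsto[OF u u s])
  ultimately have "(\<integral>x. (u (x + h) - u x)\<^sup>2 \<partial>lborel) \<le> (\<integral>x. inner h (g x) * inner h (g x) \<partial>lborel)"
    by (intro LIMSEQ_le_const) auto
  then show ?thesis by (simp add: power2_eq_square)
qed

text \<open>Averaging \<open>u(x)\<^sup>2 \<le> (u(x+h) - u(x))\<^sup>2 + u(x)\<^sup>2 1\<^sub>S(x+h) + u(x+h)\<^sup>2 1\<^sub>S(x)\<close>, where
  \<open>S\<close> is the set on which \<open>u\<close> does not vanish, over the shifts \<open>h\<close> in the ball of radius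
  \<open>r\<close>.\<close>

lemma faber_krahn:
  fixes u :: "'a::euclidean_space \<Rightarrow> real"
  assumes u: "test_fun K u g" "compact K" and "0 < r"
    and small: "emeasure lborel {x. u x \<noteq> 0} \<le> ennreal (measure lborel (ball (0::'a) r) / 4)"
  shows "(\<integral>x. (u x)\<^sup>2 \<partial>lborel) \<le> 2 * r\<^sup>2 * (\<integral>x. (norm (g x))\<^sup>2 \<partial>lborel)"
proof -
  define I where "I = (\<integral>x. (u x)\<^sup>2 \<partial>lborel)"
  define G where "G = (\<integral>x. (norm (g x))\<^sup>2 \<partial>lborel)"
  define V where "V = measure lborel (ball (0::'a) r)"
  define S where "S = {x. u x \<noteq> 0}"
  have V: "0 < V" using assms(3) by (simp add: V_def)
  have cont: "continuous_on UNIV u" "continuous_on UNIV g"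
    using test_fun_continuous[OF u(1)] by auto
  have z: "\<And>x. x \<notin> K \<Longrightarrow> u x = 0" using u by (simp add: test_fun_def)
  have gz: "\<And>x. x \<notin> K \<Longrightarrow> g x = 0"
    using test_fun_grad_eq_0[OF u(1) compact_imp_closed[OF u(2)]] .
  have [measurable]: "u \<in> borel_measurable borel"
    using cont by (intro borel_measurable_continuous_onI)
  have [measurable]: "S \<in> sets borel"
    unfolding S_def by measurable
  have intu: "integrable lborel (\<lambda>x. (u x)\<^sup>2)"
    using z by (intro integrable_compact_support[OF _ u(2)] continuous_on_power continuous_on_subset[OF cont(1)]) auto
  have intg: "integrable lborel (\<lambda>x. (norm (g x))\<^sup>2)"
    using gz by (intro integrable_compact_support[OF _ u(2)] continuous_on_power continuous_on_norm
        continuous_on_subset[OF cont(2)]) auto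
  have inthg: "integrable lborel (\<lambda>x. (inner h (g x))\<^sup>2)" for h
    using gz by (intro integrable_compact_support[OF _ u(2)] continuous_on_power continuous_on_inner
        continuous_on_const continuous_on_subset[OF cont(2)]) auto
  have intd: "integrable lborel (\<lambda>x. (u (x + h) - u x)\<^sup>2)" for h
  proof -
    have "(u (x + h) - u x)\<^sup>2 = u (x + h) * u (x + h) - 2 * (u (x + h) * u (x + 0)) + u (x + 0) * u (x + 0)" for x
      by (simp add: power2_eq_square algebra_simps)
    then show ?thesis
      using integrable_mult_shifts[OF cont(1) cont(1) u(2) z] by (simp del: add_0_right)
  qed
  have I0: "0 \<le> I" and G0: "0 \<le> G" by (simp_all add: I_def G_def)
  have nnu: "(\<integral>\<^sup>+x. ennreal ((u x)\<^sup>2) \<partial>lborel) = ennreal I"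
    unfolding I_def by (intro nn_integral_eq_integral intu) simp
  define A where "A h = (\<integral>\<^sup>+x. ennreal ((u x)\<^sup>2) * indicator S (x + h) \<partial>lborel)" for h
  define A' where "A' h = (\<integral>\<^sup>+x. ennreal ((u (x + h))\<^sup>2) * indicator S x \<partial>lborel)" for h
  have mA [measurable]: "A \<in> borel_measurable borel" "A' \<in> borel_measurable borel"
    unfolding A_def A'_def by measurable
  have shiftle: "ennreal I \<le> ennreal (r\<^sup>2 * G) + A h + A' h" if "h \<in> ball 0 r" for h
  proof -
    \<comment> \<open>If \<open>u\<close> vanishes at \<open>x + h\<close>, the first term alone is
      \<open>u x\<close> squared; if it vanishes at neither point, the second term is.\<close>
    have pt: "(u x)\<^sup>2 \<le> (u (x + h) - u x)\<^sup>2 + (u x)\<^sup>2 * indicator S (x + h) + (u (x + h))\<^sup>2 * indicator S x" for x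
    proof (cases "u x = 0 \<or> u (x + h) = 0")
      case False
      then show ?thesis by (simp add: S_def)
    qed (auto simp: S_def)
    have "ennreal I \<le> (\<integral>\<^sup>+x. ennreal ((u (x + h) - u x)\<^sup>2) + ennreal ((u x)\<^sup>2) * indicator S (x + h)
        + ennreal ((u (x + h))\<^sup>2) * indicator S x \<partial>lborel)"
      unfolding nnu[symmetric]
    proof (rule nn_integral_mono)
      fix x
      show "ennreal ((u x)\<^sup>2) \<le> ennreal ((u (x + h) - u x)\<^sup>2) + ennreal ((u x)\<^sup>2) * indicator S (x + h)
        + ennreal ((u (x + h))\<^sup>2) * indicator S x"
        using ennreal_leI[OF pt[of x]]
        by (simp add: ennreal_plus ennreal_mult ennreal_indicator del: ennreal_plus[symmetric])
    qed
    also have "\<dots> = (\<integral>\<^sup>+x. ennreal ((u (x + h) - u x)\<^sup>2) \<partial>lborel) + A h + A' h"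
      unfolding A_def A'_def by (subst nn_integral_add; simp)+
    also have "(\<integral>\<^sup>+x. ennreal ((u (x + h) - u x)\<^sup>2) \<partial>lborel) = ennreal (\<integral>x. (u (x + h) - u x)\<^sup>2 \<partial>lborel)"
      by (intro nn_integral_eq_integral intd) simp
    also have "(\<integral>x. (u (x + h) - u x)\<^sup>2 \<partial>lborel) \<le> r\<^sup>2 * G"
    proof -
      have "(inner h (g x))\<^sup>2 \<le> r\<^sup>2 * (norm (g x))\<^sup>2" for x
      proof -
        have "\<bar>inner h (g x)\<bar> \<le> norm h * norm (g x)" by (rule Cauchy_Schwarz_ineq2)
        also have "\<dots> \<le> r * norm (g x)" using that by (intro mult_right_mono) auto
        finally have "\<bar>inner h (g x)\<bar>\<^sup>2 \<le> (r * norm (g x))\<^sup>2" by (rule power_mono) simp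
        then show ?thesis by (simp add: power_mult_distrib)
      qed
      then have "(\<integral>x. (inner h (g x))\<^sup>2 \<partial>lborel) \<le> (\<integral>x. r\<^sup>2 * (norm (g x))\<^sup>2 \<partial>lborel)"
        by (intro integral_mono inthg integrable_mult_right intg)
      then show ?thesis
        using integral_translation_difference[OF u, of h] by (simp add: G_def)
    qed
    finally show ?thesis
      by (simp add: add_right_mono ennreal_leI)
  qed
  have A: "(\<integral>\<^sup>+h. A h \<partial>lborel) = ennreal I * emeasure lborel S"
  proof -
    have "(\<integral>\<^sup>+h. A h \<partial>lborel) = (\<integral>\<^sup>+x. \<integral>\<^sup>+h. ennreal ((u x)\<^sup>2) * indicator S (x + h) \<partial>lborel \<partial>lborel)"
      unfolding A_def by (intro lborel_pair.Fubini') measurable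
    also have "\<dots> = (\<integral>\<^sup>+x. ennreal ((u x)\<^sup>2) * emeasure lborel S \<partial>lborel)"
    proof (intro nn_integral_cong)
      fix x
      have "(\<integral>\<^sup>+h. ennreal ((u x)\<^sup>2) * indicator S (x + h) \<partial>lborel)
          = ennreal ((u x)\<^sup>2) * (\<integral>\<^sup>+h. indicator S (h + x) \<partial>lborel)"
        by (subst nn_integral_cmult) (simp_all add: add.commute)
      then show "(\<integral>\<^sup>+h. ennreal ((u x)\<^sup>2) * indicator S (x + h) \<partial>lborel) = ennreal ((u x)\<^sup>2) * emeasure lborel S"
        using nn_integral_lborel_shift[of "indicator S" x] by simp
    qed
    also have "\<dots> = ennreal I * emeasure lborel S"
      by (subst nn_integral_multc) (simp_all add: nnu)
    finally show ?thesis .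
  qed
  have A': "(\<integral>\<^sup>+h. A' h \<partial>lborel) = ennreal I * emeasure lborel S"
  proof -
    have "(\<integral>\<^sup>+h. A' h \<partial>lborel) = (\<integral>\<^sup>+x. \<integral>\<^sup>+h. ennreal ((u (x + h))\<^sup>2) * indicator S x \<partial>lborel \<partial>lborel)"
      unfolding A'_def by (intro lborel_pair.Fubini') measurable
    also have "\<dots> = (\<integral>\<^sup>+x. ennreal I * indicator S x \<partial>lborel)"
    proof (intro nn_integral_cong)
      fix x
      have "(\<integral>\<^sup>+h. ennreal ((u (x + h))\<^sup>2) * indicator S x \<partial>lborel)
          = (\<integral>\<^sup>+h. ennreal ((u (h + x))\<^sup>2) \<partial>lborel) * indicator S x"
        by (subst nn_integral_multc) (simp_all add: add.commute)
      then show "(\<integral>\<^sup>+h. ennreal ((u (x + h))\<^sup>2) * indicator S x \<partial>lborel) = ennreal I * indicator S x"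
        using nn_integral_lborel_shift[of "\<lambda>y. ennreal ((u y)\<^sup>2)" x] by (simp add: nnu)
    qed
    also have "\<dots> = ennreal I * emeasure lborel S"
      by (subst nn_integral_cmult_indicator) simp_all
    finally show ?thesis .
  qed
  have ball: "emeasure lborel (ball (0::'a) r) = ennreal V"
    using emeasure_lborel_ball_finite[of "0::'a" r] by (simp add: V_def emeasure_eq_ennreal_measure)
  have "ennreal (I * V) = (\<integral>\<^sup>+h. ennreal I * indicator (ball (0::'a) r) h \<partial>lborel)"
    using I0 V by (simp add: nn_integral_cmult_indicator ball ennreal_mult)
  \<comment> \<open>Off the ball the left integrand is 0, so \<open>A\<close> and \<open>A'\<close>
    may be integrated over all shifts, where Fubini gives exactly \<open>I\<close> times the measure
    of \<open>S\<close>.\<close>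
  also have "\<dots> \<le> (\<integral>\<^sup>+h. ennreal (r\<^sup>2 * G) * indicator (ball (0::'a) r) h + A h + A' h \<partial>lborel)"
    by (intro nn_integral_mono) (use shiftle in \<open>auto simp: indicator_def\<close>)
  also have "\<dots> = ennreal (r\<^sup>2 * G * V) + ennreal I * emeasure lborel S + ennreal I * emeasure lborel S"
  proof -
    have "(\<integral>\<^sup>+h. ennreal (r\<^sup>2 * G) * indicator (ball (0::'a) r) h \<partial>lborel) = ennreal (r\<^sup>2 * G * V)"
      using G0 V by (simp add: nn_integral_cmult_indicator ball ennreal_mult[symmetric])
    moreover have m0: "(\<lambda>h. ennreal (r\<^sup>2 * G) * indicator (ball (0::'a) r) h) \<in> borel_measurable borel"
      by (intro borel_measurable_times_ennreal borel_measurable_const borel_measurable_indicator borel_open open_ball)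
    moreover have "(\<lambda>h. ennreal (r\<^sup>2 * G) * indicator (ball (0::'a) r) h + A h) \<in> borel_measurable borel"
      by (intro borel_measurable_add m0 mA)
    ultimately show ?thesis
      using nn_integral_add[of "\<lambda>h. ennreal (r\<^sup>2 * G) * indicator (ball (0::'a) r) h + A h" lborel A']
        nn_integral_add[of "\<lambda>h. ennreal (r\<^sup>2 * G) * indicator (ball (0::'a) r) h" lborel A]
      by (simp add: A A' mA)
  qed
  \<comment> \<open>The two error terms add up to half of \<open>I * V\<close> and are absorbed on
    the left. This explains the 1/4 in the smallness hypothesis and the factor 2 in the
    conclusion.\<close>
  also have "\<dots> \<le> ennreal (r\<^sup>2 * G * V) + ennreal I * ennreal (V / 4) + ennreal I * ennreal (V / 4)"
    using small unfolding S_def V_def by (intro add_mono mult_left_mono) auto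
  also have "\<dots> = ennreal (r\<^sup>2 * G * V + I * (V / 4) + I * (V / 4))"
    using I0 G0 V by (simp add: ennreal_mult[symmetric] ennreal_plus[symmetric] del: ennreal_plus)
  finally have "I * V \<le> r\<^sup>2 * G * V + I * (V / 4) + I * (V / 4)"
    using I0 G0 V by (subst (asm) ennreal_le_iff) auto
  then have "I * V \<le> (2 * r\<^sup>2 * G) * V" by (simp add: algebra_simps)
  then show ?thesis using V by (simp add: I_def G_def)
qed

subsection \<open>Cutoff and truncation functions\<close>

text \<open>\<open>max 0 t\<close> has a corner at 0, but \<open>f' 0 = 0\<close> makes the constant
  branch on the left join \<open>f\<close> with equal slope. Cutoffs and truncations below are
  smoothed by this device.\<close>

lemma DERIV_compose_max_0:
  fixes f :: "real \<Rightarrow> real"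
  assumes f: "\<And>q. 0 \<le> q \<Longrightarrow> (f has_real_derivative f' q) (at q)" and "f' 0 = 0"
  shows "((\<lambda>t. f (max 0 t)) has_real_derivative f' (max 0 t)) (at t)"
proof -
  consider "t < 0" | "t = 0" | "0 < t" by linarith
  then show ?thesis
  proof cases
    case 1
    have "((\<lambda>t. f (max 0 t)) has_real_derivative 0) (at t)"
      by (rule has_field_derivative_transform_within_open[of "\<lambda>_. f 0" _ _ "{..<0}"]) (use 1 in auto)
    then show ?thesis using 1 assms(2) by simp
  next
    case 3
    have "((\<lambda>t. f (max 0 t)) has_real_derivative f' t) (at t)"
      by (rule has_field_derivative_transform_within_open[of f _ _ "{0<..}"]) (use 3 f in auto)
    then show ?thesis using 3 by simp
  next
    case 2
    have "((\<lambda>h. (f (0 + h) - f 0) / h) \<longlongrightarrow> 0) (at 0)"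
      using f[of 0] assms(2) by (simp add: DERIV_def)
    then have "((\<lambda>h. norm ((f (0 + h) - f 0) / h)) \<longlongrightarrow> 0) (at 0)"
      by (rule tendsto_norm_zero)
    then have "((\<lambda>h. (f (max 0 (0 + h)) - f (max 0 0)) / h) \<longlongrightarrow> 0) (at 0)"
      by (rule Lim_null_comparison[rotated]) (auto intro!: always_eventually simp: max_def divide_le_0_iff)
    then show ?thesis using 2 assms(2) by (simp add: DERIV_def)
  qed
qed

text \<open>On [0,1] this is 1 - (1 - t^2)^2, whose derivative 4t(1 - t^2) vanishes at both ends: a
  piecewise polynomial C^1 step from 0 to 1.\<close>

definition cut :: "real \<Rightarrow> real" where
  "cut t = 1 - (max 0 (1 - (max 0 t)\<^sup>2))\<^sup>2"

definition cut' :: "real \<Rightarrow> real" where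
  "cut' t = 4 * max 0 (1 - (max 0 t)\<^sup>2) * max 0 t"

lemma DERIV_max_0_squared: "((\<lambda>t. (max 0 t)\<^sup>2) has_real_derivative 2 * max 0 t) (at (t::real))"
  by (rule DERIV_compose_max_0[where f="\<lambda>q. q\<^sup>2" and f'="\<lambda>q. 2 * q"])
    (auto intro!: derivative_eq_intros)

lemma DERIV_cut: "(cut has_real_derivative cut' t) (at t)"
proof -
  have "((\<lambda>t. 1 - (max 0 t)\<^sup>2) has_real_derivative - (2 * max 0 t)) (at t)"
    using DERIV_diff[OF DERIV_const DERIV_max_0_squared] by simp
  from DERIV_diff[OF DERIV_const DERIV_chain2[OF DERIV_max_0_squared this], of 1]
  show ?thesis unfolding cut_def[abs_def] cut'_def by (simp add: ac_simps)
qed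

lemma continuous_on_cut': "continuous_on S cut'"
  unfolding cut'_def[abs_def] by (intro continuous_intros)

lemma cut_bounds: "0 \<le> cut t" "cut t \<le> 1" "t \<le> 0 \<Longrightarrow> cut t = 0" "1 \<le> t \<Longrightarrow> cut t = 1"
proof -
  have "(max 0 (1 - (max 0 t)\<^sup>2))\<^sup>2 \<le> 1" by (intro power_le_one) auto
  then show "0 \<le> cut t" by (simp add: cut_def)
  show "1 \<le> t \<Longrightarrow> cut t = 1" using one_le_power[of t 2] by (simp add: cut_def max_def del: one_le_power)
qed (auto simp: cut_def)

lemma cut'_bound: "\<bar>cut' t\<bar> \<le> 4"
proof (cases "0 \<le> t \<and> t \<le> 1")
  case True
  then have "\<bar>max 0 (1 - (max 0 t)\<^sup>2) * max 0 t\<bar> \<le> 1 * 1"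
    unfolding abs_mult by (intro mult_mono) (auto simp: power_le_one)
  then show ?thesis by (simp add: cut'_def abs_mult)
next
  case False
  then have "cut' t = 0" by (auto simp: cut'_def max_def not_le)
    (metis less_eq_real_def not_less one_le_power)
  then show ?thesis by simp
qed

text \<open>Radii enter through their squares \<open>a\<close> and \<open>b\<close>, so that the
  argument of \<open>cut\<close> is a quadratic polynomial, differentiable also at the centre. The
  slope bound is 4 for \<open>cut'\<close> times the gradient 2 \<open>sqrt b\<close> / (b - a) of
  the polynomial on the larger ball.\<close>

lemma cutoff_exists:
  fixes x0 :: "'a::euclidean_space"
  assumes "0 \<le> a" "a < b"
  obtains \<zeta> g where "test_fun (cball x0 (sqrt b)) \<zeta> g" "\<And>x. 0 \<le> \<zeta> x" "\<And>x. \<zeta> x \<le> 1"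
    "\<And>x. x \<in> cball x0 (sqrt a) \<Longrightarrow> \<zeta> x = 1" "\<And>x. norm (g x) \<le> 8 * sqrt b / (b - a)"
proof -
  define w where "w x = (b - inner (x - x0) (x - x0)) / (b - a)" for x
  define gw where "gw x = (- 2 / (b - a)) *\<^sub>R (x - x0)" for x
  have w: "C1_grad UNIV w gw"
    unfolding C1_grad_def
  proof (intro conjI ballI)
    fix x
    show "GDERIV w x :> gw x"
      unfolding gderiv_def w_def[abs_def] gw_def using assms
      by (auto intro!: derivative_eq_intros simp: inner_commute algebra_simps divide_simps inner_diff_left)
    show "continuous_on UNIV gw"
      unfolding gw_def[abs_def] by (intro continuous_intros)
  qed
  have C: "C1_grad UNIV (\<lambda>x. cut (w x)) (\<lambda>x. cut' (w x) *\<^sub>R gw x)"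
    by (rule C1_grad_compose[OF w DERIV_cut continuous_on_cut'])
  have w_neg: "w x \<le> 0" if "x \<notin> cball x0 (sqrt b)" for x
  proof -
    have "sqrt b \<le> norm (x - x0)" using that by (simp add: dist_norm norm_minus_commute)
    then have "b \<le> (norm (x - x0))\<^sup>2" using assms by (simp add: sqrt_le_D)
    then show ?thesis using assms by (simp add: w_def power2_norm_eq_inner divide_nonpos_pos)
  qed
  have T: "test_fun (cball x0 (sqrt b)) (\<lambda>x. cut (w x)) (\<lambda>x. cut' (w x) *\<^sub>R gw x)"
    unfolding test_fun_def using C w_neg cut_bounds(3) by blast
  show thesis
  proof (rule that[OF T])
    fix x
    show "0 \<le> cut (w x)" "cut (w x) \<le> 1" by (rule cut_bounds)+
    show "cut (w x) = 1" if "x \<in> cball x0 (sqrt a)"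
    proof -
      have "norm (x - x0) \<le> sqrt a" using that by (simp add: dist_norm norm_minus_commute)
      then have "(norm (x - x0))\<^sup>2 \<le> a" using assms
        by (metis norm_ge_zero power_mono real_sqrt_pow2)
      then show ?thesis using assms by (intro cut_bounds) (simp add: w_def power2_norm_eq_inner)
    qed
    show "norm (cut' (w x) *\<^sub>R gw x) \<le> 8 * sqrt b / (b - a)"
    proof (cases "x \<in> cball x0 (sqrt b)")
      case True
      have "norm (cut' (w x) *\<^sub>R gw x) = \<bar>cut' (w x)\<bar> * ((2 / (b - a)) * norm (x - x0))"
        using assms by (simp add: gw_def abs_mult)
      also have "\<dots> \<le> 4 * ((2 / (b - a)) * sqrt b)"
        using assms True cut'_bound[of "w x"]
        by (intro mult_mono) (auto simp: dist_norm norm_minus_commute)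
      finally show ?thesis by simp
    next
      case False
      moreover have "0 \<le> 8 * sqrt b / (b - a)" using assms by simp
      ultimately show ?thesis using test_fun_grad_eq_0[OF T closed_cball False] by auto
    qed
  qed
qed

text \<open>A C^1 substitute for the positive part of \<open>t - m\<close>: with q that positive
  part it is q^2/(q + d), quadratic near q = 0 and of slope tending to 1.\<close>

definition trunc :: "real \<Rightarrow> real \<Rightarrow> real \<Rightarrow> real" where
  "trunc m d t = (max 0 (t - m))\<^sup>2 / (max 0 (t - m) + d)"

definition trunc' :: "real \<Rightarrow> real \<Rightarrow> real \<Rightarrow> real" where
  "trunc' m d t = max 0 (t - m) * (max 0 (t - m) + 2 * d) / (max 0 (t - m) + d)\<^sup>2"

lemma DERIV_trunc:
  assumes "0 < d" shows "(trunc m d has_real_derivative trunc' m d t) (at t)"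
proof -
  have "((\<lambda>q. q\<^sup>2 / (q + d)) has_real_derivative q * (q + 2 * d) / (q + d)\<^sup>2) (at q)" if "0 \<le> q" for q
    using that assms
    by (auto intro!: derivative_eq_intros simp: power2_eq_square algebra_simps)
  from DERIV_compose_max_0[of "\<lambda>q. q\<^sup>2 / (q + d)", OF this]
  have "((\<lambda>t. (max 0 t)\<^sup>2 / (max 0 t + d)) has_real_derivative
      max 0 (t - m) * (max 0 (t - m) + 2 * d) / (max 0 (t - m) + d)\<^sup>2) (at (t - m))" by simp
  moreover have "((\<lambda>t. t - m) has_real_derivative 1) (at t)"
    by (auto intro!: derivative_eq_intros)
  ultimately show ?thesis
    unfolding trunc_def[abs_def] trunc'_def using DERIV_chain2 by fastforce
qed

lemma continuous_on_trunc': "0 < d \<Longrightarrow> continuous_on S (trunc' m d)"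
  unfolding trunc'_def[abs_def]
  by (intro continuous_intros) (auto simp: max_def)

text \<open>The bound by \<open>t * trunc' m d t\<close> lets every term of the energy estimate
  carry the single weight \<open>trunc'\<close>. The last bound measures the price of smoothing: the
  plain positive part is recovered, up to a factor 2, only from the level \<open>m + d\<close>
  on.\<close>

lemma trunc_bounds:
  assumes "0 < d"
  shows "0 \<le> trunc m d t" "0 \<le> trunc' m d t" "trunc' m d t \<le> 1" "t \<le> m \<Longrightarrow> trunc m d t = 0"
    "t \<le> m \<Longrightarrow> trunc' m d t = 0"
    and "0 \<le> m \<Longrightarrow> 0 \<le> t \<Longrightarrow> trunc m d t \<le> t * trunc' m d t"
    and "max 0 (t - (m + d)) \<le> 2 * trunc m d t"
proof -
  define q where "q = max 0 (t - m)"
  have q: "0 \<le> q" by (simp add: q_def)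
  show "0 \<le> trunc m d t" "0 \<le> trunc' m d t" using assms q by (simp_all add: trunc_def trunc'_def)
  have "q * (q + 2 * d) \<le> (q + d)\<^sup>2" by (simp add: power2_eq_square algebra_simps)
  then show "trunc' m d t \<le> 1"
    using assms q unfolding trunc'_def q_def[symmetric] by (simp add: divide_le_eq)
  show "t \<le> m \<Longrightarrow> trunc m d t = 0" "t \<le> m \<Longrightarrow> trunc' m d t = 0"
    by (simp_all add: trunc_def trunc'_def)
  show "trunc m d t \<le> t * trunc' m d t" if "0 \<le> m" "0 \<le> t"
  proof -
    have "q \<le> t" using that by (simp add: q_def)
    have "trunc m d t = q * (q * (q + d) / (q + d)\<^sup>2)"
      using assms q unfolding trunc_def q_def[symmetric] by (simp add: power2_eq_square)
    also have "\<dots> \<le> t * (q * (q + 2 * d) / (q + d)\<^sup>2)"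
      using assms q \<open>q \<le> t\<close> by (intro mult_mono divide_right_mono mult_left_mono) auto
    finally show ?thesis unfolding trunc'_def q_def[symmetric] .
  qed
  show "max 0 (t - (m + d)) \<le> 2 * trunc m d t"
  proof -
    have "max 0 (q - d) \<le> 2 * (q\<^sup>2 / (q + d))"
    proof (cases "q \<le> d")
      case False
      have "(q - d) * (q + d) \<le> 2 * q\<^sup>2" by (simp add: power2_eq_square algebra_simps)
      then show ?thesis using False assms q by (simp add: le_divide_eq)
    qed (use assms q in simp)
    moreover have "max 0 (t - (m + d)) = max 0 (q - d)" using assms by (auto simp: q_def)
    ultimately show ?thesis unfolding trunc_def q_def[symmetric] by simp
  qed
qed

subsection \<open>Local boundedness of subsolutions\<close>

lemma integrable_indicator_compact:
  fixes f :: "'a::euclidean_space \<Rightarrow> real"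
  assumes "continuous_on K f" "compact K"
  shows "integrable lborel (\<lambda>x. indicator K x * f x)"
  using borel_integrable_compact[OF assms(2,1)] by simp

text \<open>Here \<open>y\<close> is the length of the gradient of \<open>v\<close>,
  \<open>z\<close> the cutoff with gradient bound \<open>L\<close>, \<open>f\<close> and
  \<open>f'\<close> the truncation of \<open>v\<close> and its derivative, \<open>a\<close> and
  \<open>b\<close> the products of the flux with the gradients of \<open>v\<close> and of the
  cutoff. The right side is the flux against the gradient of \<open>z\<close> squared times
  \<open>f\<close>.\<close>

lemma caccioppoli_pointwise:
  fixes y z v f f' L a b lam Lam B :: real
  assumes "0 \<le> y" "0 \<le> z" "z \<le> 1" "0 \<le> v" "0 \<le> f" "0 \<le> f'" "f \<le> v * f'" "0 \<le> L"
    and "0 < lam" "0 \<le> Lam" "0 \<le> B"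
    and a: "lam * y\<^sup>2 - B * v * y \<le> a" and b: "- (L * (Lam * y + B * v)) \<le> b"
  shows "lam / 2 * (z\<^sup>2 * (f' * y\<^sup>2)) - ((B + 2 * L * Lam)\<^sup>2 / (2 * lam) + 2 * L * B) * (f' * v\<^sup>2)
    \<le> z\<^sup>2 * (f' * a) + 2 * z * f * b"
proof -
  define \<kappa> where "\<kappa> = B + 2 * L * Lam"
  have 1: "z\<^sup>2 * f' * (lam * y\<^sup>2 - B * v * y) \<le> z\<^sup>2 * f' * a"
    using assms by (intro mult_left_mono a) auto
  \<comment> \<open>One factor \<open>z\<close> is given up because \<open>z\<close> is at most 1;
    the other stays with \<open>y\<close> so that the term can be absorbed.\<close>
  have "z * z * (f' * (B * v * y)) \<le> z * 1 * (f' * (B * v * y))"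
    using assms by (intro mult_right_mono mult_left_mono) auto
  then have 2: "z\<^sup>2 * f' * (B * v * y) \<le> f' * (B * v * (z * y))"
    by (simp add: power2_eq_square ac_simps)
  have "2 * z * f * - b \<le> 2 * z * f * (L * (Lam * y + B * v))"
    using assms by (intro mult_left_mono) auto
  also have "\<dots> \<le> 2 * z * (v * f') * (L * (Lam * y + B * v))"
    using assms by (intro mult_left_mono mult_right_mono) auto
  also have "\<dots> = f' * (2 * L * Lam * v * (z * y)) + z * (2 * L * B * (f' * v\<^sup>2))"
    by (simp add: algebra_simps power2_eq_square)
  also have "z * (2 * L * B * (f' * v\<^sup>2)) \<le> 1 * (2 * L * B * (f' * v\<^sup>2))"
    using assms by (intro mult_right_mono) auto
  finally have 3: "- (2 * z * f * b) \<le> f' * (2 * L * Lam * v * (z * y)) + 2 * L * B * (f' * v\<^sup>2)"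
    by simp
  \<comment> \<open>Young's inequality as a completed square: half of the elliptic term absorbs all
    products of \<open>v\<close> with \<open>z * y\<close>, whose total coefficient is
    \<open>\<kappa>\<close>.\<close>
  have "0 \<le> f' * ((lam * (z * y) - \<kappa> * v)\<^sup>2 / (2 * lam))"
    using assms by simp
  also have "\<dots> = f' * (lam / 2 * (z * y)\<^sup>2 - \<kappa> * v * (z * y) + \<kappa>\<^sup>2 / (2 * lam) * v\<^sup>2)"
    using assms by (simp add: power2_eq_square field_simps)
  finally have 4: "0 \<le> lam / 2 * (z\<^sup>2 * (f' * y\<^sup>2)) - f' * (\<kappa> * v * (z * y)) + \<kappa>\<^sup>2 / (2 * lam) * (f' * v\<^sup>2)"
    by (simp add: algebra_simps power_mult_distrib)
  have 5: "f' * (\<kappa> * v * (z * y)) = f' * (B * v * (z * y)) + f' * (2 * L * Lam * v * (z * y))"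
    by (simp add: \<kappa>_def algebra_simps)
  have 6: "z\<^sup>2 * f' * (lam * y\<^sup>2 - B * v * y) = lam * (z\<^sup>2 * (f' * y\<^sup>2)) - z\<^sup>2 * f' * (B * v * y)"
    by (simp add: algebra_simps)
  have 7: "(\<kappa>\<^sup>2 / (2 * lam) + 2 * L * B) * (f' * v\<^sup>2) = \<kappa>\<^sup>2 / (2 * lam) * (f' * v\<^sup>2) + 2 * L * B * (f' * v\<^sup>2)"
    by (simp only: distrib_right)
  have 8: "z\<^sup>2 * f' * a = z\<^sup>2 * (f' * a)" by simp
  show ?thesis
    unfolding \<kappa>_def[symmetric] 7 using 1 2 3 4 unfolding 5 6 8 by linarith
qed

text \<open>The flux is an arbitrary field bound to the gradient by two inequalities, not a matrix
  times it. All lower-order terms are proportional to \<open>v\<close>, which keeps the estimate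
  homogeneous.\<close>

locale subsolution =
  fixes x0 :: "'a::euclidean_space" and R :: real and v :: "'a \<Rightarrow> real" and gv W :: "'a \<Rightarrow> 'a"
    and lam Lam B :: real
  assumes R: "0 < R" "R \<le> 1"
    and params: "0 < lam" "0 \<le> Lam" "0 \<le> B"
    and v: "C1_grad (ball x0 R) v gv" and v_nonneg: "\<And>x. x \<in> ball x0 R \<Longrightarrow> 0 \<le> v x"
    and W: "continuous_on (ball x0 R) W"
    and elliptic: "\<And>x. x \<in> ball x0 R \<Longrightarrow> lam * (norm (gv x))\<^sup>2 - B * v x * norm (gv x) \<le> inner (W x) (gv x)"
    and bounded: "\<And>x. x \<in> ball x0 R \<Longrightarrow> norm (W x) \<le> Lam * norm (gv x) + B * v x"
    and weak: "\<And>K \<psi> g\<psi>. test_fun K \<psi> g\<psi> \<Longrightarrow> compact K \<Longrightarrow> K \<subseteq> ball x0 R \<Longrightarrow> (\<And>x. 0 \<le> \<psi> x) \<Longrightarrow>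
      (\<integral>x. inner (W x) (g\<psi> x) \<partial>lborel) \<le> B * (\<integral>x. \<psi> x * v x \<partial>lborel)"
begin

text \<open>The weak inequality is tested with the squared cutoff times \<open>trunc m d\<close> of
  \<open>v\<close>. The right side carries \<open>v\<close> squared and not the squared excess over
  \<open>m\<close>, because the lower-order terms contain \<open>v\<close> itself.\<close>

lemma caccioppoli:
  assumes K: "compact K" "K \<subseteq> ball x0 R" and \<zeta>: "test_fun K \<zeta> g\<zeta>"
    and \<zeta>_bounds: "\<And>x. 0 \<le> \<zeta> x" "\<And>x. \<zeta> x \<le> 1" and L: "\<And>x. norm (g\<zeta> x) \<le> L"
    and m: "0 \<le> m" "0 < d"
  shows "lam / 2 * (\<integral>x. (\<zeta> x)\<^sup>2 * (trunc' m d (v x) * (norm (gv x))\<^sup>2) \<partial>lborel)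
    \<le> ((B + 2 * L * Lam)\<^sup>2 / (2 * lam) + 2 * L * B + B)
      * (\<integral>x. indicator K x * (trunc' m d (v x) * (v x)\<^sup>2) \<partial>lborel)"
proof -
  define C0 where "C0 = (B + 2 * L * Lam)\<^sup>2 / (2 * lam) + 2 * L * B"
  define S where "S = ball x0 R"
  have L0: "0 \<le> L" using L[of undefined] norm_ge_zero order_trans by blast
  have \<zeta>0: "\<And>x. x \<notin> K \<Longrightarrow> \<zeta> x = 0" using \<zeta> by (simp add: test_fun_def)
  have \<zeta>S: "C1_grad S \<zeta> g\<zeta>"
    using \<zeta> C1_grad_subset[of UNIV] unfolding test_fun_def by blast
  have vS: "C1_grad S v gv" using v by (simp add: S_def)
  define \<psi>0 where "\<psi>0 x = \<zeta> x * \<zeta> x * trunc m d (v x)" for x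
  define g\<psi>0 where "g\<psi>0 x = (\<zeta> x * \<zeta> x) *\<^sub>R (trunc' m d (v x) *\<^sub>R gv x)
      + trunc m d (v x) *\<^sub>R (\<zeta> x *\<^sub>R g\<zeta> x + \<zeta> x *\<^sub>R g\<zeta> x)" for x
  have C: "C1_grad S \<psi>0 g\<psi>0"
    unfolding \<psi>0_def[abs_def] g\<psi>0_def[abs_def]
    by (intro C1_grad_mult[where f="\<lambda>x. \<zeta> x * \<zeta> x"] C1_grad_mult \<zeta>S
        C1_grad_compose[OF vS DERIV_trunc continuous_on_trunc'] m)
  define \<psi> where "\<psi> x = (if x \<in> S then \<psi>0 x else 0)" for x
  define g\<psi> where "g\<psi> x = (if x \<in> S then g\<psi>0 x else 0)" for x
  have KS: "K \<subseteq> S" using K by (simp add: S_def)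
  have T: "test_fun K \<psi> g\<psi>"
    unfolding \<psi>_def[abs_def] g\<psi>_def[abs_def]
    by (rule test_fun_extend[OF C _ K(1) KS]) (auto simp: S_def \<psi>0_def \<zeta>0)
  have g\<psi>0': "g\<psi> x = 0" if "x \<notin> K" for x
    using test_fun_grad_eq_0[OF T compact_imp_closed[OF K(1)] that] .
  have nonneg: "0 \<le> \<psi> x" for x
    using trunc_bounds[OF m(2)] by (simp add: \<psi>_def \<psi>0_def)
  have vK: "continuous_on K v" "continuous_on K gv" and WK: "continuous_on K W"
    using C1_grad_continuous[OF vS] C1_grad_continuous_grad[OF vS] W KS
    by (auto intro: continuous_on_subset simp: S_def)
  have \<zeta>K: "continuous_on K \<zeta>" using test_fun_continuous[OF \<zeta>] by blast
  have tK: "continuous_on K (\<lambda>x. trunc' m d (v x))"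
    by (rule continuous_on_compose2[OF continuous_on_trunc'[OF m(2)] vK(1)]) auto
  have pos: "0 \<le> v x" if "x \<in> K" for x using v_nonneg that KS by (auto simp: S_def)
  let ?T = "\<lambda>x. (\<zeta> x)\<^sup>2 * (trunc' m d (v x) * (norm (gv x))\<^sup>2)"
  let ?V = "\<lambda>x. indicator K x * (trunc' m d (v x) * (v x)\<^sup>2)"
  have intT: "integrable lborel ?T"
    by (rule integrable_compact_support[OF _ K(1)])
      (auto intro!: continuous_on_mult continuous_on_power continuous_on_norm vK \<zeta>K tK simp: \<zeta>0)
  have intV: "integrable lborel ?V"
    by (intro integrable_indicator_compact K continuous_on_mult continuous_on_power vK tK)
  have intW: "integrable lborel (\<lambda>x. inner (W x) (g\<psi> x))"
    using test_fun_continuous(2)[OF T]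
    by (intro integrable_compact_support[OF _ K(1)] continuous_on_inner WK) (auto simp: g\<psi>0')
  have int\<psi>: "integrable lborel (\<lambda>x. \<psi> x * v x)"
    using test_fun_continuous(1)[OF T] T
    by (intro integrable_compact_support[OF _ K(1)] continuous_on_mult vK) (auto simp: test_fun_def)
  have "lam / 2 * (\<integral>x. ?T x \<partial>lborel) - C0 * (\<integral>x. ?V x \<partial>lborel) = (\<integral>x. lam / 2 * ?T x - C0 * ?V x \<partial>lborel)"
    using intT intV by simp
  also have "\<dots> \<le> (\<integral>x. inner (W x) (g\<psi> x) \<partial>lborel)"
  proof (rule integral_mono)
    show "integrable lborel (\<lambda>x. lam / 2 * ?T x - C0 * ?V x)" using intT intV by simp
    show "lam / 2 * ?T x - C0 * ?V x \<le> inner (W x) (g\<psi> x)" for x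
    proof (cases "x \<in> K")
      case False
      then show ?thesis by (simp add: g\<psi>0' \<zeta>0)
    next
      case True
      then have x: "x \<in> ball x0 R" using K by auto
      have Wg: "- (L * (Lam * norm (gv x) + B * v x)) \<le> inner (W x) (g\<zeta> x)"
      proof -
        have "\<bar>inner (W x) (g\<zeta> x)\<bar> \<le> norm (W x) * norm (g\<zeta> x)" by (rule Cauchy_Schwarz_ineq2)
        also have "\<dots> \<le> (Lam * norm (gv x) + B * v x) * L"
          using bounded[OF x] L L0 params v_nonneg[OF x] by (intro mult_mono) auto
        finally show ?thesis by (simp add: mult.commute)
      qed
      have "lam / 2 * ((\<zeta> x)\<^sup>2 * (trunc' m d (v x) * (norm (gv x))\<^sup>2)) - C0 * (trunc' m d (v x) * (v x)\<^sup>2)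
        \<le> (\<zeta> x)\<^sup>2 * (trunc' m d (v x) * inner (W x) (gv x)) + 2 * \<zeta> x * trunc m d (v x) * inner (W x) (g\<zeta> x)"
        unfolding C0_def
        using trunc_bounds[OF m(2)] \<zeta>_bounds params m v_nonneg[OF x] elliptic[OF x] Wg L0
        by (intro caccioppoli_pointwise) auto
      also have "\<dots> = inner (W x) (g\<psi> x)"
        using True KS by (auto simp: g\<psi>_def g\<psi>0_def inner_add_right power2_eq_square)
      finally show ?thesis using True by simp
    qed
  qed (rule intW)
  also have "\<dots> \<le> B * (\<integral>x. \<psi> x * v x \<partial>lborel)"
    by (rule weak[OF T K nonneg])
  also have "\<dots> \<le> B * (\<integral>x. ?V x \<partial>lborel)"
  proof (intro mult_left_mono integral_mono int\<psi> intV params)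
    show "\<psi> x * v x \<le> ?V x" for x
    proof (cases "x \<in> K")
      case True
      have "\<zeta> x * \<zeta> x * trunc m d (v x) \<le> 1 * (v x * trunc' m d (v x))"
        using trunc_bounds[OF m(2)] \<zeta>_bounds m pos[OF True]
        by (intro mult_mono) (auto intro: mult_le_one)
      then have "\<zeta> x * \<zeta> x * trunc m d (v x) * v x \<le> v x * trunc' m d (v x) * v x"
        using pos[OF True] by (intro mult_right_mono) auto
      then show ?thesis using True KS by (auto simp: \<psi>_def \<psi>0_def power2_eq_square ac_simps)
    qed (use T in \<open>simp add: test_fun_def\<close>)
  qed
  finally show ?thesis unfolding C0_def[symmetric] by (simp add: algebra_simps)
qed

section \<open>De Giorgi iteration over shrinking balls (indexed by squared radius) and rising
  levels\<close>

definition excess :: "real \<Rightarrow> real \<Rightarrow> real" where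
  "excess s k = (\<integral>x. indicator (cball x0 (sqrt s)) x * (max 0 (v x - k))\<^sup>2 \<partial>lborel)"

text \<open>Gradient constant for cutoff times truncation: the 2 comes from the gradient of the
  cutoff, the rest from \<open>caccioppoli\<close> multiplied by 4/\<open>lam\<close>, after L \<ge>
  1 has been used to pull out \<open>L\<close> squared.\<close>

definition energy_const :: real where
  "energy_const = 2 + 4 / lam * ((B + 2 * Lam)\<^sup>2 / (2 * lam) + 3 * B)"

lemma energy_const_pos: "0 < energy_const"
  using params by (simp add: energy_const_def add_pos_nonneg)

lemma cball_subset_ball: "s < R\<^sup>2 \<Longrightarrow> cball x0 (sqrt s) \<subseteq> ball x0 R"
  using R real_sqrt_less_mono[of s "R\<^sup>2"] by auto

lemma continuous_on_cball_v: "s < R\<^sup>2 \<Longrightarrow> continuous_on (cball x0 (sqrt s)) v"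
  using continuous_on_subset[OF C1_grad_continuous[OF v] cball_subset_ball] .

lemma integrable_excess:
  assumes "s < R\<^sup>2"
  shows "integrable lborel (\<lambda>x. indicator (cball x0 (sqrt s)) x * (max 0 (v x - k))\<^sup>2)"
  by (intro integrable_indicator_compact compact_cball continuous_on_power continuous_on_max
      continuous_on_diff continuous_on_const continuous_on_cball_v assms)

text \<open>Faber-Krahn is applied to the cutoff times the truncated \<open>v\<close>, whose support
  is small by Chebyshev, and \<open>caccioppoli\<close> bounds its gradient. The gain is the factor
  \<open>r\<close> squared, with \<open>r\<close> limited by the smallness hypothesis. The 8 is the
  2 of Faber-Krahn times the square of the 2 in \<open>trunc_bounds\<close>.\<close>

lemma excess_step:
  assumes s: "0 < s'" "s' < s" "s < R\<^sup>2" and k: "0 \<le> k" "0 < d" and N: "1 + k / d \<le> N"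
    and r: "0 < r" and L: "1 \<le> L" "8 * sqrt s / (s - s') \<le> L"
    and small: "excess s k \<le> d\<^sup>2 * (measure lborel (ball (0::'a) r) / 4)"
  shows "excess s' (k + 2 * d) \<le> 8 * r\<^sup>2 * (energy_const * L\<^sup>2 * N\<^sup>2) * excess s k"
proof -
  define K where "K = cball x0 (sqrt s)"
  define S where "S = ball x0 R"
  \<comment> \<open>The level rises by \<open>2 * d\<close>: the first \<open>d\<close> makes the
    Chebyshev bound and the comparison of \<open>v\<close> with \<open>v - k\<close> possible, the
    second is lost to the smoothed truncation.\<close>
  define m where "m = k + d"
  have m: "0 \<le> m" using k by (simp add: m_def)
  have K: "compact K" "K \<subseteq> ball x0 R" using cball_subset_ball[OF s(3)] by (auto simp: K_def)
  have KS: "K \<subseteq> S" using K by (simp add: S_def)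
  have 0: "0 \<le> s'" using s by simp
  obtain \<zeta> g\<zeta> where \<zeta>: "test_fun K \<zeta> g\<zeta>" "\<And>x. 0 \<le> \<zeta> x" "\<And>x. \<zeta> x \<le> 1"
    "\<And>x. x \<in> cball x0 (sqrt s') \<Longrightarrow> \<zeta> x = 1" and g\<zeta>: "\<And>x. norm (g\<zeta> x) \<le> 8 * sqrt s / (s - s')"
    using cutoff_exists[OF 0 s(2), of x0] unfolding K_def by metis
  have L\<zeta>: "norm (g\<zeta> x) \<le> L" for x using g\<zeta>[of x] L by linarith
  have \<zeta>0: "\<And>x. x \<notin> K \<Longrightarrow> \<zeta> x = 0" using \<zeta> by (simp add: test_fun_def)
  have \<zeta>S: "C1_grad S \<zeta> g\<zeta>"
    using \<zeta> C1_grad_subset[of UNIV] unfolding test_fun_def by blast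
  have vS: "C1_grad S v gv" using v by (simp add: S_def)
  define u0 where "u0 x = \<zeta> x * trunc m d (v x)" for x
  define gu0 where "gu0 x = \<zeta> x *\<^sub>R (trunc' m d (v x) *\<^sub>R gv x) + trunc m d (v x) *\<^sub>R g\<zeta> x" for x
  have C: "C1_grad S u0 gu0"
    unfolding u0_def[abs_def] gu0_def[abs_def]
    by (intro C1_grad_mult \<zeta>S C1_grad_compose[OF vS DERIV_trunc continuous_on_trunc'] k)
  define u where "u x = (if x \<in> S then u0 x else 0)" for x
  define gu where "gu x = (if x \<in> S then gu0 x else 0)" for x
  have T: "test_fun K u gu"
    unfolding u_def[abs_def] gu_def[abs_def]
    by (rule test_fun_extend[OF C _ K(1) KS]) (auto simp: S_def u0_def \<zeta>0)
  have gu0': "gu x = 0" if "x \<notin> K" for x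
    using test_fun_grad_eq_0[OF T compact_imp_closed[OF K(1)] that] .
  have vK: "continuous_on K v" "continuous_on K gv"
    using C1_grad_continuous[OF vS] C1_grad_continuous_grad[OF vS] KS
    by (auto intro: continuous_on_subset simp: S_def)
  have \<zeta>K: "continuous_on K \<zeta>" using test_fun_continuous[OF \<zeta>(1)] by blast
  have tK: "continuous_on K (\<lambda>x. trunc' m d (v x))"
    by (rule continuous_on_compose2[OF continuous_on_trunc'[OF k(2)] vK(1)]) auto
  have pos: "0 \<le> v x" if "x \<in> K" for x using v_nonneg that KS by (auto simp: S_def)
  let ?T = "\<lambda>x. (\<zeta> x)\<^sup>2 * (trunc' m d (v x) * (norm (gv x))\<^sup>2)"
  let ?V = "\<lambda>x. indicator K x * (trunc' m d (v x) * (v x)\<^sup>2)"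
  let ?E = "\<lambda>x. indicator K x * (max 0 (v x - k))\<^sup>2"
  have intT: "integrable lborel ?T"
    by (rule integrable_compact_support[OF _ K(1)])
      (auto intro!: continuous_on_mult continuous_on_power continuous_on_norm vK \<zeta>K tK simp: \<zeta>0)
  have intV: "integrable lborel ?V"
    by (intro integrable_indicator_compact K continuous_on_mult continuous_on_power vK tK)
  have intE: "integrable lborel ?E"
    using integrable_excess[OF s(3)] by (simp add: K_def)
  have excess: "excess s k = (\<integral>x. ?E x \<partial>lborel)" by (simp add: excess_def K_def)
  define I where "I = (\<integral>x. ?V x \<partial>lborel)"
  have I0: "0 \<le> I"
    unfolding I_def using trunc_bounds[OF k(2)] by (intro integral_nonneg_AE) auto
  have "1 \<le> N" using N k by (smt (verit) divide_nonneg_pos)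

  \<comment> \<open>Where \<open>trunc'\<close> is nonzero, \<open>v\<close> exceeds
    \<open>k\<close> by at least \<open>d\<close>, so \<open>k\<close> is at most
    \<open>k / d\<close> times that excess and \<open>v\<close> at most \<open>N\<close> times it.
    This trades \<open>v\<close> for \<open>v - k\<close>.\<close>
  have "I \<le> (\<integral>x. N\<^sup>2 * ?E x \<partial>lborel)"
    unfolding I_def
  proof (intro integral_mono intV integrable_mult_right intE)
    show "?V x \<le> N\<^sup>2 * ?E x" for x
    proof (cases "x \<in> K \<and> m < v x")
      case True
      then have "d \<le> v x - k" by (simp add: m_def)
      have "v x - k \<ge> 0" using \<open>d \<le> v x - k\<close> k by linarith
      have "v x = (v x - k) + k / d * d" using k by simp
      also have "\<dots> \<le> (v x - k) + k / d * (v x - k)"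
        using \<open>d \<le> v x - k\<close> k by (intro add_left_mono mult_left_mono) auto
      also have "\<dots> = (1 + k / d) * (v x - k)" by (simp add: algebra_simps)
      also have "\<dots> \<le> N * (v x - k)" using N \<open>v x - k \<ge> 0\<close> by (intro mult_right_mono)
      finally have "v x \<le> N * (v x - k)" .
      then have "(v x)\<^sup>2 \<le> N\<^sup>2 * (v x - k)\<^sup>2"
        using pos True power_mono[of "v x" "N * (v x - k)" 2] by (simp add: power_mult_distrib)
      moreover have "trunc' m d (v x) * (v x)\<^sup>2 \<le> 1 * (v x)\<^sup>2"
        using trunc_bounds[OF k(2)] by (intro mult_right_mono) auto
      ultimately show ?thesis using True \<open>v x - k \<ge> 0\<close> by (simp add: max_def)
    next
      case False
      then show ?thesis using trunc_bounds(5)[OF k(2)] by (auto simp: indicator_def)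
    qed
  qed
  then have I: "I \<le> N\<^sup>2 * excess s k" by (simp add: excess)

  have cacc: "lam / 2 * (\<integral>x. ?T x \<partial>lborel) \<le> ((B + 2 * L * Lam)\<^sup>2 / (2 * lam) + 2 * L * B + B) * I"
    unfolding I_def by (rule caccioppoli[OF K \<zeta>(1-3) L\<zeta> m k(2)])
  have "B + 2 * L * Lam \<le> L * (B + 2 * Lam)"
    using params L mult_right_mono[of 1 L B] by (simp add: algebra_simps)
  then have "(B + 2 * L * Lam)\<^sup>2 \<le> (L * (B + 2 * Lam))\<^sup>2"
    using params L by (intro power_mono) auto
  then have "(B + 2 * L * Lam)\<^sup>2 / (2 * lam) \<le> L\<^sup>2 * ((B + 2 * Lam)\<^sup>2 / (2 * lam))"
    using params by (simp add: power_mult_distrib divide_right_mono)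
  moreover have "L \<le> L\<^sup>2" "1 \<le> L\<^sup>2" using L self_le_power[of L 2] one_le_power[of L 2] by simp_all
  then have "L * B \<le> L\<^sup>2 * B" "1 * B \<le> L\<^sup>2 * B" using params mult_right_mono by blast+
  ultimately have c: "(B + 2 * L * Lam)\<^sup>2 / (2 * lam) + 2 * L * B + B
      \<le> L\<^sup>2 * ((B + 2 * Lam)\<^sup>2 / (2 * lam) + 3 * B)"
    by (simp add: algebra_simps)
  have "lam / 2 * (\<integral>x. ?T x \<partial>lborel) \<le> L\<^sup>2 * ((B + 2 * Lam)\<^sup>2 / (2 * lam) + 3 * B) * I"
    using order_trans[OF cacc mult_right_mono[OF c I0]] .
  then have "(4 / lam) * (lam / 2 * (\<integral>x. ?T x \<partial>lborel))
      \<le> (4 / lam) * (L\<^sup>2 * ((B + 2 * Lam)\<^sup>2 / (2 * lam) + 3 * B) * I)"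
    using params by (intro mult_left_mono) auto
  then have T_le: "2 * (\<integral>x. ?T x \<partial>lborel) \<le> L\<^sup>2 * ((4 / lam) * ((B + 2 * Lam)\<^sup>2 / (2 * lam) + 3 * B)) * I"
    using params by (simp add: ac_simps)

  have "(\<integral>x. (norm (gu x))\<^sup>2 \<partial>lborel) \<le> (\<integral>x. 2 * ?T x + 2 * L\<^sup>2 * ?V x \<partial>lborel)"
  proof (rule integral_mono)
    show "integrable lborel (\<lambda>x. (norm (gu x))\<^sup>2)"
      using test_fun_continuous(2)[OF T]
      by (intro integrable_compact_support[OF _ K(1)] continuous_on_power continuous_on_norm) (auto simp: gu0')
    show "integrable lborel (\<lambda>x. 2 * ?T x + 2 * L\<^sup>2 * ?V x)"
      by (intro Bochner_Integration.integrable_add integrable_mult_right intT intV)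
    show "(norm (gu x))\<^sup>2 \<le> 2 * ?T x + 2 * L\<^sup>2 * ?V x" for x
    proof (cases "x \<in> K")
      case False
      then show ?thesis by (simp add: gu0' \<zeta>0)
    next
      case True
      let ?t = "trunc m d (v x)" and ?t' = "trunc' m d (v x)"
      let ?p = "\<zeta> x *\<^sub>R (?t' *\<^sub>R gv x)" and ?q = "?t *\<^sub>R g\<zeta> x"
      note tb = trunc_bounds[OF k(2), of m "v x"]
      \<comment> \<open>As \<open>trunc'\<close> lies in [0,1], its square is dominated by
        \<open>trunc'\<close>, the weight that \<open>caccioppoli\<close> controls.\<close>
      have t'2: "?t'\<^sup>2 \<le> ?t'" using tb by (simp add: power2_eq_square mult_left_le)
      have "(norm (gu x))\<^sup>2 \<le> (norm ?p + norm ?q)\<^sup>2"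
        using True KS norm_triangle_ineq[of ?p ?q] by (intro power_mono) (auto simp: gu_def gu0_def)
      also have "\<dots> \<le> 2 * (norm ?p)\<^sup>2 + 2 * (norm ?q)\<^sup>2"
        using sum_squares_bound[of "norm ?p" "norm ?q"] by (simp add: power2_sum)
      also have "(norm ?p)\<^sup>2 \<le> ?T x"
        using mult_left_mono[OF mult_right_mono[OF t'2, of "(norm (gv x))\<^sup>2"], of "(\<zeta> x)\<^sup>2"]
        by (simp add: power_mult_distrib mult.assoc)
      also have "(norm ?q)\<^sup>2 \<le> L\<^sup>2 * ?V x"
      proof -
        have "?t\<^sup>2 \<le> (v x * ?t')\<^sup>2"
          using tb m pos[OF True] by (intro power_mono) auto
        also have "\<dots> \<le> ?t' * (v x)\<^sup>2"
          using mult_right_mono[OF t'2, of "(v x)\<^sup>2"] by (simp add: power_mult_distrib mult.commute)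
        finally have "?t\<^sup>2 * (norm (g\<zeta> x))\<^sup>2 \<le> (?t' * (v x)\<^sup>2) * L\<^sup>2"
          using L\<zeta>[of x] tb by (intro mult_mono power_mono) auto
        then show ?thesis using True by (simp add: power_mult_distrib ac_simps)
      qed
      finally show ?thesis by simp
    qed
  qed
  also have "\<dots> = 2 * (\<integral>x. ?T x \<partial>lborel) + 2 * L\<^sup>2 * I"
    using intT intV by (simp add: I_def)
  also have "\<dots> \<le> energy_const * L\<^sup>2 * I"
    using T_le by (simp add: energy_const_def algebra_simps)
  also have "\<dots> \<le> energy_const * L\<^sup>2 * (N\<^sup>2 * excess s k)"
    using energy_const_pos by (intro mult_left_mono I) auto
  finally have grad: "(\<integral>x. (norm (gu x))\<^sup>2 \<partial>lborel) \<le> energy_const * L\<^sup>2 * N\<^sup>2 * excess s k"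
    by (simp add: ac_simps)

  have supp: "emeasure lborel {x. u x \<noteq> 0} \<le> ennreal (measure lborel (ball (0::'a) r) / 4)"
  proof -
    have cu: "continuous_on UNIV u" using test_fun_continuous[OF T] by blast
    have [measurable]: "u \<in> borel_measurable borel"
      using cu by (intro borel_measurable_continuous_onI)
    have "{x. u x \<noteq> 0} \<in> sets borel" by measurable
    then have "emeasure lborel {x. u x \<noteq> 0} = (\<integral>\<^sup>+x. indicator {x. u x \<noteq> 0} x \<partial>lborel)"
      by simp
    \<comment> \<open>Chebyshev: where \<open>u\<close> is nonzero, \<open>v\<close> lies above
      \<open>k + d\<close>.\<close>
    also have "\<dots> \<le> (\<integral>\<^sup>+x. ennreal (?E x / d\<^sup>2) \<partial>lborel)"
    proof (intro nn_integral_mono)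
      fix x
      show "indicator {x. u x \<noteq> 0} x \<le> ennreal (?E x / d\<^sup>2)"
      proof (cases "u x = 0")
        case False
        then have x: "x \<in> K" and "trunc m d (v x) \<noteq> 0"
          using \<zeta>0 by (auto simp: u_def u0_def split: if_splits)
        then have "m < v x" using trunc_bounds(4)[OF k(2)] by (meson not_le)
        then have "d\<^sup>2 \<le> (max 0 (v x - k))\<^sup>2" using k by (intro power_mono) (auto simp: m_def)
        then show ?thesis using x False k by (simp add: ennreal_ge_1)
      qed simp
    qed
    also have "\<dots> = ennreal (\<integral>x. ?E x / d\<^sup>2 \<partial>lborel)"
      using intE by (intro nn_integral_eq_integral) auto
    also have "\<dots> \<le> ennreal (measure lborel (ball (0::'a) r) / 4)"
      using small k unfolding excess by (intro ennreal_leI) (simp add: divide_le_eq mult.commute)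
    finally show ?thesis .
  qed
  have fk: "(\<integral>x. (u x)\<^sup>2 \<partial>lborel) \<le> 2 * r\<^sup>2 * (\<integral>x. (norm (gu x))\<^sup>2 \<partial>lborel)"
    by (rule faber_krahn[OF T K(1) r supp])

  have "excess s' (k + 2 * d) \<le> (\<integral>x. 4 * (u x)\<^sup>2 \<partial>lborel)"
    unfolding excess_def
  proof (rule integral_mono)
    show "integrable lborel (\<lambda>x. indicator (cball x0 (sqrt s')) x * (max 0 (v x - (k + 2 * d)))\<^sup>2)"
      using s by (intro integrable_excess) simp
    show "integrable lborel (\<lambda>x. 4 * (u x)\<^sup>2)"
      using test_fun_continuous(1)[OF T] T
      by (intro integrable_mult_right integrable_compact_support[OF _ K(1)] continuous_on_power)
        (auto simp: test_fun_def)
    show "indicator (cball x0 (sqrt s')) x * (max 0 (v x - (k + 2 * d)))\<^sup>2 \<le> 4 * (u x)\<^sup>2" for x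
    proof (cases "x \<in> cball x0 (sqrt s')")
      case True
      moreover have "cball x0 (sqrt s') \<subseteq> S"
        using cball_subset_ball[of s'] s by (simp add: S_def)
      ultimately have "u x = trunc m d (v x)" using \<zeta>(4) by (auto simp: u_def u0_def)
      then have "max 0 (v x - (k + 2 * d)) \<le> 2 * u x"
        using trunc_bounds(7)[OF k(2), of "v x" m] by (simp add: m_def)
      then have "(max 0 (v x - (k + 2 * d)))\<^sup>2 \<le> (2 * u x)\<^sup>2" by (intro power_mono) auto
      then show ?thesis using True by simp
    qed simp
  qed
  also have "\<dots> = 4 * (\<integral>x. (u x)\<^sup>2 \<partial>lborel)" by simp
  also have "\<dots> \<le> 4 * (2 * r\<^sup>2 * (energy_const * L\<^sup>2 * N\<^sup>2 * excess s k))"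
    by (intro mult_left_mono order_trans[OF fk] grad) auto
  finally show ?thesis by (simp add: ac_simps)
qed

text \<open>The square root is the initial Faber-Krahn radius, chosen so that one step contracts by
  exactly 4^(n+1). Here 819200 = 8 * 64^2 * 5^2 collects the 8 of \<open>excess_step\<close> with
  the slopes and level ratios of the iteration, and 64 = 4^2 * 4 is the square from the level step
  times the 4 of Faber-Krahn.\<close>

definition sup_const :: real where
  "sup_const = unit_ball_vol DIM('a) / 64
    * sqrt (1 / 4 ^ (DIM('a) + 1) / (819200 * energy_const / R\<^sup>2)) ^ DIM('a)"

lemma sup_const_pos: "0 < sup_const"
  using energy_const_pos R by (simp add: sup_const_def)

text \<open>Prescribing the radii r0/4^j in advance replaces the usual nonlinear recursion by plain
  geometric decay. The constants of step j grow like 16^j, which the squared radius compensates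
  exactly. The smallness threshold decays like 4^(-j) from the level step times 4^(-jn) from the
  ball volume, which is the decay rate being proved, so the induction closes.\<close>

lemma excess_decay:
  assumes M: "0 < M" and init: "excess (R\<^sup>2 / 4) 0 \<le> sup_const * M\<^sup>2"
  shows "excess (R\<^sup>2 / 4 * (1 / 2 + 1 / 2 ^ (j + 1))) (M * (1 - 1 / 2 ^ j))
    \<le> sup_const * M\<^sup>2 / (4 ^ (DIM('a) + 1)) ^ j"
proof (induction j)
  case 0
  then show ?case using init by simp
next
  case (Suc j)
  define n where "n = DIM('a)"
  define C where "C = 819200 * energy_const / R\<^sup>2"
  define r0 where "r0 = sqrt (1 / 4 ^ (n + 1) / C)"
  define t :: real where "t = 2 ^ j"
  have t: "1 \<le> t" "t\<^sup>2 = 4 ^ j" by (simp_all add: t_def power2_eq_square power_mult_distrib[symmetric])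
  have C: "0 < C" using energy_const_pos R by (simp add: C_def)
  have r0: "0 < r0" "r0\<^sup>2 = 1 / 4 ^ (n + 1) / C" using C by (simp_all add: r0_def)
  have sc: "sup_const = unit_ball_vol n / 64 * r0 ^ n"
    by (simp add: sup_const_def r0_def C_def n_def)
  define s where "s = R\<^sup>2 / 4 * (1 / 2 + 1 / (2 * t))"
  define s' where "s' = R\<^sup>2 / 4 * (1 / 2 + 1 / (4 * t))"
  define k where "k = M * (1 - 1 / t)"
  \<comment> \<open>\<open>2 * d\<close> is the increment M/2^(j+1) of the levels;
    \<open>k / d\<close> is then \<open>4 * t - 4\<close>, whence the ratio bound
    \<open>5 * t\<close>.\<close>
  define d where "d = M / (4 * t)"
  define r where "r = r0 / 4 ^ j"
  \<comment> \<open>The squared radii differ by R^2/(16t) and the outer radius is at most R/2, so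
    8(R/2) * 16t/R^2 = 64t/R.\<close>
  define L where "L = 64 * t / R"
  have IH: "excess s k \<le> sup_const * M\<^sup>2 / (4 ^ (n + 1)) ^ j"
    using Suc.IH by (simp add: s_def k_def t_def n_def)
  have R2: "0 < R\<^sup>2" using R by simp
  have s: "0 < s'" "s' < s" "s < R\<^sup>2" "s \<le> R\<^sup>2 / 4"
  proof -
    show "0 < s'" using R2 t by (simp add: s'_def add_pos_pos)
    have "1 / (4 * t) < 1 / (2 * t)" using t by (simp add: field_simps)
    then show "s' < s" unfolding s_def s'_def using R2 by (intro mult_strict_left_mono) auto
    have "1 / (2 * t) \<le> 1 / 2" using t by (simp add: field_simps)
    then show "s \<le> R\<^sup>2 / 4" unfolding s_def using mult_left_mono[of "1 / 2 + 1 / (2 * t)" 1 "R\<^sup>2 / 4"] by simp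
    then show "s < R\<^sup>2" using R2 by linarith
  qed
  have diff: "s - s' = R\<^sup>2 / (16 * t)"
    using t by (simp add: s_def s'_def field_simps)
  have kd: "0 \<le> k" "0 < d" using M t by (simp_all add: k_def d_def)
  have N: "1 + k / d \<le> 5 * t"
  proof -
    have "k / d = 4 * t * (1 - 1 / t)" using M t by (simp add: k_def d_def field_simps)
    also have "\<dots> = 4 * t - 4" using t by (simp add: right_diff_distrib)
    finally show ?thesis using t by simp
  qed
  have L: "1 \<le> L" "8 * sqrt s / (s - s') \<le> L"
  proof -
    have "R \<le> 64 * t" using R t by linarith
    then show "1 \<le> L" using R by (simp add: L_def)
    have "sqrt s \<le> R / 2" using s R by (intro real_le_lsqrt) (auto simp: power_divide)
    then have "8 * sqrt s / (s - s') \<le> 8 * (R / 2) / (s - s')"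
      using s by (intro divide_right_mono mult_left_mono) auto
    also have "\<dots> = L" using R t by (simp add: diff L_def field_simps power2_eq_square)
    finally show "8 * sqrt s / (s - s') \<le> L" .
  qed
  have r: "0 < r" using r0 by (simp add: r_def)
  have p: "(4 ^ (n + 1)) ^ j = t\<^sup>2 * (4 ^ j) ^ n" for n :: nat
    unfolding t(2) by (simp add: power_mult_distrib power_mult[symmetric] mult.commute[of n j])
  have small: "excess s k \<le> d\<^sup>2 * (measure lborel (ball (0::'a) r) / 4)"
  proof -
    have "measure lborel (ball (0::'a) r) = unit_ball_vol n * (r0 / 4 ^ j) ^ n"
      using content_ball[of r "0::'a"] r by (simp add: n_def r_def)
    then have "d\<^sup>2 * (measure lborel (ball (0::'a) r) / 4) = sup_const * M\<^sup>2 / (t\<^sup>2 * (4 ^ j) ^ n)"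
      by (simp add: sc d_def power_divide power_mult_distrib)
    then show ?thesis using IH unfolding p by simp
  qed
  have "excess s' (k + 2 * d) \<le> 8 * r\<^sup>2 * (energy_const * L\<^sup>2 * (5 * t)\<^sup>2) * excess s k"
    by (rule excess_step[OF s(1-3) kd N r L small])
  also have "8 * r\<^sup>2 * (energy_const * L\<^sup>2 * (5 * t)\<^sup>2) = 1 / 4 ^ (n + 1)"
  proof -
    have r2: "r\<^sup>2 * (t\<^sup>2 * t\<^sup>2) = r0\<^sup>2"
      by (simp add: r_def power_divide t(2)) (simp add: power2_eq_square)
    have "8 * r\<^sup>2 * (energy_const * L\<^sup>2 * (5 * t)\<^sup>2) = C * (r\<^sup>2 * (t\<^sup>2 * t\<^sup>2))"
      by (simp add: C_def L_def power_divide power_mult_distrib)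
    also have "\<dots> = 1 / 4 ^ (n + 1)" unfolding r2 r0(2) using C by simp
    finally show ?thesis .
  qed
  also have "1 / 4 ^ (n + 1) * excess s k \<le> 1 / 4 ^ (n + 1) * (sup_const * M\<^sup>2 / (4 ^ (n + 1)) ^ j)"
    using IH by (intro mult_left_mono) auto
  finally have "excess s' (k + 2 * d) \<le> sup_const * M\<^sup>2 / (4 ^ (n + 1)) ^ Suc j"
    by simp
  moreover have "k + 2 * d = M * (1 - 1 / 2 ^ Suc j)"
    using t by (simp add: k_def d_def field_simps t_def)
  moreover have "s' = R\<^sup>2 / 4 * (1 / 2 + 1 / 2 ^ (Suc j + 1))"
    by (simp add: s'_def t_def)
  ultimately show ?case by (simp add: n_def)
qed

text \<open>The levels stay below \<open>M\<close> and the balls keep a fixed radius. A value above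
  \<open>M\<close> at the centre would persist on a small ball by continuity and bound all excesses
  from below, although they tend to 0.\<close>

lemma center_le:
  assumes M: "0 < M" and init: "excess (R\<^sup>2 / 4) 0 \<le> sup_const * M\<^sup>2"
  shows "v x0 \<le> M"
proof (rule ccontr)
  assume "\<not> v x0 \<le> M"
  define e where "e = (v x0 - M) / 2"
  have e: "0 < e" using \<open>\<not> v x0 \<le> M\<close> by (simp add: e_def)
  have "isCont v x0"
    using C1_grad_continuous[OF v] R by (simp add: continuous_on_eq_continuous_at)
  then obtain \<rho> where \<rho>: "0 < \<rho>" "\<And>x. dist x x0 < \<rho> \<Longrightarrow> dist (v x) (v x0) < e"
    using e unfolding continuous_at_eps_delta by blast
  \<comment> \<open>R^2/8 is the limit of the squared radii, so this ball lies inside every ball of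
    the iteration.\<close>
  define \<sigma> where "\<sigma> = min \<rho> (sqrt (R\<^sup>2 / 8))"
  have \<sigma>: "0 < \<sigma>" using \<rho> R by (simp add: \<sigma>_def)
  have low: "e\<^sup>2 * measure lborel (ball x0 \<sigma>) \<le> sup_const * M\<^sup>2 / (4 ^ (DIM('a) + 1)) ^ j" for j
  proof -
    define s where "s = R\<^sup>2 / 4 * (1 / 2 + 1 / 2 ^ (j + 1))"
    define k where "k = M * (1 - 1 / 2 ^ j)"
    have "1 / 2 + 1 / 2 ^ (j + 1) \<le> (1 :: real)" by (simp add: field_simps)
    then have "R\<^sup>2 / 4 * (1 / 2 + 1 / 2 ^ (j + 1)) \<le> R\<^sup>2 / 4 * 1" by (intro mult_left_mono) auto
    moreover have "0 < R\<^sup>2" using R by simp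
    ultimately have s: "s < R\<^sup>2" unfolding s_def by linarith
    have s8: "R\<^sup>2 / 8 \<le> s" unfolding s_def using mult_left_mono[of "1 / 2" "1 / 2 + 1 / 2 ^ (j + 1)" "R\<^sup>2 / 4"] by simp
    have kM: "k \<le> M" using M by (simp add: k_def)
    have "e\<^sup>2 * measure lborel (ball x0 \<sigma>) = (\<integral>x. e\<^sup>2 * indicator (ball x0 \<sigma>) x \<partial>lborel)"
      by simp
    also have "\<dots> \<le> excess s k"
      unfolding excess_def
    proof (intro integral_mono integrable_excess s integrable_mult_right integrable_real_indicator)
      show "ball x0 \<sigma> \<in> sets lborel" by simp
      show "emeasure lborel (ball x0 \<sigma>) < \<infinity>" by (rule emeasure_lborel_ball_finite)
      show "e\<^sup>2 * indicator (ball x0 \<sigma>) x \<le> indicator (cball x0 (sqrt s)) x * (max 0 (v x - k))\<^sup>2" for x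
      proof (cases "x \<in> ball x0 \<sigma>")
        case True
        then have "dist x x0 < \<rho>" and "dist x0 x < sqrt (R\<^sup>2 / 8)" by (auto simp: \<sigma>_def dist_commute)
        then have "x \<in> cball x0 (sqrt s)" using real_sqrt_le_mono[OF s8] unfolding mem_cball by linarith
        have "\<bar>v x - v x0\<bar> < e" using \<rho>(2)[OF \<open>dist x x0 < \<rho>\<close>] by (simp add: dist_real_def)
        moreover have "v x0 = M + 2 * e" by (simp add: e_def field_simps)
        ultimately have "e \<le> v x - k" using kM by linarith
        then have "e \<le> max 0 (v x - k)" by simp
        then have "e\<^sup>2 \<le> (max 0 (v x - k))\<^sup>2" using e by (intro power_mono) auto
        then show ?thesis using True \<open>x \<in> cball x0 (sqrt s)\<close> by simp
      qed simp
    qed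
    also have "\<dots> \<le> sup_const * M\<^sup>2 / (4 ^ (DIM('a) + 1)) ^ j"
      unfolding s_def k_def by (rule excess_decay[OF M init])
    finally show ?thesis .
  qed
  have "(\<lambda>j. sup_const * M\<^sup>2 * (1 / 4 ^ (DIM('a) + 1)) ^ j) \<longlonglongrightarrow> sup_const * M\<^sup>2 * 0"
    by (intro tendsto_mult tendsto_const LIMSEQ_power_zero)
      (use one_less_power[of "4::real" "DIM('a) + 1"] in simp)
  then have "(\<lambda>j. sup_const * M\<^sup>2 / (4 ^ (DIM('a) + 1)) ^ j) \<longlonglongrightarrow> 0"
    by (simp add: power_divide)
  then have "e\<^sup>2 * measure lborel (ball x0 \<sigma>) \<le> 0"
    using low by (intro LIMSEQ_le_const) auto
  moreover have "0 < e\<^sup>2 * measure lborel (ball x0 \<sigma>)"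
    using e \<sigma> by simp
  ultimately show False by simp
qed

theorem sup_bound:
  "sup_const * (v x0)\<^sup>2 \<le> (\<integral>x. indicator (cball x0 (R / 2)) x * (v x)\<^sup>2 \<partial>lborel)"
proof -
  have "sqrt (R\<^sup>2 / 4) = R / 2" using R by (simp add: real_sqrt_divide)
  then have E: "excess (R\<^sup>2 / 4) 0 = (\<integral>x. indicator (cball x0 (R / 2)) x * (v x)\<^sup>2 \<partial>lborel)"
    unfolding excess_def
    by (intro Bochner_Integration.integral_cong refl)
      (use v_nonneg R in \<open>auto simp: indicator_def max_def\<close>)
  have v0: "0 \<le> v x0" using v_nonneg[of x0] R by simp
  show ?thesis
  proof (rule ccontr)
    assume "\<not> ?thesis"
    then have lt: "excess (R\<^sup>2 / 4) 0 / sup_const < (v x0)\<^sup>2"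
      using sup_const_pos by (simp add: E divide_less_eq mult.commute)
    have "0 \<le> excess (R\<^sup>2 / 4) 0" unfolding excess_def by (intro integral_nonneg_AE) auto
    \<comment> \<open>The midpoint of the two squares keeps \<open>M\<close> positive, as
      \<open>center_le\<close> demands, even when the excess is 0.\<close>
    define M where "M = sqrt ((excess (R\<^sup>2 / 4) 0 / sup_const + (v x0)\<^sup>2) / 2)"
    have avg: "a \<le> (a + b) / 2" if "a < b" for a b :: real using that by (simp add: field_simps)
    have nn: "0 \<le> excess (R\<^sup>2 / 4) 0 / sup_const"
      using \<open>0 \<le> excess (R\<^sup>2 / 4) 0\<close> sup_const_pos by simp
    have M2: "M\<^sup>2 = (excess (R\<^sup>2 / 4) 0 / sup_const + (v x0)\<^sup>2) / 2" using nn by (simp add: M_def)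
    have "0 < M" using nn lt by (simp add: M_def)
    moreover have "excess (R\<^sup>2 / 4) 0 \<le> sup_const * M\<^sup>2"
    proof -
      have "excess (R\<^sup>2 / 4) 0 / sup_const \<le> M\<^sup>2" unfolding M2 using avg[OF lt] .
      then show ?thesis using sup_const_pos by (simp add: divide_le_eq mult.commute)
    qed
    ultimately have "v x0 \<le> M" by (rule center_le)
    then have "(v x0)\<^sup>2 \<le> M\<^sup>2" using v0 by (rule power_mono)
    then show False using lt by (simp add: M2)
  qed
qed

end

subsection \<open>The density\<close>

locale admissible_density =
  fixes C1 C2 :: real and \<rho> \<rho>' H :: "real \<Rightarrow> real"
  assumes C: "0 < C1" "0 < C2" and dens: "hodge_density C1 C2 \<rho> \<rho>' H"
begin

definition H' :: "real \<Rightarrow> real" where "H' q = \<rho> q / 2 + q * \<rho>' q"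

lemma \<rho>_pos: "0 \<le> q \<Longrightarrow> 0 < \<rho> q"
  and \<rho>_deriv: "0 \<le> q \<Longrightarrow> (\<rho> has_real_derivative \<rho>' q) (at q within {0..})"
  and \<rho>'_cont: "continuous_on {0..} \<rho>'"
  and H0: "H 0 = 0"
  and H_deriv: "0 \<le> q \<Longrightarrow> (H has_real_derivative H' q) (at q within {0..})"
  and H'_le: "0 \<le> q \<Longrightarrow> 0 < \<rho>' q \<Longrightarrow> H' q \<le> C1 * \<rho> q"
  and H'_ge: "0 \<le> q \<Longrightarrow> \<rho>' q < 0 \<Longrightarrow> C2 * \<rho> q \<le> H' q"
  using dens by (simp_all add: hodge_density_def H'_def)

lemma \<rho>_cont: "continuous_on {0..} \<rho>"
  by (rule DERIV_continuous_on[of _ _ \<rho>']) (use \<rho>_deriv in auto)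

lemma H'_cont: "continuous_on {0..} H'"
  unfolding H'_def[abs_def] by (intro continuous_intros \<rho>_cont \<rho>'_cont) simp

lemma H'_lower: "0 \<le> q \<Longrightarrow> min (1 / 2) C2 * \<rho> q \<le> H' q"
proof -
  assume q: "0 \<le> q"
  have "min (1 / 2) C2 * \<rho> q \<le> 1 / 2 * \<rho> q" "min (1 / 2) C2 * \<rho> q \<le> C2 * \<rho> q"
    using \<rho>_pos[OF q] by (intro mult_right_mono; simp)+
  moreover have "1 / 2 * \<rho> q \<le> H' q" if "0 \<le> \<rho>' q" using q that by (simp add: H'_def)
  ultimately show ?thesis using H'_ge[OF q] by (cases "\<rho>' q < 0") auto
qed

lemma H'_pos: "0 \<le> q \<Longrightarrow> 0 < H' q"
  using H'_lower[of q] \<rho>_pos[of q] C by (smt (verit) mult_pos_pos min_less_iff_conj zero_less_divide_1_iff)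

text \<open>The derivative of Q\<open>\<rho>\<close> is H' + \<open>\<rho>\<close>/2, and
  \<open>\<rho>\<close> is at most H' / \<open>min (1 / 2) C2\<close>; so \<open>\<kappa>\<close>
  bounds the ratio of the derivatives of Q\<open>\<rho>\<close> and H, both of which vanish at
  0.\<close>

definition \<kappa> :: real where "\<kappa> = 1 + 1 / (2 * min (1 / 2) C2)"

lemma \<kappa>_pos: "0 < \<kappa>" using C by (simp add: \<kappa>_def add_pos_pos)

lemma H_bounds:
  assumes "0 \<le> q" shows "0 \<le> H q" "q * \<rho> q \<le> \<kappa> * H q"
proof -
  have inner: "(f has_real_derivative y) (at t)"
    if "(f has_real_derivative y) (at t within {0..})" "0 < t" for f :: "real \<Rightarrow> real" and t y
    using that at_within_interior[of t "{0..}"] by (simp add: interior_real_atLeast)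
  have Hc: "continuous_on {0..} H"
    by (rule DERIV_continuous_on[of _ _ H']) (use H_deriv in auto)
  have "H 0 \<le> H q"
  proof (rule DERIV_nonneg_imp_increasing_open[OF assms])
    show "continuous_on {0..q} H" by (intro continuous_on_subset[OF Hc]) auto
    show "\<exists>y. (H has_real_derivative y) (at t) \<and> 0 \<le> y" if "0 < t" "t < q" for t
      using inner[where f=H, OF H_deriv[of t]] H'_pos[of t] that by (intro exI[of _ "H' t"]) auto
  qed
  then show "0 \<le> H q" by (simp add: H0)
  let ?f = "\<lambda>t. \<kappa> * H t - t * \<rho> t"
  have "?f 0 \<le> ?f q"
  proof (rule DERIV_nonneg_imp_increasing_open[OF assms])
    show "continuous_on {0..q} ?f"
      by (intro continuous_intros continuous_on_subset[OF Hc] continuous_on_subset[OF \<rho>_cont]) auto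
    fix t assume t: "0 < t" "t < q"
    have "(?f has_real_derivative \<kappa> * H' t - (\<rho> t + t * \<rho>' t)) (at t)"
      using inner[where f=H, OF H_deriv[of t]] inner[where f=\<rho>, OF \<rho>_deriv[of t]] t
      by (auto intro!: derivative_eq_intros)
    moreover have "0 \<le> \<kappa> * H' t - (\<rho> t + t * \<rho>' t)"
    proof -
      have m: "0 < min (1 / 2) C2" using C by simp
      have "\<rho> t / 2 = 1 / (2 * min (1 / 2) C2) * (min (1 / 2) C2 * \<rho> t)" using m by simp
      also have "\<dots> \<le> 1 / (2 * min (1 / 2) C2) * H' t"
        using H'_lower[of t] t m by (intro mult_left_mono) auto
      finally have "\<rho> t / 2 \<le> (\<kappa> - 1) * H' t" by (simp add: \<kappa>_def)
      moreover have "\<rho> t + t * \<rho>' t = H' t + \<rho> t / 2" by (simp add: H'_def)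
      ultimately show ?thesis by (simp add: left_diff_distrib)
    qed
    ultimately show "\<exists>y. (?f has_real_derivative y) (at t) \<and> 0 \<le> y" by blast
  qed
  then show "q * \<rho> q \<le> \<kappa> * H q" by (simp add: H0)
qed

text \<open>Q\<open>\<rho>'\<close> equals H' - \<open>\<rho>\<close>/2, so an upper bound on H'
  serves where it is positive and H' > 0 where it is negative. This controls the terms in which
  \<open>\<rho>'\<close> meets \<open>\<Gamma>\<close>.\<close>

lemma \<rho>'_bound: "0 \<le> q \<Longrightarrow> \<bar>\<rho>' q\<bar> * q \<le> (C1 + 1 / 2) * \<rho> q"
proof -
  assume q: "0 \<le> q"
  have p: "0 < C1 * \<rho> q" "0 < C2 * \<rho> q" using C \<rho>_pos[OF q] by simp_all
  have e: "q * \<rho>' q = H' q - \<rho> q / 2" by (simp add: H'_def)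
  consider "0 < \<rho>' q" | "\<rho>' q = 0" | "\<rho>' q < 0" by linarith
  then have "\<bar>\<rho>' q\<bar> * q \<le> C1 * \<rho> q + \<rho> q / 2"
  proof cases
    case 1
    then have "\<bar>\<rho>' q\<bar> * q = H' q - \<rho> q / 2" using e by (simp add: mult.commute)
    then show ?thesis using H'_le[OF q 1] \<rho>_pos[OF q] by linarith
  next
    case 3
    then have "\<bar>\<rho>' q\<bar> * q = \<rho> q / 2 - H' q" using e by (simp add: mult.commute)
    then show ?thesis using H'_ge[OF q 3] p by linarith
  qed (use p \<rho>_pos[OF q] in simp)
  then show ?thesis by (simp add: distrib_right)
qed

section \<open>Ellipticity constants\<close>

definition ell :: real where "ell = min 1 (1 / (2 * C1))"
definition ell' :: real where "ell' = max 1 (1 / C2)"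

lemma ell: "0 < ell" "0 \<le> ell'" using C by (simp_all add: ell_def ell'_def)

lemma ell_le:
  assumes "0 \<le> q" "\<rho>' q \<ge> 0" shows "2 * ell * H' q \<le> \<rho> q"
proof (cases "\<rho>' q = 0")
  case True
  then show ?thesis using \<rho>_pos[OF assms(1)] mult_right_mono[of ell 1 "\<rho> q"] by (simp add: H'_def ell_def)
next
  case False
  have "2 * ell * H' q \<le> 2 * (1 / (2 * C1)) * (C1 * \<rho> q)"
    using assms False H'_le[of q] H'_pos[of q] C ell
    by (intro mult_mono) (auto simp: ell_def)
  then show ?thesis using C by simp
qed

text \<open>The left side is exactly 2H' if \<rho>' \<ge> 0 and 2\<open>\<rho>\<close> - 2H'
  otherwise; the second case needs the bound with \<open>C2\<close>.\<close>

lemma ell'_ge: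
  assumes "0 \<le> q" shows "\<rho> q + 2 * (\<bar>\<rho>' q\<bar> * q) \<le> ell' * (2 * H' q)"
proof (cases "\<rho>' q < 0")
  case True
  have "\<rho> q = 1 / C2 * (C2 * \<rho> q)" using C by simp
  also have "\<dots> \<le> ell' * H' q"
    using H'_ge[OF assms True] \<rho>_pos[OF assms] C by (intro mult_mono) (auto simp: ell'_def)
  finally have 1: "\<rho> q \<le> ell' * H' q" .
  have "\<bar>\<rho>' q\<bar> * q = \<rho> q / 2 - H' q" using True by (simp add: H'_def)
  then show ?thesis using 1 H'_pos[OF assms] by simp
next
  case False
  then have "\<rho> q + 2 * (\<bar>\<rho>' q\<bar> * q) = 1 * (2 * H' q)" by (simp add: H'_def)
  also have "\<dots> \<le> ell' * (2 * H' q)" using H'_pos[OF assms] by (intro mult_right_mono) (auto simp: ell'_def)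
  finally show ?thesis .
qed

end

subsection \<open>Pointwise estimates\<close>

lemma norm_matrix_vector_mult_le:
  fixes D :: "real^'n^'m" shows "norm (D *v w) \<le> norm D * norm w"
proof -
  have "(norm (D *v w))\<^sup>2 = (\<Sum>i\<in>UNIV. (inner (D $ i) w)\<^sup>2)"
    unfolding power2_norm_eq_inner inner_vec_def[of "D *v w"]
    by (simp add: matrix_vector_mult_def inner_vec_def power2_eq_square)
  also have "\<dots> \<le> (\<Sum>i\<in>UNIV. (norm (D $ i))\<^sup>2 * (norm w)\<^sup>2)"
    using power_mono[OF Cauchy_Schwarz_ineq2, of _ _ 2] by (intro sum_mono) (simp add: power_mult_distrib)
  also have "\<dots> = (norm D * norm w)\<^sup>2"
    by (simp add: power_mult_distrib sum_distrib_right[symmetric] power2_norm_eq_inner[of D] inner_vec_def[of D D]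
        power2_norm_eq_inner)
  finally show ?thesis by (rule power2_le_imp_le) simp
qed

text \<open>The antisymmetric part of \<open>D\<close> is prescribed by the curl equation, so
  replacing \<open>D\<close> by its transpose leaves only terms without derivatives (first part) or
  turns the trace of the square of \<open>D\<close> into its squared Frobenius norm (second
  part).\<close>

lemma sum_curl_swap:
  fixes D :: "real^'n^'n" and w \<Gamma> :: "real^'n"
  assumes curl: "\<And>i j. D $ i $ j - D $ j $ i = \<Gamma> $ i * w $ j - \<Gamma> $ j * w $ i"
  shows "w v* D = D *v w + inner \<Gamma> w *\<^sub>R w - inner w w *\<^sub>R \<Gamma>" (is ?A)
    and "(\<Sum>i\<in>UNIV. \<Sum>j\<in>UNIV. D $ j $ i * D $ i $ j)
      = (norm D)\<^sup>2 + (inner \<Gamma> w)\<^sup>2 - inner w w * (norm \<Gamma>)\<^sup>2" (is ?B)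
proof -
  have D: "D $ j $ i = D $ i $ j - \<Gamma> $ i * w $ j + \<Gamma> $ j * w $ i" for i j
    using curl[of i j] by simp
  show A: ?A
  proof (subst vec_eq_iff, rule allI)
    fix j
    have "(w v* D) $ j = (\<Sum>i\<in>UNIV. w $ i * D $ i $ j)"
      by (simp add: vector_matrix_mult_def mult.commute)
    also have "\<dots> = (\<Sum>i\<in>UNIV. D $ j $ i * w $ i + (\<Gamma> $ i * w $ i) * w $ j - (w $ i * w $ i) * \<Gamma> $ j)"
    proof (intro sum.cong refl)
      fix i
      show "w $ i * D $ i $ j = D $ j $ i * w $ i + (\<Gamma> $ i * w $ i) * w $ j - (w $ i * w $ i) * \<Gamma> $ j"
        unfolding D[of j i] by (simp add: algebra_simps)
    qed
    also have "\<dots> = (D *v w + inner \<Gamma> w *\<^sub>R w - inner w w *\<^sub>R \<Gamma>) $ j"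
      by (simp add: sum.distrib sum_subtractf sum_distrib_right matrix_vector_mult_def inner_vec_def)
    finally show "(w v* D) $ j = (D *v w + inner \<Gamma> w *\<^sub>R w - inner w w *\<^sub>R \<Gamma>) $ j" .
  qed
  have "(\<Sum>i\<in>UNIV. \<Sum>j\<in>UNIV. D $ j $ i * D $ i $ j)
    = (\<Sum>i\<in>UNIV. \<Sum>j\<in>UNIV. D $ i $ j * D $ i $ j) - (\<Sum>i\<in>UNIV. \<Sum>j\<in>UNIV. \<Gamma> $ i * (D $ i $ j * w $ j))
      + (\<Sum>i\<in>UNIV. \<Sum>j\<in>UNIV. \<Gamma> $ j * (w $ i * D $ i $ j))"
    unfolding sum.distrib[symmetric] sum_subtractf[symmetric]
  proof (intro sum.cong refl)
    fix i j
    show "D $ j $ i * D $ i $ j = D $ i $ j * D $ i $ j - \<Gamma> $ i * (D $ i $ j * w $ j) + \<Gamma> $ j * (w $ i * D $ i $ j)"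
      unfolding D[of i j] by (simp add: algebra_simps)
  qed
  also have "(\<Sum>i\<in>UNIV. \<Sum>j\<in>UNIV. D $ i $ j * D $ i $ j) = (norm D)\<^sup>2"
    by (simp add: power2_norm_eq_inner inner_vec_def)
  also have "(\<Sum>i\<in>UNIV. \<Sum>j\<in>UNIV. \<Gamma> $ i * (D $ i $ j * w $ j)) = inner \<Gamma> (D *v w)"
    by (simp add: inner_vec_def matrix_vector_mult_def sum_distrib_left)
  also have "(\<Sum>i\<in>UNIV. \<Sum>j\<in>UNIV. \<Gamma> $ j * (w $ i * D $ i $ j)) = inner \<Gamma> (w v* D)"
    by (subst sum.swap) (simp add: inner_vec_def vector_matrix_mult_def sum_distrib_left mult.commute mult.left_commute)
  finally show ?B
    unfolding A by (simp add: inner_add_right inner_diff_right power2_norm_eq_inner power2_eq_square[of "inner \<Gamma> w"] inner_commute)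
qed

text \<open>\<open>dF i j\<close> is the i-th partial derivative of the j-th component of
  \<open>\<rho>(Q) \<omega>\<close>. The left sides are the coefficients of the gradient of the test
  function and of the test function itself in the weak identity.\<close>

lemma divergence_terms:
  fixes D :: "real^'n^'n" and w \<Gamma> :: "real^'n" and r r' :: real
  defines "z \<equiv> D *v w"
  defines "dF \<equiv> \<lambda>i j. r * D $ i $ j + 2 * r' * z $ i * w $ j"
  assumes curl: "\<And>i j. D $ i $ j - D $ j $ i = \<Gamma> $ i * w $ j - \<Gamma> $ j * w $ i"
    and div: "(\<Sum>k\<in>UNIV. dF k k) = - r * inner \<Gamma> w"
  shows "(\<chi> j. (\<Sum>i\<in>UNIV. w $ i * dF i j) - (\<Sum>k\<in>UNIV. dF k k) * w $ j)
      = r *\<^sub>R z + (2 * r' * inner z w) *\<^sub>R w + r *\<^sub>R ((2 * inner \<Gamma> w) *\<^sub>R w - inner w w *\<^sub>R \<Gamma>)" (is ?A)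
    and "(\<Sum>i\<in>UNIV. \<Sum>j\<in>UNIV. D $ j $ i * dF i j) - (\<Sum>k\<in>UNIV. dF k k) * (\<Sum>k\<in>UNIV. D $ k $ k)
      = r * ((norm D)\<^sup>2 - inner w w * (norm \<Gamma>)\<^sup>2) + 2 * r' * ((norm z)\<^sup>2 - inner w w * inner \<Gamma> z)" (is ?B)
proof -
  note A = sum_curl_swap(1)[OF curl, folded z_def] and B = sum_curl_swap(2)[OF curl]
  show ?A
  proof (subst vec_eq_iff, rule allI)
    fix j
    have "(\<Sum>i\<in>UNIV. w $ i * dF i j) = r * (w v* D) $ j + 2 * r' * inner z w * w $ j"
      by (simp add: dF_def vector_matrix_mult_def inner_vec_def sum_distrib_left sum_distrib_right
          sum.distrib[symmetric] algebra_simps)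
    then show "(\<chi> j. (\<Sum>i\<in>UNIV. w $ i * dF i j) - (\<Sum>k\<in>UNIV. dF k k) * w $ j) $ j
      = (r *\<^sub>R z + (2 * r' * inner z w) *\<^sub>R w + r *\<^sub>R ((2 * inner \<Gamma> w) *\<^sub>R w - inner w w *\<^sub>R \<Gamma>)) $ j"
      by (simp add: A div algebra_simps)
  qed
  have tr: "r * (\<Sum>k\<in>UNIV. D $ k $ k) = - r * inner \<Gamma> w - 2 * r' * inner z w"
    using div by (simp add: dF_def sum.distrib sum_distrib_left inner_vec_def mult.assoc)
  have "(\<Sum>i\<in>UNIV. \<Sum>j\<in>UNIV. D $ j $ i * dF i j)
      = r * (\<Sum>i\<in>UNIV. \<Sum>j\<in>UNIV. D $ j $ i * D $ i $ j) + 2 * r' * inner z (w v* D)"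
    by (simp add: dF_def vector_matrix_mult_def inner_vec_def sum_distrib_left sum_distrib_right
          sum.distrib[symmetric] algebra_simps)
  also have "\<dots> = r * ((norm D)\<^sup>2 + (inner \<Gamma> w)\<^sup>2 - inner w w * (norm \<Gamma>)\<^sup>2)
      + 2 * r' * ((norm z)\<^sup>2 + inner \<Gamma> w * inner z w - inner w w * inner \<Gamma> z)"
    unfolding A B by (simp add: inner_add_right inner_diff_right power2_norm_eq_inner inner_commute)
  finally have 1: "(\<Sum>i\<in>UNIV. \<Sum>j\<in>UNIV. D $ j $ i * dF i j) = \<dots>" .
  have 2: "(\<Sum>k\<in>UNIV. dF k k) * (\<Sum>k\<in>UNIV. D $ k $ k) = inner \<Gamma> w * (r * inner \<Gamma> w + 2 * r' * inner z w)"
  proof -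
    have "(\<Sum>k\<in>UNIV. dF k k) * (\<Sum>k\<in>UNIV. D $ k $ k) = - inner \<Gamma> w * (r * (\<Sum>k\<in>UNIV. D $ k $ k))"
      by (simp add: div)
    then show ?thesis unfolding tr by (simp add: algebra_simps)
  qed
  \<comment> \<open>The terms with \<open>inner \<Gamma> w\<close> produced by transposition cancel
    exactly against the product of the two divergences.\<close>
  show ?B unfolding 1 2 by (simp add: algebra_simps power2_eq_square)
qed

context admissible_density begin

text \<open>The quadratic part keeps a fraction \<open>c\<close> of \<open>\<rho>\<close> times the
  squared norm of \<open>D\<close>, just enough to absorb the mixed term by a completed square. What
  remains is a multiple of Q\<open>\<rho>\<close>, hence of H.\<close>

lemma zeroth_order_bound:
  fixes D :: "real^'n^'n" and w \<Gamma> :: "real^'n"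
  defines "z \<equiv> D *v w" and "q \<equiv> inner w w" and "c \<equiv> min 1 (2 * C2)"
  assumes G: "norm \<Gamma> \<le> G"
  shows "- (\<kappa> * G\<^sup>2 * (1 + (C1 + 1 / 2)\<^sup>2 / c)) * H q
    \<le> \<rho> q * ((norm D)\<^sup>2 - q * (norm \<Gamma>)\<^sup>2) + 2 * \<rho>' q * ((norm z)\<^sup>2 - q * inner \<Gamma> z)"
proof -
  define k where "k = C1 + 1 / 2"
  define s where "s = norm w"
  have q: "0 \<le> q" "q = s\<^sup>2" "0 \<le> s" by (simp_all add: q_def s_def power2_norm_eq_inner)
  have G0: "0 \<le> G" using G norm_ge_zero order_trans by blast
  note rpos = \<rho>_pos[OF q(1)]
  have c: "0 < c" using C by (simp add: c_def)
  have z: "norm z \<le> norm D * s" unfolding z_def s_def by (rule norm_matrix_vector_mult_le)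
  then have z2: "(norm z)\<^sup>2 \<le> (norm D)\<^sup>2 * q"
    using power_mono[OF z, of 2] by (simp add: q power_mult_distrib)
  \<comment> \<open>If \<rho>' < 0, the worst case is \<open>z\<close> of maximal length, and there
    the coefficient is \<open>\<rho>\<close> + 2Q\<open>\<rho>'\<close> = 2H', at least 2
    \<open>C2\<close> times \<open>\<rho>\<close>. This is the origin of \<open>c\<close>.\<close>
  have main: "c * \<rho> q * (norm D)\<^sup>2 \<le> \<rho> q * (norm D)\<^sup>2 + 2 * \<rho>' q * (norm z)\<^sup>2"
  proof (cases "\<rho>' q < 0")
    case True
    have "c * \<rho> q * (norm D)\<^sup>2 \<le> (2 * C2) * \<rho> q * (norm D)\<^sup>2"
      using rpos by (intro mult_right_mono) (auto simp: c_def)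
    also have "\<dots> \<le> (2 * H' q) * (norm D)\<^sup>2"
      using H'_ge[OF q(1) True] by (intro mult_right_mono) auto
    also have "\<dots> = \<rho> q * (norm D)\<^sup>2 + 2 * \<rho>' q * ((norm D)\<^sup>2 * q)"
      by (simp add: H'_def algebra_simps)
    also have "\<dots> \<le> \<rho> q * (norm D)\<^sup>2 + 2 * \<rho>' q * (norm z)\<^sup>2"
      using True z2 by (intro add_left_mono mult_left_mono_neg) auto
    finally show ?thesis .
  next
    case False
    have "c * \<rho> q * (norm D)\<^sup>2 \<le> 1 * \<rho> q * (norm D)\<^sup>2"
      using rpos by (intro mult_right_mono) (auto simp: c_def)
    moreover have "0 \<le> 2 * \<rho>' q * (norm z)\<^sup>2" using False by simp
    ultimately show ?thesis by simp
  qed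
  have "\<bar>2 * \<rho>' q * (q * inner \<Gamma> z)\<bar> = 2 * ((\<bar>\<rho>' q\<bar> * q) * \<bar>inner \<Gamma> z\<bar>)"
    using q by (simp add: abs_mult)
  also have "\<dots> \<le> 2 * ((k * \<rho> q) * (G * (norm D * s)))"
  proof (rule mult_left_mono[OF mult_mono])
    show "\<bar>\<rho>' q\<bar> * q \<le> k * \<rho> q" unfolding k_def by (rule \<rho>'_bound[OF q(1)])
    have "\<bar>inner \<Gamma> z\<bar> \<le> norm \<Gamma> * norm z" by (rule Cauchy_Schwarz_ineq2)
    also have "\<dots> \<le> G * (norm D * s)" using G z G0 by (intro mult_mono) auto
    finally show "\<bar>inner \<Gamma> z\<bar> \<le> G * (norm D * s)" .
  qed (use C rpos q in \<open>auto simp: k_def\<close>)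
  finally have lot: "\<bar>2 * \<rho>' q * (q * inner \<Gamma> z)\<bar> \<le> \<rho> q * (2 * k * G * s * norm D)" by (simp add: ac_simps)
  have "0 \<le> \<rho> q * ((c * norm D - k * G * s)\<^sup>2 / c)"
    using rpos c by simp
  also have "(c * norm D - k * G * s)\<^sup>2 / c = c * (norm D)\<^sup>2 - 2 * k * G * s * norm D + k\<^sup>2 / c * G\<^sup>2 * q"
    using c by (simp add: q(2) power2_diff add_divide_distrib diff_divide_distrib power_mult_distrib power2_eq_square[of c])
  finally have sq: "\<rho> q * (2 * k * G * s * norm D) \<le> c * \<rho> q * (norm D)\<^sup>2 + k\<^sup>2 / c * G\<^sup>2 * (q * \<rho> q)"
    by (simp add: algebra_simps)
  have "q * \<rho> q * (norm \<Gamma>)\<^sup>2 \<le> q * \<rho> q * G\<^sup>2"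
    using G rpos q by (intro mult_left_mono power_mono) auto
  moreover have "(q * \<rho> q) * (G\<^sup>2 * (1 + k\<^sup>2 / c)) \<le> (\<kappa> * H q) * (G\<^sup>2 * (1 + k\<^sup>2 / c))"
    using H_bounds[OF q(1)] c by (intro mult_right_mono) auto
  ultimately have "\<rho> q * (q * (norm \<Gamma>)\<^sup>2) + k\<^sup>2 / c * G\<^sup>2 * (q * \<rho> q) \<le> (\<kappa> * G\<^sup>2 * (1 + k\<^sup>2 / c)) * H q"
    by (simp add: algebra_simps)
  then show ?thesis using main lot sq unfolding k_def[symmetric] by (simp add: right_diff_distrib)
qed

text \<open>The principal part is a symmetric map applied to \<open>z\<close>, with eigenvalue
  \<open>\<rho>\<close> orthogonally to \<open>w\<close> and 2H' along it; the sign of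
  \<open>\<rho>'\<close> decides which is smaller. The \<open>\<Gamma>\<close> terms have total
  weight 2 + 1 = 3 and size \<open>G\<close> times Q\<open>\<rho>\<close>.\<close>

lemma flux_bounds:
  fixes z w \<Gamma> :: "'a::real_inner"
  defines "q \<equiv> inner w w"
  defines "W \<equiv> \<rho> q *\<^sub>R z + (2 * \<rho>' q * inner z w) *\<^sub>R w + \<rho> q *\<^sub>R ((2 * inner \<Gamma> w) *\<^sub>R w - q *\<^sub>R \<Gamma>)"
    and "g \<equiv> (2 * H' q) *\<^sub>R z"
  assumes G: "norm \<Gamma> \<le> G"
  shows "ell * (norm g)\<^sup>2 - 3 * G * \<kappa> * H q * norm g \<le> inner W g"
    and "norm W \<le> ell' * norm g + 3 * G * \<kappa> * H q"
proof -
  have q: "0 \<le> q" "norm w * norm w = q" by (simp_all add: q_def power2_norm_eq_inner[symmetric] power2_eq_square)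
  have G0: "0 \<le> G" using G norm_ge_zero order_trans by blast
  note rpos = \<rho>_pos[OF q(1)] and hpos = H'_pos[OF q(1)]
  define e where "e = \<rho> q *\<^sub>R ((2 * inner \<Gamma> w) *\<^sub>R w - q *\<^sub>R \<Gamma>)"
  have "norm ((2 * inner \<Gamma> w) *\<^sub>R w - q *\<^sub>R \<Gamma>) \<le> norm ((2 * inner \<Gamma> w) *\<^sub>R w) + norm (q *\<^sub>R \<Gamma>)"
    by (rule norm_triangle_ineq4)
  also have "\<dots> = 2 * \<bar>inner \<Gamma> w\<bar> * norm w + q * norm \<Gamma>"
    using q by (simp add: abs_mult)
  also have "\<dots> \<le> 2 * (norm \<Gamma> * norm w) * norm w + q * norm \<Gamma>"
    using Cauchy_Schwarz_ineq2 by (intro add_right_mono mult_right_mono mult_left_mono) auto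
  also have "\<dots> = 3 * norm \<Gamma> * q" using q(2) by (simp add: algebra_simps)
  also have "\<dots> \<le> 3 * G * q" using G q by (intro mult_right_mono) auto
  finally have "norm e \<le> \<rho> q * (3 * G * q)" unfolding e_def using rpos by simp
  also have "\<dots> = 3 * G * (q * \<rho> q)" by simp
  also have "\<dots> \<le> 3 * G * (\<kappa> * H q)" using H_bounds[OF q(1)] G0 by (intro mult_left_mono) auto
  finally have e: "norm e \<le> 3 * G * \<kappa> * H q" by simp
  have W: "W = \<rho> q *\<^sub>R z + (2 * \<rho>' q * inner z w) *\<^sub>R w + e" by (simp add: W_def e_def)
  have zw: "(inner z w)\<^sup>2 \<le> q * (norm z)\<^sup>2"
    using power_mono[OF Cauchy_Schwarz_ineq2[of z w], of 2] q
    by (simp add: power_mult_distrib mult.commute power2_eq_square[of "norm w"])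
  have ng: "norm g = 2 * H' q * norm z" using hpos by (simp add: g_def)
  have "ell * (2 * H' q) * (norm z)\<^sup>2 \<le> \<rho> q * (norm z)\<^sup>2 + 2 * \<rho>' q * (inner z w)\<^sup>2"
  proof (cases "\<rho>' q < 0")
    case True
    have "ell * (2 * H' q) * (norm z)\<^sup>2 \<le> 1 * (2 * H' q) * (norm z)\<^sup>2"
      using hpos by (intro mult_right_mono) (auto simp: ell_def)
    also have "\<dots> = \<rho> q * (norm z)\<^sup>2 + 2 * \<rho>' q * (q * (norm z)\<^sup>2)"
      by (simp add: H'_def algebra_simps)
    also have "\<dots> \<le> \<rho> q * (norm z)\<^sup>2 + 2 * \<rho>' q * (inner z w)\<^sup>2"
      using True zw by (intro add_left_mono mult_left_mono_neg) auto
    finally show ?thesis .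
  next
    case False
    have "ell * (2 * H' q) * (norm z)\<^sup>2 \<le> \<rho> q * (norm z)\<^sup>2"
      using ell_le[OF q(1)] False by (intro mult_right_mono) auto
    moreover have "0 \<le> 2 * \<rho>' q * (inner z w)\<^sup>2" using False by simp
    ultimately show ?thesis by simp
  qed
  then have "2 * H' q * (ell * (2 * H' q) * (norm z)\<^sup>2)
      \<le> 2 * H' q * (\<rho> q * (norm z)\<^sup>2 + 2 * \<rho>' q * (inner z w)\<^sup>2)"
    using hpos by (intro mult_left_mono) auto
  moreover have "- (3 * G * \<kappa> * H q * norm g) \<le> inner e g"
  proof -
    have "\<bar>inner e g\<bar> \<le> norm e * norm g" by (rule Cauchy_Schwarz_ineq2)
    also have "\<dots> \<le> 3 * G * \<kappa> * H q * norm g" using e by (intro mult_right_mono) auto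
    finally show ?thesis by simp
  qed
  moreover have "inner W g = 2 * H' q * (\<rho> q * (norm z)\<^sup>2 + 2 * \<rho>' q * (inner z w)\<^sup>2) + inner e g"
    by (simp add: W g_def inner_add_left power2_norm_eq_inner power2_eq_square[of "inner w z"] inner_commute algebra_simps)
  moreover have "ell * (norm g)\<^sup>2 = 2 * H' q * (ell * (2 * H' q) * (norm z)\<^sup>2)"
    by (simp add: ng power2_eq_square)
  ultimately show "ell * (norm g)\<^sup>2 - 3 * G * \<kappa> * H q * norm g \<le> inner W g" by linarith
  have "norm W \<le> norm (\<rho> q *\<^sub>R z) + norm ((2 * \<rho>' q * inner z w) *\<^sub>R w) + norm e"
    unfolding W by (intro order_trans[OF norm_triangle_ineq] add_right_mono norm_triangle_ineq)
  also have "\<dots> = \<rho> q * norm z + 2 * \<bar>\<rho>' q\<bar> * (\<bar>inner z w\<bar> * norm w) + norm e"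
    using rpos by (simp add: abs_mult)
  also have "\<dots> \<le> \<rho> q * norm z + 2 * \<bar>\<rho>' q\<bar> * (q * norm z) + norm e"
  proof -
    have "\<bar>inner z w\<bar> * norm w \<le> (norm z * norm w) * norm w"
      by (intro mult_right_mono Cauchy_Schwarz_ineq2) auto
    also have "\<dots> = q * norm z" using q(2) by (simp add: algebra_simps)
    finally show ?thesis by (intro add_right_mono add_left_mono mult_left_mono) auto
  qed
  also have "\<rho> q * norm z + 2 * \<bar>\<rho>' q\<bar> * (q * norm z) \<le> ell' * norm g"
    using mult_right_mono[OF ell'_ge[OF q(1)], of "norm z"] by (simp add: ng algebra_simps)
  finally show "norm W \<le> ell' * norm g + 3 * G * \<kappa> * H q" using e by simp
qed

end

subsection \<open>The weak inequality\<close>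

text \<open>Q may vanish inside the domain, where \<open>\<rho>\<close> and H have only one-sided
  derivatives; the chain rule within the image of \<open>f\<close>, which lies in the half-line,
  still gives a full derivative.\<close>

lemma C1_grad_compose_nonneg:
  assumes f: "C1_grad S f g" "open S" "\<And>x. x \<in> S \<Longrightarrow> 0 \<le> f x"
    and p: "\<And>t. 0 \<le> t \<Longrightarrow> (p has_real_derivative p' t) (at t within {0..})" "continuous_on {0..} p'"
  shows "C1_grad S (\<lambda>x. p (f x)) (\<lambda>x. p' (f x) *\<^sub>R g x)"
  unfolding C1_grad_def
proof (intro conjI ballI)
  show "continuous_on S (\<lambda>x. p' (f x) *\<^sub>R g x)"
    by (intro continuous_on_scaleR continuous_on_compose2[OF p(2) C1_grad_continuous[OF f(1)]]
        C1_grad_continuous_grad[OF f(1)]) (use f(3) in auto)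
  fix x assume x: "x \<in> S"
  have fx: "(f has_derivative (\<lambda>h. inner h (g x))) (at x within S)"
    using C1_gradD[OF f(1) x] has_derivative_at_withinI unfolding gderiv_def by blast
  have "(p has_derivative (*) (p' (f x))) (at (f x) within f ` S)"
    using p(1)[OF f(3)[OF x]] unfolding has_field_derivative_def
    by (rule has_derivative_subset) (use f(3) in auto)
  from has_derivative_in_compose[OF fx this]
  have "((\<lambda>x. p (f x)) has_derivative (\<lambda>h. p' (f x) * inner h (g x))) (at x)"
    using at_within_open[OF x f(2)] by simp
  then show "GDERIV (\<lambda>x. p (f x)) x :> p' (f x) *\<^sub>R g x"
    unfolding gderiv_def by simp
qed

text \<open>The symmetry of mixed partials is available for globally defined, compactly supported
  functions, whereas \<open>\<rho> \<omega>\<close> is known on the ball only. A cutoff equal to 1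
  near \<open>K\<close> leaves the gradient unchanged where it is tested.\<close>

lemma cutoff_extension:
  fixes x0 :: "'a::euclidean_space"
  assumes f: "C1_grad (ball x0 R) f g" and K: "compact K" "K \<subseteq> ball x0 R"
  obtains J h k where "compact J" "test_fun J h k" "\<And>x. x \<in> K \<Longrightarrow> k x = g x"
proof (cases "K = {}")
  case True
  have "test_fun {} (\<lambda>x. 0) (\<lambda>x::'a. 0)"
    by (simp add: test_fun_def C1_grad_def GDERIV_const)
  then show ?thesis using that[of "{}"] True by auto
next
  case False
  have "continuous_on K (dist x0)" by (intro continuous_intros)
  then obtain y where y: "y \<in> K" "\<And>x. x \<in> K \<Longrightarrow> dist x0 x \<le> dist x0 y"
    using continuous_attains_sup[OF K(1) False, of "dist x0"] by blast
  \<comment> \<open>By compactness \<open>K\<close> stays at distance less than \<open>R\<close>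
    from the centre; \<open>a < b\<close> strictly in between leave room for the cutoff.\<close>
  define a where "a = (dist x0 y + R) / 2"
  define b where "b = (a + R) / 2"
  have "dist x0 y < R" "0 \<le> dist x0 y" using y(1) K(2) by auto
  then have ab: "dist x0 y < a" "a < b" "b < R"
    by (auto simp: a_def b_def field_simps)
  then have "0 \<le> a" using \<open>0 \<le> dist x0 y\<close> by linarith
  have sq: "0 \<le> a\<^sup>2" "a\<^sup>2 < b\<^sup>2" "sqrt (a\<^sup>2) = a" "sqrt (b\<^sup>2) = b"
    using ab \<open>0 \<le> a\<close> by (auto intro: power_strict_mono)
  obtain \<zeta> g\<zeta> where \<zeta>: "test_fun (cball x0 b) \<zeta> g\<zeta>" "\<And>x. x \<in> cball x0 a \<Longrightarrow> \<zeta> x = 1"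
    using cutoff_exists[OF sq(1,2), of x0] unfolding sq(3,4) by metis
  have \<zeta>S: "C1_grad (ball x0 R) \<zeta> g\<zeta>"
    using \<zeta>(1) C1_grad_subset[of UNIV] unfolding test_fun_def by blast
  define k where "k x = (if x \<in> ball x0 R then \<zeta> x *\<^sub>R g x + f x *\<^sub>R g\<zeta> x else 0)" for x
  have T: "test_fun (cball x0 b) (\<lambda>x. if x \<in> ball x0 R then \<zeta> x * f x else 0) k"
    unfolding k_def[abs_def]
    by (rule test_fun_extend[OF C1_grad_mult[OF \<zeta>S f]]) (use ab \<zeta>(1) in \<open>auto simp: test_fun_def\<close>)
  show ?thesis
  proof (rule that[OF compact_cball T])
    fix x assume "x \<in> K"
    then have x: "x \<in> ball x0 a" using y(2)[of x] ab by auto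
    then have xR: "x \<in> ball x0 R" using ab by auto
    have "GDERIV (\<lambda>x. if x \<in> ball x0 R then \<zeta> x * f x else 0) x :> g x"
      by (rule GDERIV_transform_open[OF C1_gradD[OF f xR] open_ball x]) (use \<zeta>(2) ab in auto)
    moreover have "GDERIV (\<lambda>x. if x \<in> ball x0 R then \<zeta> x * f x else 0) x :> k x"
      using T by (simp add: test_fun_def C1_grad_def)
    ultimately show "k x = g x" using GDERIV_unique by blast
  qed
qed

lemma integral_partials_commute_local:
  assumes f: "test_fun K f g" "compact K" "K \<subseteq> ball x0 R" and F: "C1_grad (ball x0 R) F dF"
  shows "(\<integral>x. inner p (g x) * inner q (dF x) \<partial>lborel) = (\<integral>x. inner q (g x) * inner p (dF x) \<partial>lborel)"
    and "integrable lborel (\<lambda>x. inner p (g x) * inner q (dF x))"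
proof -
  have g0: "g x = 0" if "x \<notin> K" for x
    by (rule test_fun_grad_eq_0[OF f(1) compact_imp_closed[OF f(2)] that])
  obtain J h k where h: "compact J" "test_fun J h k" and k: "\<And>x. x \<in> K \<Longrightarrow> k x = dF x"
    using cutoff_extension[OF F f(2,3)] by metis
  have eq: "inner p (g x) * inner q (dF x) = inner p (g x) * inner q (k x)" for p q x
    using k[of x] g0[of x] by (cases "x \<in> K") auto
  show "(\<integral>x. inner p (g x) * inner q (dF x) \<partial>lborel) = (\<integral>x. inner q (g x) * inner p (dF x) \<partial>lborel)"
    unfolding eq by (rule integral_partials_commute[OF f(1,2) h(2,1)])
  show "integrable lborel (\<lambda>x. inner p (g x) * inner q (dF x))"
    by (rule integrable_compact_support[OF _ f(2)])
      (auto intro!: continuous_on_mult continuous_on_inner continuous_on_const test_fun_continuous(2)[OF f(1)]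
        continuous_on_subset[OF C1_grad_continuous_grad[OF F] f(3)] simp: g0)
qed

text \<open>\<open>D x $ i $ j\<close> is the i-th partial derivative of the j-th component. The
  equations for \<omega> enter only later; the identity proved here is pure calculus.\<close>

locale hodge_field = admissible_density C1 C2 \<rho> \<rho>' H
  for C1 C2 \<rho> \<rho>' H +
  fixes x0 :: "real^'n" and R :: real and w :: "real^'n \<Rightarrow> real^'n" and D :: "real^'n \<Rightarrow> real^'n^'n"
  assumes w: "\<And>j. C1_grad (ball x0 R) (\<lambda>x. w x $ j) (\<lambda>x. \<chi> i. D x $ i $ j)"
begin

definition q where "q x = inner (w x) (w x)"

definition dF where "dF x i j = \<rho> (q x) * D x $ i $ j + 2 * \<rho>' (q x) * (D x *v w x) $ i * w x $ j"

text \<open>\<open>W\<close> and \<open>Z\<close> arise from the integrand of the weak identity when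
  the derivative falls on the test function and on \<open>w\<close>, respectively.\<close>

definition W where "W x = (\<chi> j. (\<Sum>i\<in>UNIV. w x $ i * dF x i j) - (\<Sum>k\<in>UNIV. dF x k k) * w x $ j)"

definition Z where "Z x = (\<Sum>i\<in>UNIV. \<Sum>j\<in>UNIV. D x $ j $ i * dF x i j)
  - (\<Sum>k\<in>UNIV. dF x k k) * (\<Sum>k\<in>UNIV. D x $ k $ k)"

lemma q_nonneg: "0 \<le> q x" by (simp add: q_def)

lemma grad_q: "C1_grad (ball x0 R) q (\<lambda>x. 2 *\<^sub>R (D x *v w x))"
proof -
  note c = C1_grad_continuous[OF w] C1_grad_continuous_grad[OF w]
  have D: "continuous_on (ball x0 R) (\<lambda>x. D x $ i $ j)" for i j
    using continuous_on_component[OF c(2)[of j], of i] by simp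
  show ?thesis
    unfolding C1_grad_def
  proof (intro conjI ballI)
    show "continuous_on (ball x0 R) (\<lambda>x. 2 *\<^sub>R (D x *v w x))"
      unfolding matrix_vector_mult_def
      by (intro continuous_on_scaleR continuous_on_const continuous_on_vec_lambda continuous_on_sum continuous_on_mult D c)
    fix x assume x: "x \<in> ball x0 R"
    have "GDERIV (\<lambda>x. w x $ j * w x $ j) x :> w x $ j *\<^sub>R (\<chi> i. D x $ i $ j) + w x $ j *\<^sub>R (\<chi> i. D x $ i $ j)" for j
      by (intro GDERIV_mult C1_gradD[OF w x])
    then have "((\<lambda>x. \<Sum>j\<in>UNIV. w x $ j * w x $ j) has_derivative
        (\<lambda>h. \<Sum>j\<in>UNIV. inner h (w x $ j *\<^sub>R (\<chi> i. D x $ i $ j) + w x $ j *\<^sub>R (\<chi> i. D x $ i $ j)))) (at x)"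
      unfolding gderiv_def by (intro has_derivative_sum) auto
    moreover have "(\<lambda>h. \<Sum>j\<in>UNIV. inner h (w x $ j *\<^sub>R (\<chi> i. D x $ i $ j) + w x $ j *\<^sub>R (\<chi> i. D x $ i $ j)))
        = (\<lambda>h. inner h (2 *\<^sub>R (D x *v w x)))"
    proof
      fix h
      have "inner h (D x *v w x) = (\<Sum>i\<in>UNIV. \<Sum>j\<in>UNIV. h $ i * (D x $ i $ j * w x $ j))"
        by (simp add: inner_vec_def matrix_vector_mult_def sum_distrib_left)
      also have "\<dots> = (\<Sum>j\<in>UNIV. \<Sum>i\<in>UNIV. h $ i * (D x $ i $ j * w x $ j))" by (rule sum.swap)
      also have "\<dots> = (\<Sum>j\<in>UNIV. inner h (w x $ j *\<^sub>R (\<chi> i. D x $ i $ j)))"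
        by (simp add: inner_vec_def sum_distrib_left ac_simps)
      finally show "(\<Sum>j\<in>UNIV. inner h (w x $ j *\<^sub>R (\<chi> i. D x $ i $ j) + w x $ j *\<^sub>R (\<chi> i. D x $ i $ j)))
        = inner h (2 *\<^sub>R (D x *v w x))"
        by (simp only: scaleR_2 inner_add_right sum.distrib)
    qed
    ultimately show "GDERIV q x :> 2 *\<^sub>R (D x *v w x)"
      unfolding gderiv_def q_def[abs_def] inner_vec_def[of "w _"] by simp
  qed
qed

lemma grad_H: "C1_grad (ball x0 R) (\<lambda>x. H (q x)) (\<lambda>x. (2 * H' (q x)) *\<^sub>R (D x *v w x))"
  using C1_grad_compose_nonneg[OF grad_q open_ball q_nonneg H_deriv H'_cont] by (simp add: mult.commute)

lemma grad_F: "C1_grad (ball x0 R) (\<lambda>x. \<rho> (q x) * w x $ j) (\<lambda>x. \<chi> i. dF x i j)"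
proof -
  have "(\<lambda>x. \<rho> (q x) *\<^sub>R (\<chi> i. D x $ i $ j) + w x $ j *\<^sub>R (\<rho>' (q x) *\<^sub>R (2 *\<^sub>R (D x *v w x)))) = (\<lambda>x. \<chi> i. dF x i j)"
    by (rule ext) (simp add: vec_eq_iff dF_def)
  then show ?thesis
    using C1_grad_mult[OF C1_grad_compose_nonneg[OF grad_q open_ball q_nonneg \<rho>_deriv \<rho>'_cont] w[of j]] by simp
qed

lemma continuous_on_dF: "continuous_on (ball x0 R) (\<lambda>x. dF x i j)"
  using continuous_on_component[OF C1_grad_continuous_grad[OF grad_F[of j]], of i] by simp

lemma continuous_on_W: "continuous_on (ball x0 R) W"
  unfolding W_def[abs_def]
  by (intro continuous_on_vec_lambda continuous_on_diff continuous_on_sum continuous_on_mult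
      continuous_on_dF C1_grad_continuous[OF w])

text \<open>The vector fields \<open>\<psi> w\<close> and \<open>\<rho> w\<close> have \<open>\<integral> \<partial>\<^sub>j(\<psi> w\<^sub>i) \<partial>\<^sub>i(\<rho> w\<^sub>j) = \<integral> div (\<psi> w) div (\<rho> w)\<close>.\<close>

lemma weak_identity:
  assumes \<psi>: "test_fun K \<psi> g\<psi>" and K: "compact K" "K \<subseteq> ball x0 R"
  shows "(\<integral>x. inner (W x) (g\<psi> x) + \<psi> x * Z x \<partial>lborel) = 0"
proof -
  let ?S = "ball x0 R"
  have \<psi>0: "\<And>x. x \<notin> K \<Longrightarrow> \<psi> x = 0" using \<psi> by (simp add: test_fun_def)
  have g\<psi>0: "\<And>x. x \<notin> K \<Longrightarrow> g\<psi> x = 0"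
    by (rule test_fun_grad_eq_0[OF \<psi> compact_imp_closed[OF K(1)]])
  have \<psi>S: "C1_grad ?S \<psi> g\<psi>"
    using \<psi> C1_grad_subset[of UNIV] unfolding test_fun_def by blast
  define gX where "gX i x = (if x \<in> ?S then \<psi> x *\<^sub>R (\<chi> k. D x $ k $ i) + w x $ i *\<^sub>R g\<psi> x else 0)" for i x
  have X: "test_fun K (\<lambda>x. if x \<in> ?S then \<psi> x * w x $ i else 0) (gX i)" for i
    unfolding gX_def[abs_def]
    by (rule test_fun_extend[OF C1_grad_mult[OF \<psi>S w] open_ball K]) (use \<psi>0 in auto)
  note pc = integral_partials_commute_local[OF X K grad_F]
  have comm: "(\<integral>x. gX i x $ j * dF x i j \<partial>lborel) = (\<integral>x. gX i x $ i * dF x j j \<partial>lborel)"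
    and int: "integrable lborel (\<lambda>x. gX i x $ j * dF x i j)" "integrable lborel (\<lambda>x. gX i x $ i * dF x j j)" for i j
    using pc[of "axis j 1" i "axis i 1" j] pc[of "axis i 1" i "axis j 1" j]
    by (simp_all add: inner_axis' )
  have "(\<integral>x. (\<Sum>i\<in>UNIV. \<Sum>j\<in>UNIV. gX i x $ j * dF x i j - gX i x $ i * dF x j j) \<partial>lborel) = 0"
    using int by (simp add: Bochner_Integration.integral_sum comm)
  moreover have "(\<Sum>i\<in>UNIV. \<Sum>j\<in>UNIV. gX i x $ j * dF x i j - gX i x $ i * dF x j j)
      = inner (W x) (g\<psi> x) + \<psi> x * Z x" for x
  proof (cases "x \<in> ?S")
    case True
    let ?T = "\<Sum>k\<in>UNIV. dF x k k"
    have g: "gX i x $ j = \<psi> x * D x $ j $ i + w x $ i * g\<psi> x $ j" for i j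
      using True by (simp add: gX_def)
    have "(\<Sum>i\<in>UNIV. \<Sum>j\<in>UNIV. gX i x $ j * dF x i j - gX i x $ i * dF x j j)
      = (\<Sum>i\<in>UNIV. \<Sum>j\<in>UNIV. gX i x $ j * dF x i j) - (\<Sum>i\<in>UNIV. gX i x $ i) * ?T"
      by (simp add: sum_subtractf sum_product)
    also have "(\<Sum>i\<in>UNIV. \<Sum>j\<in>UNIV. gX i x $ j * dF x i j)
      = \<psi> x * (\<Sum>i\<in>UNIV. \<Sum>j\<in>UNIV. D x $ j $ i * dF x i j) + (\<Sum>i\<in>UNIV. \<Sum>j\<in>UNIV. (w x $ i * dF x i j) * g\<psi> x $ j)"
      unfolding g by (simp add: sum_distrib_left sum.distrib[symmetric] algebra_simps)
    also have "(\<Sum>i\<in>UNIV. \<Sum>j\<in>UNIV. (w x $ i * dF x i j) * g\<psi> x $ j) = (\<Sum>j\<in>UNIV. (\<Sum>i\<in>UNIV. w x $ i * dF x i j) * g\<psi> x $ j)"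
      by (subst sum.swap) (simp add: sum_distrib_right)
    also have "(\<Sum>i\<in>UNIV. gX i x $ i) = \<psi> x * (\<Sum>k\<in>UNIV. D x $ k $ k) + (\<Sum>j\<in>UNIV. w x $ j * g\<psi> x $ j)"
      unfolding g by (simp add: sum_distrib_left sum.distrib)
    finally have 1: "(\<Sum>i\<in>UNIV. \<Sum>j\<in>UNIV. gX i x $ j * dF x i j - gX i x $ i * dF x j j)
      = \<psi> x * (\<Sum>i\<in>UNIV. \<Sum>j\<in>UNIV. D x $ j $ i * dF x i j) + (\<Sum>j\<in>UNIV. (\<Sum>i\<in>UNIV. w x $ i * dF x i j) * g\<psi> x $ j)
        - (\<psi> x * (\<Sum>k\<in>UNIV. D x $ k $ k) + (\<Sum>j\<in>UNIV. w x $ j * g\<psi> x $ j)) * ?T" .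
    have 2: "inner (W x) (g\<psi> x) = (\<Sum>j\<in>UNIV. (\<Sum>i\<in>UNIV. w x $ i * dF x i j) * g\<psi> x $ j)
        - ?T * (\<Sum>j\<in>UNIV. w x $ j * g\<psi> x $ j)"
      by (simp add: W_def inner_vec_def left_diff_distrib sum_subtractf sum_distrib_left mult.assoc)
    show ?thesis unfolding 1 2 Z_def by (simp add: algebra_simps)
  next
    case False
    then have "x \<notin> K" using K by auto
    then show ?thesis using False by (simp add: gX_def \<psi>0 g\<psi>0)
  qed
  ultimately show ?thesis by simp
qed

end

locale hodge_system = hodge_field C1 C2 \<rho> \<rho>' H x0 R w D
  for C1 C2 \<rho> \<rho>' H x0 R and w :: "real^'n \<Rightarrow> real^'n" and D +
  fixes G :: real and \<Gamma> :: "real^'n \<Rightarrow> real^'n"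
  assumes R: "0 < R" "R \<le> 1"
    and curl: "\<And>x i j. x \<in> ball x0 R \<Longrightarrow> D x $ i $ j - D x $ j $ i = \<Gamma> x $ i * w x $ j - \<Gamma> x $ j * w x $ i"
    and div: "\<And>x. x \<in> ball x0 R \<Longrightarrow> (\<Sum>k\<in>UNIV. dF x k k) = - \<rho> (q x) * inner (\<Gamma> x) (w x)"
    and G: "\<And>x. x \<in> ball x0 R \<Longrightarrow> norm (\<Gamma> x) \<le> G"
begin

text \<open>One constant for the three places where \<open>subsolution\<close> allows a multiple of
  \<open>v\<close>: the two flux bounds and the right side of the weak inequality.\<close>

definition lower_const where
  "lower_const = max (3 * G * \<kappa>) (\<kappa> * G\<^sup>2 * (1 + (C1 + 1 / 2)\<^sup>2 / min 1 (2 * C2)))"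

lemma G_nonneg: "0 \<le> G"
  using G[of x0] R norm_ge_zero[of "\<Gamma> x0"] by (simp del: norm_ge_zero)

lemma W_eq:
  assumes "x \<in> ball x0 R"
  shows "W x = \<rho> (q x) *\<^sub>R (D x *v w x) + (2 * \<rho>' (q x) * inner (D x *v w x) (w x)) *\<^sub>R w x
    + \<rho> (q x) *\<^sub>R ((2 * inner (\<Gamma> x) (w x)) *\<^sub>R w x - q x *\<^sub>R \<Gamma> x)"
  and "Z x = \<rho> (q x) * ((norm (D x))\<^sup>2 - q x * (norm (\<Gamma> x))\<^sup>2)
    + 2 * \<rho>' (q x) * ((norm (D x *v w x))\<^sup>2 - q x * inner (\<Gamma> x) (D x *v w x))"
  using divergence_terms[OF curl[OF assms] div[OF assms, unfolded dF_def q_def]]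
  by (simp_all only: W_def Z_def dF_def q_def)

lemma Z_ge: "x \<in> ball x0 R \<Longrightarrow> - lower_const * H (q x) \<le> Z x"
proof -
  assume x: "x \<in> ball x0 R"
  have "- lower_const * H (q x) \<le> - (\<kappa> * G\<^sup>2 * (1 + (C1 + 1 / 2)\<^sup>2 / min 1 (2 * C2))) * H (q x)"
    using H_bounds(1)[OF q_nonneg] by (intro mult_right_mono) (auto simp: lower_const_def)
  also have "\<dots> \<le> Z x"
    unfolding W_eq[OF x] q_def by (rule zeroth_order_bound[OF G[OF x]])
  finally show ?thesis .
qed

lemma subsolution_H:
  "subsolution x0 R (\<lambda>x. H (q x)) (\<lambda>x. (2 * H' (q x)) *\<^sub>R (D x *v w x)) W ell ell' lower_const"
proof
  show "0 \<le> lower_const"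
    using G_nonneg \<kappa>_pos by (simp add: lower_const_def le_max_iff_disj)
  have lc: "3 * G * \<kappa> * H (q x) \<le> lower_const * H (q x)" for x
    using H_bounds(1)[OF q_nonneg] by (intro mult_right_mono) (auto simp: lower_const_def)
  {
    fix x assume x: "x \<in> ball x0 R"
    let ?g = "(2 * H' (q x)) *\<^sub>R (D x *v w x)"
    note fb = flux_bounds[OF G[OF x], where w="w x" and z="D x *v w x", folded q_def, folded W_eq(1)[OF x]]
    show "ell * (norm ?g)\<^sup>2 - lower_const * H (q x) * norm ?g \<le> inner (W x) ?g"
      using fb(1) mult_right_mono[OF lc[of x], of "norm ?g"] by simp
    show "norm (W x) \<le> ell' * norm ?g + lower_const * H (q x)"
      using fb(2) lc[of x] by linarith
  }
  fix K \<psi> g\<psi>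
  assume \<psi>: "test_fun K \<psi> g\<psi>" and K: "compact K" "K \<subseteq> ball x0 R" and nonneg: "\<And>x. 0 \<le> \<psi> x"
  have \<psi>0: "\<And>x. x \<notin> K \<Longrightarrow> \<psi> x = 0" using \<psi> by (simp add: test_fun_def)
  have g\<psi>0: "\<And>x. x \<notin> K \<Longrightarrow> g\<psi> x = 0"
    by (rule test_fun_grad_eq_0[OF \<psi> compact_imp_closed[OF K(1)]])
  note c = test_fun_continuous[OF \<psi>]
  have D: "continuous_on (ball x0 R) (\<lambda>x. D x $ i $ j)" for i j
    using continuous_on_component[OF C1_grad_continuous_grad[OF w[of j]], of i] by simp
  have Zc: "continuous_on (ball x0 R) Z"
    unfolding Z_def[abs_def]
    by (intro continuous_on_diff continuous_on_sum continuous_on_mult continuous_on_dF D)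
  have intW: "integrable lborel (\<lambda>x. inner (W x) (g\<psi> x))"
    by (intro integrable_compact_support[OF _ K(1)] continuous_on_inner c
        continuous_on_subset[OF continuous_on_W K(2)]) (simp add: g\<psi>0)
  have intZ: "integrable lborel (\<lambda>x. \<psi> x * Z x)"
    by (intro integrable_compact_support[OF _ K(1)] continuous_on_mult c
        continuous_on_subset[OF Zc K(2)]) (simp add: \<psi>0)
  have intH: "integrable lborel (\<lambda>x. \<psi> x * H (q x))"
    by (intro integrable_compact_support[OF _ K(1)] continuous_on_mult c
        continuous_on_subset[OF C1_grad_continuous[OF grad_H] K(2)]) (simp add: \<psi>0)
  have "(\<integral>x. - (\<psi> x * Z x) \<partial>lborel) \<le> (\<integral>x. lower_const * (\<psi> x * H (q x)) \<partial>lborel)"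
  proof (intro integral_mono integrable_mult_right integrable_minus intZ intH)
    fix x
    show "- (\<psi> x * Z x) \<le> lower_const * (\<psi> x * H (q x))"
    proof (cases "x \<in> K")
      case True
      then have "- lower_const * H (q x) \<le> Z x" using K by (intro Z_ge) auto
      from mult_left_mono[OF this nonneg[of x]] show ?thesis by (simp add: ac_simps)
    qed (simp add: \<psi>0)
  qed
  moreover have "(\<integral>x. inner (W x) (g\<psi> x) \<partial>lborel) = (\<integral>x. - (\<psi> x * Z x) \<partial>lborel)"
    using weak_identity[OF \<psi> K] intW intZ by simp
  ultimately show "(\<integral>x. inner (W x) (g\<psi> x) \<partial>lborel) \<le> lower_const * (\<integral>x. \<psi> x * H (q x) \<partial>lborel)"
    by simp
qed (use R ell grad_H H_bounds(1)[OF q_nonneg] continuous_on_W in auto)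

end

subsection \<open>Forms in coordinates\<close>

lemma shuffle_sign_squared: "shuffle_sign I J * shuffle_sign I J = 1"
  by (simp add: shuffle_sign_def power_add[symmetric] mult_2[symmetric])

lemma shuffle_sign_empty [simp]: "shuffle_sign I {} = 1" "shuffle_sign {} J = 1"
  by (simp_all add: shuffle_sign_def)

lemma shuffle_sign_singletons: "shuffle_sign {i} {j} = (if j < i then - 1 else 1)"
proof -
  have "{(a, b). a \<in> {i} \<and> b \<in> {j} \<and> b < a} = (if j < i then {(i, j)} else {})" by auto
  then show ?thesis by (simp add: shuffle_sign_def)
qed

lemma hodge_star_top [simp]: "hodge_star a {} = a UNIV"
  by (simp add: hodge_star_def)

text \<open>The shuffle sign in \<open>wedge\<close> meets the same sign from the star of
  \<open>b\<close>, and signs square to 1. It serves both for Q and for the right side of the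
  codifferential equation.\<close>

lemma star_wedge_star_1form:
  assumes "\<And>I. card I \<noteq> 1 \<Longrightarrow> b I = 0"
  shows "hodge_star (wedge a (hodge_star b)) {} = (\<Sum>i\<in>UNIV. a {i} * b {i})"
proof -
  have eq: "shuffle_sign I (UNIV - I) * a I * hodge_star b (UNIV - I) = a I * b I" for I
  proof -
    have "- (UNIV - I) = I" by auto
    then show ?thesis
      using shuffle_sign_squared[of I "UNIV - I"] by (simp add: hodge_star_def mult.assoc mult.left_commute)
  qed
  have "hodge_star (wedge a (hodge_star b)) {} = (\<Sum>I\<in>UNIV. a I * b I)"
    by (simp only: hodge_star_top wedge_def Pow_UNIV eq)
  also have "\<dots> = (\<Sum>I\<in>range (\<lambda>i. {i}). a I * b I)"
  proof (rule sum.mono_neutral_right)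
    show "\<forall>I\<in>UNIV - range (\<lambda>i. {i}). a I * b I = 0"
      using assms by (auto simp: card_1_singleton_iff)
  qed auto
  also have "\<dots> = (\<Sum>i\<in>UNIV. a {i} * b {i})"
    by (subst sum.reindex) (auto simp: inj_on_def)
  finally show ?thesis .
qed

lemma ext_d_singleton: "ext_d \<alpha> x {i} = partial_deriv i (\<lambda>y. \<alpha> y {}) x"
  by (simp add: ext_d_def)

lemma ext_d_pair:
  assumes "i < j"
  shows "ext_d \<alpha> x {i, j} = partial_deriv i (\<lambda>y. \<alpha> y {j}) x - partial_deriv j (\<lambda>y. \<alpha> y {i}) x"
proof -
  have "{i, j} - {i} = {j}" "{i, j} - {j} = {i}" using assms by auto
  then show ?thesis using assms by (simp add: ext_d_def shuffle_sign_singletons)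
qed

lemma wedge_pair:
  assumes "i < j" "a {} = 0" "b {} = 0"
  shows "wedge a b {i, j} = a {i} * b {j} - a {j} * b {i}"
proof -
  have P: "Pow {i, j} = {{}, {i}, {j}, {i, j}}" by (auto simp: Pow_insert)
  have "{i, j} - {i} = {j}" "{i, j} - {j} = {i}" "{i} \<noteq> {j}" "{i} \<noteq> {i, j}" "{j} \<noteq> {i, j}"
    using assms(1) by auto
  then show ?thesis
    unfolding wedge_def P using assms by (simp add: shuffle_sign_singletons)
qed

lemma GDERIV_partial_deriv:
  assumes "GDERIV f x :> g" shows "partial_deriv i f x = g $ i"
  using fun_cong[OF frechet_derivative_at[OF assms[unfolded gderiv_def]], of "axis i 1"]
  by (simp add: partial_deriv_def inner_axis')

lemma differentiable_GDERIV:
  assumes "f differentiable (at x)" shows "GDERIV f x :> (\<chi> i. partial_deriv i f x)"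
proof -
  let ?F = "frechet_derivative f (at x)"
  have F: "(f has_derivative ?F) (at x)" using assms frechet_derivative_works by blast
  then have lin: "linear ?F" by (rule has_derivative_linear)
  have "?F h = inner h (\<chi> i. partial_deriv i f x)" for h
  proof -
    have "?F h = ?F (\<Sum>i\<in>UNIV. h $ i *\<^sub>R axis i 1)"
      using basis_expansion[of h] by (simp add: scalar_mult_eq_scaleR)
    also have "\<dots> = (\<Sum>i\<in>UNIV. h $ i * ?F (axis i 1))"
      by (simp add: linear_sum[OF lin] linear_cmul[OF lin])
    finally show ?thesis by (simp add: inner_vec_def partial_deriv_def)
  qed
  then have "?F = (\<lambda>h. inner h (\<chi> i. partial_deriv i f x))" by (rule ext)
  with F show ?thesis by (simp add: gderiv_def)
qed

lemma smooth_form_C1_grad: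
  assumes "smooth_form_on S \<alpha>"
  shows "C1_grad S (\<lambda>x. \<alpha> x I) (\<lambda>x. \<chi> i. partial_deriv i (\<lambda>y. \<alpha> y I) x)"
proof -
  have "Ck_on (Suc 0) S (\<lambda>x. \<alpha> x I)" using assms by (simp add: smooth_form_on_def)
  then show ?thesis
    by (auto simp: C1_grad_def intro!: differentiable_GDERIV continuous_on_vec_lambda)
qed

text \<open>The sign of the inner star at the complement of {i} is the sign with which
  \<open>ext_d\<close> adds dx_i back, so they cancel and minus the divergence is left.\<close>

lemma codiff1_empty:
  assumes "\<And>i. GDERIV (\<lambda>y. \<alpha> y {i}) x :> g i"
  shows "codiff1 \<alpha> x {} = - (\<Sum>i\<in>UNIV. g i $ i)"
proof -
  have "shuffle_sign {i} (UNIV - {i}) * partial_deriv i (\<lambda>y. hodge_star (\<alpha> y) (UNIV - {i})) x = g i $ i" for i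
  proof -
    let ?c = "shuffle_sign {i} (UNIV - {i})"
    have "- (UNIV - {i}) = {i}" by auto
    then have "(\<lambda>y. hodge_star (\<alpha> y) (UNIV - {i})) = (\<lambda>y. ?c * \<alpha> y {i})"
      by (simp add: hodge_star_def)
    moreover have "GDERIV (\<lambda>y. ?c * \<alpha> y {i}) x :> ?c *\<^sub>R g i + \<alpha> x {i} *\<^sub>R 0"
      by (intro GDERIV_mult GDERIV_const assms)
    ultimately show ?thesis
      using GDERIV_partial_deriv[of "\<lambda>y. ?c * \<alpha> y {i}" x "?c *\<^sub>R g i"] shuffle_sign_squared[of "{i}" "UNIV - {i}"]
      by (simp add: mult.assoc[symmetric])
  qed
  then show ?thesis
    by (simp add: codiff1_def scale_ext_def ext_d_def)
qed

subsection \<open>The main estimate\<close>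

text \<open>The constants are written with explicit locale arguments to show that they depend on the
  dimension, \<open>R\<close>, \<open>C1\<close>, \<open>C2\<close> and \<open>G\<close> alone, so
  they can be fixed before \<open>\<rho>\<close> and \<open>\<omega>\<close> are given.\<close>

lemma pointwise_bound:
  fixes \<eta> \<Gamma> \<omega> :: "'n::{finite,linorder} form"
  assumes C: "0 < C1" "0 < C2" and dens: "hodge_density C1 C2 \<rho> \<rho>' H"
    and S: "ball x0 R \<subseteq> \<Omega>" "0 < R" "R \<le> 1"
    and \<Gamma>: "\<And>x. x \<in> \<Omega> \<Longrightarrow> \<Gamma> x = ext_d \<eta> x"
    and G: "\<And>x. x \<in> ball x0 R \<Longrightarrow> norm (\<chi> i. \<Gamma> x {i}) \<le> G"
    and \<omega>: "form_on 1 \<Omega> \<omega>" "smooth_form_on \<Omega> \<omega>"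
    and Q: "\<And>x. x \<in> \<Omega> \<Longrightarrow> Q x = ext_inner (\<omega> x) (\<omega> x)"
    and d\<omega>: "\<And>x. x \<in> \<Omega> \<Longrightarrow> ext_d \<omega> x = wedge (\<Gamma> x) (\<omega> x)"
    and \<delta>\<omega>: "\<And>x. x \<in> \<Omega> \<Longrightarrow> codiff1 (\<lambda>y. scale_ext (\<rho> (Q y)) (\<omega> y)) x
      = hodge_star (wedge (ext_d \<eta> x) (hodge_star (scale_ext (\<rho> (Q x)) (\<omega> x))))"
  shows "0 < subsolution.sup_const TYPE((real, 'n) vec) R (admissible_density.ell C1) (admissible_density.ell' C2)
        (hodge_system.lower_const C1 C2 G)"
    and "subsolution.sup_const TYPE((real, 'n) vec) R (admissible_density.ell C1) (admissible_density.ell' C2)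
        (hodge_system.lower_const C1 C2 G) * (H (Q x0))\<^sup>2
      \<le> (\<integral>x. indicator (cball x0 (R / 2)) x * (H (Q x))\<^sup>2 \<partial>lborel)"
    and "integrable lborel (\<lambda>x. indicator (cball x0 (R / 2)) x * (H (Q x))\<^sup>2)"
    and "Q x0 * \<rho> (Q x0) \<le> admissible_density.\<kappa> C2 * H (Q x0)" "0 \<le> H (Q x0)"
proof -
  define w where "w x = (\<chi> i. \<omega> x {i})" for x
  define D where "D x = (\<chi> i j. partial_deriv i (\<lambda>y. \<omega> y {j}) x)" for x
  define g where "g x = (\<chi> i. \<Gamma> x {i})" for x
  have w: "C1_grad \<Omega> (\<lambda>x. w x $ j) (\<lambda>x. \<chi> i. D x $ i $ j)" for j
    using smooth_form_C1_grad[OF \<omega>(2), of "{j}"] by (simp add: w_def D_def)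
  interpret hodge_field C1 C2 \<rho> \<rho>' H x0 R w D
    by unfold_locales (use C dens C1_grad_subset[OF w S(1)] in auto)
  have \<omega>0: "\<omega> x I = 0" if "x \<in> \<Omega>" "card I \<noteq> 1" for x I
    using \<omega>(1) that by (auto simp: form_on_def)
  have Qq: "Q x = q x" if "x \<in> \<Omega>" for x
    using Q[OF that] star_wedge_star_1form[of "\<omega> x" "\<omega> x"] \<omega>0[OF that]
    by (simp add: ext_inner_def q_def w_def inner_vec_def)
  interpret hodge_system C1 C2 \<rho> \<rho>' H x0 R w D G g
  proof unfold_locales
    fix x assume x: "x \<in> ball x0 R"
    then have x\<Omega>: "x \<in> \<Omega>" using S by auto
    show "norm (g x) \<le> G" using G[OF x] by (simp add: g_def)
    \<comment> \<open>A coefficient of a 2-form sits at an unordered pair, so only i < j is read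
      off; the other cases follow by antisymmetry.\<close>
    have curl': "D x $ i $ j - D x $ j $ i = g x $ i * w x $ j - g x $ j * w x $ i" if "i < j" for i j
    proof -
      have "\<Gamma> x {} = 0" by (simp add: \<Gamma>[OF x\<Omega>] ext_d_def)
      then have "wedge (\<Gamma> x) (\<omega> x) {i, j} = \<Gamma> x {i} * \<omega> x {j} - \<Gamma> x {j} * \<omega> x {i}"
        using that \<omega>0[OF x\<Omega>, of "{}"] by (intro wedge_pair) auto
      then show ?thesis
        using ext_d_pair[OF that, of \<omega> x] d\<omega>[OF x\<Omega>] by (simp add: D_def g_def w_def)
    qed
    show "D x $ i $ j - D x $ j $ i = g x $ i * w x $ j - g x $ j * w x $ i" for i j
      using curl'[of i j] curl'[of j i] by (cases i j rule: linorder_cases) auto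
    have "GDERIV (\<lambda>y. scale_ext (\<rho> (Q y)) (\<omega> y) {i}) x :> (\<chi> k. dF x k i)" for i
      by (rule GDERIV_transform_open[OF C1_gradD[OF grad_F x] open_ball x])
        (use Qq S in \<open>auto simp: scale_ext_def w_def subset_iff\<close>)
    then have "codiff1 (\<lambda>y. scale_ext (\<rho> (Q y)) (\<omega> y)) x {} = - (\<Sum>i\<in>UNIV. dF x i i)"
      by (subst codiff1_empty) auto
    moreover have "hodge_star (wedge (ext_d \<eta> x) (hodge_star (scale_ext (\<rho> (Q x)) (\<omega> x)))) {}
        = \<rho> (q x) * inner (g x) (w x)"
      using \<omega>0[OF x\<Omega>]
      by (subst star_wedge_star_1form)
        (auto simp: scale_ext_def Qq[OF x\<Omega>] \<Gamma>[OF x\<Omega>] g_def w_def inner_vec_def sum_distrib_left ac_simps)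
    ultimately show "(\<Sum>k\<in>UNIV. dF x k k) = - \<rho> (q x) * inner (g x) (w x)"
      using \<delta>\<omega>[OF x\<Omega>] by simp
  qed (use S in auto)
  interpret subsolution x0 R "\<lambda>x. H (q x)" "\<lambda>x. (2 * H' (q x)) *\<^sub>R (D x *v w x)" W ell ell' lower_const
    by (rule subsolution_H)
  have x0: "Q x0 = q x0" using S by (intro Qq) auto
  show "0 < sup_const" by (rule sup_const_pos)
  have cb: "cball x0 (R / 2) \<subseteq> ball x0 R" using S by auto
  have eq: "indicator (cball x0 (R / 2)) x * (H (q x))\<^sup>2 = indicator (cball x0 (R / 2)) x * (H (Q x))\<^sup>2" for x
  proof (cases "x \<in> cball x0 (R / 2)")
    case True
    then have "Q x = q x" using cb S(1) by (intro Qq) blast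
    then show ?thesis by simp
  qed simp
  show "sup_const * (H (Q x0))\<^sup>2 \<le> (\<integral>x. indicator (cball x0 (R / 2)) x * (H (Q x))\<^sup>2 \<partial>lborel)"
    using sup_bound unfolding x0 eq .
  show "integrable lborel (\<lambda>x. indicator (cball x0 (R / 2)) x * (H (Q x))\<^sup>2)"
    unfolding eq[symmetric]
    by (intro integrable_indicator_compact compact_cball continuous_on_power
        continuous_on_subset[OF C1_grad_continuous[OF grad_H] cb])
  show "Q x0 * \<rho> (Q x0) \<le> \<kappa> * H (Q x0)" "0 \<le> H (Q x0)"
    unfolding x0 by (rule H_bounds[OF q_nonneg])+
qed

lemma L2_norm_ge:
  fixes f :: "'a::euclidean_space \<Rightarrow> real"
  assumes "A \<subseteq> U" "integrable lborel (\<lambda>x. indicator A x * (f x)\<^sup>2)"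
  shows "ennreal (sqrt (\<integral>x. indicator A x * (f x)\<^sup>2 \<partial>lborel)) \<le> L2_norm U f"
proof -
  define J where "J = (\<integral>\<^sup>+x\<in>U. ennreal ((f x)\<^sup>2) \<partial>lborel)"
  have "ennreal (\<integral>x. indicator A x * (f x)\<^sup>2 \<partial>lborel) = (\<integral>\<^sup>+x. ennreal (indicator A x * (f x)\<^sup>2) \<partial>lborel)"
    by (rule nn_integral_eq_integral[symmetric, OF assms(2)]) simp
  also have "\<dots> \<le> J"
    unfolding J_def using assms(1) by (intro nn_integral_mono) (auto simp: indicator_def)
  finally have le: "ennreal (\<integral>x. indicator A x * (f x)\<^sup>2 \<partial>lborel) \<le> J" .
  show ?thesis
  proof (cases "J = \<infinity>")
    case True
    then show ?thesis by (simp add: L2_norm_def J_def[symmetric])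
  next
    case False
    then have "(\<integral>x. indicator A x * (f x)\<^sup>2 \<partial>lborel) \<le> enn2real J"
      using le by (metis ennreal_enn2real ennreal_le_iff enn2real_nonneg infinity_ennreal_def less_top)
    then show ?thesis
      using False by (auto simp: L2_norm_def J_def[symmetric] Let_def intro!: ennreal_leI)
  qed
qed

theorem theorem5:
  fixes \<Omega> K U :: "(real^'n::{finite,linorder}) set"
    and \<eta> \<Gamma> :: "'n form"
    and C1 C2 :: real
  assumes "CARD('n) \<ge> 2"
    and "open \<Omega>" and "connected \<Omega>" and "bounded \<Omega>" and "interior_sphere_condition \<Omega>"
    and "C1 > 0" and "C2 > 0"
    and "form_on 0 \<Omega> \<eta>" and "smooth_form_on \<Omega> \<eta>"
    and "\<And>x. x \<in> \<Omega> \<Longrightarrow> \<Gamma> x = ext_d \<eta> x"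
    and "compact K" and "open U" and "K \<subseteq> U" and "U \<subseteq> \<Omega>"
  shows "\<exists>C>0. \<forall>\<rho> \<rho>' H \<omega> Q.
           hodge_density C1 C2 \<rho> \<rho>' H \<longrightarrow>
           form_on 1 \<Omega> \<omega> \<longrightarrow> smooth_form_on \<Omega> \<omega> \<longrightarrow>
           (\<forall>x\<in>\<Omega>. Q x = ext_inner (\<omega> x) (\<omega> x)) \<longrightarrow>
           (\<forall>x\<in>\<Omega>. ext_d \<omega> x = wedge (\<Gamma> x) (\<omega> x)) \<longrightarrow>
           (\<forall>x\<in>\<Omega>. codiff1 (\<lambda>y. scale_ext (\<rho> (Q y)) (\<omega> y)) x
              = hodge_star (wedge (ext_d \<eta> x) (hodge_star (scale_ext (\<rho> (Q x)) (\<omega> x))))) \<longrightarrow>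
           (\<forall>x\<in>K. ennreal (Q x * \<rho> (Q x)) \<le> ennreal C * L2_norm U (\<lambda>y. H (Q y)))"
proof -
  obtain e where e: "0 < e" "(\<Union>x\<in>K. cball x e) \<subseteq> U"
    using compact_subset_open_imp_cball_epsilon_subset[OF \<open>compact K\<close> \<open>open U\<close> \<open>K \<subseteq> U\<close>] by blast
  define R where "R = min e 1"
  have R: "0 < R" "R \<le> 1" "R \<le> e" using e by (auto simp: R_def)
  define g where "g x = (\<chi> i. \<Gamma> x {i})" for x
  have "continuous_on \<Omega> (\<lambda>x. \<chi> i. partial_deriv i (\<lambda>y. \<eta> y {}) x)"
    using smooth_form_C1_grad[OF \<open>smooth_form_on \<Omega> \<eta>\<close>] by (simp add: C1_grad_def)
  moreover have "g x = (\<chi> i. partial_deriv i (\<lambda>y. \<eta> y {}) x)" if "x \<in> \<Omega>" for x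
    using assms(10)[OF that] by (simp add: g_def ext_d_singleton)
  ultimately have cont: "continuous_on \<Omega> g"
    by (simp cong: continuous_on_cong)
  \<comment> \<open>A compact neighbourhood of \<open>K\<close> containing every ball used, so that
    one bound \<open>G\<close> for \<Gamma> serves all centres.\<close>
  define N where "N = {x + y |x y. x \<in> K \<and> y \<in> cball 0 e}"
  have N: "x \<in> N" if "x0 \<in> K" "x \<in> cball x0 e" for x0 x
    unfolding N_def using that
    by (intro CollectI exI[of _ x0] exI[of _ "x - x0"]) (simp add: dist_norm norm_minus_commute)
  have "N \<subseteq> (\<Union>x\<in>K. cball x e)"
    by (auto simp: N_def dist_norm)
  then have "N \<subseteq> \<Omega>" using e \<open>U \<subseteq> \<Omega>\<close> by blast
  moreover have "compact N"
    unfolding N_def by (intro compact_sums \<open>compact K\<close> compact_cball)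
  ultimately have "bounded (g ` N)"
    by (intro compact_imp_bounded compact_continuous_image continuous_on_subset[OF cont])
  then obtain G where G: "\<And>x. x \<in> N \<Longrightarrow> norm (g x) \<le> G"
    unfolding bounded_iff by blast
  define \<sigma> where "\<sigma> = subsolution.sup_const TYPE((real, 'n) vec) R (admissible_density.ell C1)
    (admissible_density.ell' C2) (hodge_system.lower_const C1 C2 G)"
  define \<kappa> where "\<kappa> = admissible_density.\<kappa> C2"
  \<comment> \<open>The maximum with 1 makes \<open>C\<close> positive at once; positivity of
    \<open>\<sigma>\<close> comes from \<open>pointwise_bound\<close>, once a solution is at
    hand.\<close>
  define C where "C = max 1 (\<kappa> / sqrt \<sigma>)"
  show ?thesis
  proof (intro exI[of _ C] conjI allI impI ballI)
    show "0 < C" by (simp add: C_def)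
    fix \<rho> \<rho>' H :: "real \<Rightarrow> real" and \<omega> Q x0
    assume dens: "hodge_density C1 C2 \<rho> \<rho>' H" and \<omega>: "form_on 1 \<Omega> \<omega>" "smooth_form_on \<Omega> \<omega>"
      and Q: "\<forall>x\<in>\<Omega>. Q x = ext_inner (\<omega> x) (\<omega> x)"
      and d\<omega>: "\<forall>x\<in>\<Omega>. ext_d \<omega> x = wedge (\<Gamma> x) (\<omega> x)"
      and \<delta>\<omega>: "\<forall>x\<in>\<Omega>. codiff1 (\<lambda>y. scale_ext (\<rho> (Q y)) (\<omega> y)) x
              = hodge_star (wedge (ext_d \<eta> x) (hodge_star (scale_ext (\<rho> (Q x)) (\<omega> x))))"
      and x0: "x0 \<in> K"
    have cb: "cball x0 R \<subseteq> cball x0 e" using R by auto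
    have S: "ball x0 R \<subseteq> \<Omega>" and AU: "cball x0 (R / 2) \<subseteq> U"
      using e(2) x0 \<open>U \<subseteq> \<Omega>\<close> cb R by (force simp: subset_iff)+
    have G': "norm (\<chi> i. \<Gamma> x {i}) \<le> G" if "x \<in> ball x0 R" for x
      using G[OF N[OF x0, of x]] that R by (simp add: g_def)
    note pb = pointwise_bound[OF \<open>0 < C1\<close> \<open>0 < C2\<close> dens S R(1,2) assms(10) G' \<omega> bspec[OF Q] bspec[OF d\<omega>]
        bspec[OF \<delta>\<omega>], folded \<sigma>_def \<kappa>_def]
    let ?f = "\<lambda>x. indicator (cball x0 (R / 2)) x * (H (Q x))\<^sup>2"
    have \<kappa>: "0 < \<kappa>"
      unfolding \<kappa>_def by (rule admissible_density.\<kappa>_pos) (use dens assms in \<open>simp add: admissible_density_def\<close>)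
    have "(H (Q x0))\<^sup>2 \<le> (\<integral>x. ?f x \<partial>lborel) / \<sigma>"
      using pb(1,2) by (simp add: le_divide_eq mult.commute)
    then have "H (Q x0) \<le> sqrt ((\<integral>x. ?f x \<partial>lborel) / \<sigma>)"
      by (rule real_le_rsqrt)
    then have "\<kappa> * H (Q x0) \<le> \<kappa> * (sqrt (\<integral>x. ?f x \<partial>lborel) / sqrt \<sigma>)"
      using \<kappa> by (intro mult_left_mono) (auto simp: real_sqrt_divide)
    also have "\<dots> = \<kappa> / sqrt \<sigma> * sqrt (\<integral>x. ?f x \<partial>lborel)" by simp
    also have "\<dots> \<le> C * sqrt (\<integral>x. ?f x \<partial>lborel)"
      by (intro mult_right_mono) (auto simp: C_def)
    finally have "ennreal (Q x0 * \<rho> (Q x0)) \<le> ennreal (C * sqrt (\<integral>x. ?f x \<partial>lborel))"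
      using pb(4) by (intro ennreal_leI) simp
    also have "\<dots> = ennreal C * ennreal (sqrt (\<integral>x. ?f x \<partial>lborel))"
      by (rule ennreal_mult) (auto simp: C_def)
    also have "\<dots> \<le> ennreal C * L2_norm U (\<lambda>y. H (Q y))"
      by (intro mult_left_mono L2_norm_ge AU pb(3) zero_le)
    finally show "ennreal (Q x0 * \<rho> (Q x0)) \<le> ennreal C * L2_norm U (\<lambda>y. H (Q y))" .
  qed
qed

end
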